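(* Let $E\subset\Bbbk[x,y]$ be a monomial ideal of colength $d$ with associated base $B$, spread-out matrix $\mathcal M$, family $\pi\colon\mathbf V(I_t(\mathcal M))\to B$ and resultant $\operatorname{res}_E\in\Bbbk[\mathbf a][y]$. Let $B'\subset B$ be the open complement of the common vanishing locus of all coefficients of $\operatorname{res}_E$ as a polynomial in $y$, and let $S\subset B'$ be the locally closed subscheme on which the resultant is a polynomial in $y$ of degree exactly $tm_t$ (that is, the coefficient of $y^{tm_t}$ is invertible and the coefficients of all higher powers of $y$ vanish). Then over $S$ the map $\pi$ is finite and flat.
   Context: Fix a field $\Bbbk$ and an integer $d\ge 1$. Spread-out matrix. Let $E$ be a monomial ideal of colength $d$, written as $E=(x^{t},x^{t-1}y^{m_1},\ldots,xy^{m_{t-1}},y^{m_t})$ with $t\ge 1$ and $0\le m_1\le\dots\le m_t$; put $m_0=0$ and $d_i=m_i-m_{i-1}\ge 0$. For $1\le i\le t+1$, $1\le j\le t$ let $D_{i,j}=d_j$ if $i>j$ and $D_{i,j}=d_i$ if $i\le j$. Let $\mathbf a=(a_{i,j,k})$, $0\le k<D_{i,j}$, be independent variables, and $a_{i,j}=\sum_{0\le k<D_{i,j}}a_{i,j,k}y^k$ (so $a_{i,j}=0$ if $D_{i,j}=0$). Put $B=\operatorname{Spec}\Bbbk[\mathbf a]$. The matrix $\mathcal M$ is the $(t+1)\times t$ matrix over $\Bbbk[\mathbf a][x,y]$ with $(i,i)$ entry $y^{d_i}+a_{i,i}$, $(i+1,i)$ entry $-x+a_{i+1,i}$, and all other $(i,j)$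 entries $a_{i,j}$. $I_t(\mathcal M)\subset\Bbbk[\mathbf a][x,y]$ is the ideal generated by the maximal minors of $\mathcal M$, and $\pi\colon \mathbf V(I_t(\mathcal M))\subset \mathbb A^2\times B\to B$ is the projection. Resultant. Let $f_0$ and $f_t$ be the first and last maximal minors of $\mathcal M$, i.e. the determinants of $\mathcal M$ with the first, respectively the last, row removed. They are regarded as polynomials in $x$ over $\Bbbk[\mathbf a,y]$ ($f_0$ is, up to sign, monic in $x$ of degree $t$), and $\operatorname{res}_E=\operatorname{res}_x(f_0,f_t)\in\Bbbk[\mathbf a,y]=\Bbbk[\mathbf a][y]$ is their resultant with respect to $x$. *)

theory Defs
  imports
    "HOL-Algebra.Algebra"
    "HOL-Algebra.Algebraic_Closure_Type"
    "Jordan_Normal_Form.Determinant"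
    "Subresultants.Resultant_Prelim"
begin

section \<open>Tensor products, finite and flat ring homomorphisms\<close>

definition linear_maps ::
    "('a, 'r) ring_scheme \<Rightarrow> ('a, 'p) module \<Rightarrow> ('a, 'n) module \<Rightarrow> ('p \<Rightarrow> 'n) set" where
  "linear_maps A N' N =
     {u \<in> carrier N' \<rightarrow> carrier N.
        (\<forall>x\<in>carrier N'. \<forall>y\<in>carrier N'. u (x \<oplus>\<^bsub>N'\<^esub> y) = u x \<oplus>\<^bsub>N\<^esub> u y) \<and>
        (\<forall>a\<in>carrier A. \<forall>x\<in>carrier N'. u (a \<odot>\<^bsub>N'\<^esub> x) = a \<odot>\<^bsub>N\<^esub> u x)}"

definition tensor_relators ::
    "('a, 'r) ring_scheme \<Rightarrow> ('a, 'n) module \<Rightarrow> ('a, 'b) module \<Rightarrow> ('n \<times> 'b \<Rightarrow>\<^sub>0 int) set" where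
  "tensor_relators A N M =
     {frag_of (x \<oplus>\<^bsub>N\<^esub> y, v) - frag_of (x, v) - frag_of (y, v) | x y v.
        x \<in> carrier N \<and> y \<in> carrier N \<and> v \<in> carrier M} \<union>
     {frag_of (x, v \<oplus>\<^bsub>M\<^esub> w) - frag_of (x, v) - frag_of (x, w) | x v w.
        x \<in> carrier N \<and> v \<in> carrier M \<and> w \<in> carrier M} \<union>
     {frag_of (a \<odot>\<^bsub>N\<^esub> x, v) - frag_of (x, a \<odot>\<^bsub>M\<^esub> v) | a x v.
        a \<in> carrier A \<and> x \<in> carrier N \<and> v \<in> carrier M}"

definition tensor_kernel ::
    "('a, 'r) ring_scheme \<Rightarrow> ('a, 'n) module \<Rightarrow> ('a, 'b) module \<Rightarrow> ('n \<times> 'b \<Rightarrow>\<^sub>0 int) set" where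
  "tensor_kernel A N M =
     generate (free_Abelian_group (carrier N \<times> carrier M)) (tensor_relators A N M)"

text \<open>The abelian group underlying \<open>N \<otimes>\<^sub>A M\<close>.\<close>

definition tensor ::
    "('a, 'r) ring_scheme \<Rightarrow> ('a, 'n) module \<Rightarrow> ('a, 'b) module \<Rightarrow>
     ('n \<times> 'b \<Rightarrow>\<^sub>0 int) set monoid" where
  "tensor A N M = free_Abelian_group (carrier N \<times> carrier M) Mod tensor_kernel A N M"

text \<open>The map \<open>u \<otimes> id : N' \<otimes>\<^sub>A M \<rightarrow> N \<otimes>\<^sub>A M\<close>.  Elements of \<open>N' \<otimes>\<^sub>A M\<close> are cosets; the union below
  runs over representatives \<open>c\<close> of the coset \<open>C\<close>, all of which yield the same coset.\<close>

definition tensor_map ::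
    "('a, 'r) ring_scheme \<Rightarrow> ('a, 'n) module \<Rightarrow> ('a, 'b) module \<Rightarrow> ('p \<Rightarrow> 'n) \<Rightarrow>
     ('p \<times> 'b \<Rightarrow>\<^sub>0 int) set \<Rightarrow> ('n \<times> 'b \<Rightarrow>\<^sub>0 int) set" where
  "tensor_map A N M u C =
     (\<Union>c\<in>C. r_coset (free_Abelian_group (carrier N \<times> carrier M)) (tensor_kernel A N M)
               (frag_extend (\<lambda>(x, v). frag_of (u x, v)) c))"

text \<open>Tensoring with \<open>M\<close> preserves injections \<open>N' \<rightarrow> N\<close>.  HOL cannot quantify over all types inside
  a definition, so the types of the elements of \<open>N'\<close> and \<open>N\<close> are parameters; they are to be left
  as free type variables.\<close>

definition flat_module ::
    "'p itself \<Rightarrow> 'n itself \<Rightarrow> ('a, 'r) ring_scheme \<Rightarrow> ('a, 'b) module \<Rightarrow> bool" where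
  "flat_module _ _ A M \<longleftrightarrow>
     Module.module A M \<and>
     (\<forall>(N' :: ('a, 'p) module) (N :: ('a, 'n) module) u.
        Module.module A N' \<longrightarrow> Module.module A N \<longrightarrow> u \<in> linear_maps A N' N \<longrightarrow> inj_on u (carrier N') \<longrightarrow>
        inj_on (tensor_map A N M u) (carrier (tensor A N' M)))"

definition finite_module :: "('a, 'r) ring_scheme \<Rightarrow> ('a, 'b) module \<Rightarrow> bool" where
  "finite_module A M \<longleftrightarrow>
     Module.module A M \<and>
     (\<exists>F. finite F \<and> F \<subseteq> carrier M \<and>
        (\<forall>x\<in>carrier M. \<exists>c\<in>F \<rightarrow> carrier A. x = (\<Oplus>\<^bsub>M\<^esub>v\<in>F. c v \<odot>\<^bsub>M\<^esub> v)))"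

text \<open>The target of a ring homomorphism \<open>\<rho>\<close> as a module over its source.\<close>

definition restrict_scalars :: "('b, 's) ring_scheme \<Rightarrow> ('a \<Rightarrow> 'b) \<Rightarrow> ('a, 'b) module" where
  "restrict_scalars Q \<rho> =
     \<lparr>carrier = carrier Q, monoid.mult = monoid.mult Q, one = one Q, ring.zero = ring.zero Q, add = add Q,
      module.smult = (\<lambda>a x. \<rho> a \<otimes>\<^bsub>Q\<^esub> x)\<rparr>"

text \<open>The morphism \<open>Spec Q \<rightarrow> Spec A\<close> given by \<open>\<rho>\<close> is finite, respectively flat.\<close>

definition finite_ring_hom ::
    "('a, 'r) ring_scheme \<Rightarrow> ('b, 's) ring_scheme \<Rightarrow> ('a \<Rightarrow> 'b) \<Rightarrow> bool" where
  "finite_ring_hom A Q \<rho> \<longleftrightarrow>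
     cring A \<and> cring Q \<and> \<rho> \<in> Ring.ring_hom A Q \<and> finite_module A (restrict_scalars Q \<rho>)"

definition flat_ring_hom ::
    "'p itself \<Rightarrow> 'n itself \<Rightarrow> ('a, 'r) ring_scheme \<Rightarrow> ('b, 's) ring_scheme \<Rightarrow> ('a \<Rightarrow> 'b) \<Rightarrow> bool" where
  "flat_ring_hom P N A Q \<rho> \<longleftrightarrow>
     cring A \<and> cring Q \<and> \<rho> \<in> Ring.ring_hom A Q \<and> flat_module P N A (restrict_scalars Q \<rho>)"


section \<open>Localization at a multiplicative set\<close>

definition fraction_rel :: "('a, 'r) ring_scheme \<Rightarrow> 'a set \<Rightarrow> (('a \<times> 'a) \<times> ('a \<times> 'a)) set" where
  "fraction_rel R W =
     {((r, w), (s, v)). r \<in> carrier R \<and> s \<in> carrier R \<and> w \<in> W \<and> v \<in> W \<and>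
        (\<exists>u\<in>W. u \<otimes>\<^bsub>R\<^esub> (r \<otimes>\<^bsub>R\<^esub> v) = u \<otimes>\<^bsub>R\<^esub> (s \<otimes>\<^bsub>R\<^esub> w))}"

text \<open>The class of \<open>(r, w)\<close> is the fraction \<open>r / w\<close>.\<close>

definition fraction :: "('a, 'r) ring_scheme \<Rightarrow> 'a set \<Rightarrow> 'a \<Rightarrow> 'a \<Rightarrow> ('a \<times> 'a) set" where
  "fraction R W r w = fraction_rel R W `` {(r, w)}"

definition localization :: "('a, 'r) ring_scheme \<Rightarrow> 'a set \<Rightarrow> ('a \<times> 'a) set ring" where
  "localization R W =
     \<lparr>carrier = (carrier R \<times> W) // fraction_rel R W,
      monoid.mult = (\<lambda>C C'. \<Union>(r, w)\<in>C. \<Union>(s, v)\<in>C'. fraction R W (r \<otimes>\<^bsub>R\<^esub> s) (w \<otimes>\<^bsub>R\<^esub> v)),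
      one = fraction R W \<one>\<^bsub>R\<^esub> \<one>\<^bsub>R\<^esub>,
      ring.zero = fraction R W \<zero>\<^bsub>R\<^esub> \<one>\<^bsub>R\<^esub>,
      add = (\<lambda>C C'. \<Union>(r, w)\<in>C. \<Union>(s, v)\<in>C'.
               fraction R W (r \<otimes>\<^bsub>R\<^esub> v \<oplus>\<^bsub>R\<^esub> s \<otimes>\<^bsub>R\<^esub> w) (w \<otimes>\<^bsub>R\<^esub> v))\<rparr>"


section \<open>Monomial ideals of finite colength in the polynomial ring in x and y\<close>

text \<open>Throughout, \<open>R[x, y]\<close> is rendered as \<open>R[y][x]\<close>, i.e. as \<open>'r poly poly\<close> (or \<open>UP (UP R)\<close>
  for a ring with a carrier) whose outer variable is \<open>x\<close> and whose inner variable is \<open>y\<close>.\<close>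

text \<open>The ideal \<open>(x^t, x^(t-1) y^(m 1), \<dots>, x y^(m (t-1)), y^(m t))\<close>, where \<open>m 0 = 0\<close>.\<close>

definition monomial_ideal :: "nat \<Rightarrow> (nat \<Rightarrow> nat) \<Rightarrow> 'k::field poly poly set" where
  "monomial_ideal t m =
     Idl\<^bsub>ring_of_type_algebra\<^esub>
       {Polynomial.monom (Polynomial.monom 1 (m i)) (t - i) | i. i \<le> t}"

definition has_colength :: "'k::field poly poly set \<Rightarrow> nat \<Rightarrow> bool" where
  "has_colength E d \<longleftrightarrow>
     ring.dimension (ring_of_type_algebra Quot E) d
       (range (\<lambda>c. E +>\<^bsub>ring_of_type_algebra\<^esub> [:[:c:]:])) (carrier (ring_of_type_algebra Quot E))"


section \<open>The spread-out matrix and the resultant\<close>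

text \<open>Polynomials over \<open>'k\<close> in the variables \<open>a\<^sub>i\<^sub>,\<^sub>j\<^sub>,\<^sub>k\<close> for all triples \<open>(i, j, k)\<close>;
  \<open>base_ring\<close> below cuts out those in the finitely many variables that occur in the matrix.\<close>

type_synonym 'k apoly = "(nat \<times> nat \<times> nat \<Rightarrow>\<^sub>0 nat) \<Rightarrow>\<^sub>0 'k"

definition a_var :: "nat \<Rightarrow> nat \<Rightarrow> nat \<Rightarrow> 'k::field apoly" where
  "a_var i j k = Poly_Mapping.single (Poly_Mapping.single (i, j, k) 1) 1"

text \<open>The truncated subtraction is harmless, since \<open>m\<close> will be nondecreasing.\<close>

definition step :: "(nat \<Rightarrow> nat) \<Rightarrow> nat \<Rightarrow> nat" where
  "step m i = m i - m (i - 1)"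

definition D_bound :: "(nat \<Rightarrow> nat) \<Rightarrow> nat \<Rightarrow> nat \<Rightarrow> nat" where
  "D_bound m i j = (if i > j then step m j else step m i)"

definition a_index :: "nat \<Rightarrow> (nat \<Rightarrow> nat) \<Rightarrow> (nat \<times> nat \<times> nat) set" where
  "a_index t m =
     {(i, j, k). 1 \<le> i \<and> i \<le> t + 1 \<and> 1 \<le> j \<and> j \<le> t \<and> k < D_bound m i j}"

text \<open>The coordinate ring of \<open>B\<close>.\<close>

definition base_ring :: "nat \<Rightarrow> (nat \<Rightarrow> nat) \<Rightarrow> 'k::field apoly ring" where
  "base_ring t m =
     ring_of_type_algebra\<lparr>carrier :=
       {p. \<forall>e\<in>Poly_Mapping.keys p. Poly_Mapping.keys e \<subseteq> a_index t m}\<rparr>"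

definition a_entry :: "(nat \<Rightarrow> nat) \<Rightarrow> nat \<Rightarrow> nat \<Rightarrow> 'k::field apoly poly" where
  "a_entry m i j = (\<Sum>k<D_bound m i j. Polynomial.monom (a_var i j k) k)"

text \<open>Matrix positions are counted from 0 in the library but from 1 in \<open>a_entry\<close>, \<open>step\<close>.\<close>

definition spread_out_matrix :: "nat \<Rightarrow> (nat \<Rightarrow> nat) \<Rightarrow> 'k::field apoly poly poly mat" where
  "spread_out_matrix t m = mat (t + 1) t (\<lambda>(i0, j0).
     let i = i0 + 1; j = j0 + 1 in
     if i = j then [:Polynomial.monom 1 (step m i) + a_entry m i i:]
     else if i = j + 1 then [:a_entry m i j, - 1:]
     else [:a_entry m i j:])"

text \<open>The maximal minor \<open>f\<^sub>l\<close>: row \<open>l\<close> (counted from 0) is removed.\<close>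

definition maximal_minor :: "nat \<Rightarrow> (nat \<Rightarrow> nat) \<Rightarrow> nat \<Rightarrow> 'k::field apoly poly poly" where
  "maximal_minor t m l =
     det (mat t t (\<lambda>(i, j). spread_out_matrix t m $$ (insert_index l i, j)))"

definition res_E :: "nat \<Rightarrow> (nat \<Rightarrow> nat) \<Rightarrow> 'k::field apoly poly" where
  "res_E t m = resultant (maximal_minor t m 0) (maximal_minor t m t)"


section \<open>The subscheme S and the family over it\<close>

text \<open>\<open>S\<close> is the principal open subscheme, given by the coefficient of \<open>y^(t * m t)\<close>, of the closed
  subscheme of \<open>B\<close> given by the coefficients of the higher powers of \<open>y\<close>; as one of the coefficients
  of the resultant is invertible on it, it lies in \<open>B'\<close>.  It is affine, with the following
  coordinate ring.\<close>

type_synonym 'k S_elem = "('k apoly set \<times> 'k apoly set) set"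

definition S_ideal :: "nat \<Rightarrow> (nat \<Rightarrow> nat) \<Rightarrow> 'k::field apoly set" where
  "S_ideal t m = Idl\<^bsub>base_ring t m\<^esub> {Polynomial.coeff (res_E t m) n | n. n > t * m t}"

definition S_denominators :: "nat \<Rightarrow> (nat \<Rightarrow> nat) \<Rightarrow> 'k::field apoly set set" where
  "S_denominators t m =
     range (\<lambda>n::nat. (S_ideal t m +>\<^bsub>base_ring t m\<^esub> Polynomial.coeff (res_E t m) (t * m t))
                       [^]\<^bsub>base_ring t m Quot S_ideal t m\<^esub> n)"

definition S_ring :: "nat \<Rightarrow> (nat \<Rightarrow> nat) \<Rightarrow> 'k::field S_elem ring" where
  "S_ring t m = localization (base_ring t m Quot S_ideal t m) (S_denominators t m)"

text \<open>The restriction of functions from \<open>B\<close> to \<open>S\<close>.\<close>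

definition to_S :: "nat \<Rightarrow> (nat \<Rightarrow> nat) \<Rightarrow> 'k::field apoly \<Rightarrow> 'k S_elem" where
  "to_S t m p =
     fraction (base_ring t m Quot S_ideal t m) (S_denominators t m)
       (S_ideal t m +>\<^bsub>base_ring t m\<^esub> p) \<one>\<^bsub>base_ring t m Quot S_ideal t m\<^esub>"

text \<open>The base change of the family along \<open>S \<rightarrow> B\<close> is the closed subscheme of the affine plane over
  \<open>S\<close> whose ideal is generated by the images of the maximal minors.\<close>

definition minors_S :: "nat \<Rightarrow> (nat \<Rightarrow> nat) \<Rightarrow> (nat \<Rightarrow> nat \<Rightarrow> 'k::field S_elem) set" where
  "minors_S t m =
     Idl\<^bsub>UP (UP (S_ring t m))\<^esub>
       {(\<lambda>i j. to_S t m (Polynomial.coeff (Polynomial.coeff (maximal_minor t m l) i) j)) | l. l \<le> t}"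

definition family_ring ::
    "nat \<Rightarrow> (nat \<Rightarrow> nat) \<Rightarrow> (nat \<Rightarrow> nat \<Rightarrow> 'k::field S_elem) set ring" where
  "family_ring t m = UP (UP (S_ring t m)) Quot minors_S t m"

text \<open>The homomorphism of coordinate rings that corresponds to the restriction of \<open>\<pi>\<close> over \<open>S\<close>.\<close>

definition pi_S ::
    "nat \<Rightarrow> (nat \<Rightarrow> nat) \<Rightarrow> 'k::field S_elem \<Rightarrow> (nat \<Rightarrow> nat \<Rightarrow> 'k S_elem) set" where
  "pi_S t m a =
     minors_S t m +>\<^bsub>UP (UP (S_ring t m))\<^esub>
       up_ring.monom (UP (UP (S_ring t m))) (up_ring.monom (UP (S_ring t m)) a 0) 0"

end

theory Submission
  imports Defs "Jordan_Normal_Form.Char_Poly"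
begin

text \<open>
  Write \<open>A\<close> for the coordinate ring of \<open>S\<close>, \<open>I\<close> for the ideal of \<open>A[x, y]\<close> generated by the maximal
  minors \<open>f 0, \<dots>, f t\<close>, and \<open>Q = A[x, y] / I\<close>.  The theorem follows from a finite dual basis of \<open>Q\<close>
  over \<open>A\<close>: finitely many \<open>e j\<close> in \<open>Q\<close> and linear forms \<open>\<psi> j\<close> on \<open>Q\<close> such that every \<open>v\<close> equals
  \<open>\<Sum>j. \<psi> j v \<cdot> e j\<close>.  The \<open>e j\<close> generate, and \<open>Q\<close> is flat because the contractions \<open>id \<otimes> \<psi> j\<close> recover
  an element of \<open>N \<otimes> Q\<close> from finitely many elements of \<open>N\<close>
  (\<open>finite_dual_basis.finite_module\<close>, \<open>finite_dual_basis.flat_module\<close>).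

  Up to sign, \<open>f 0\<close> is monic in \<open>x\<close> of degree \<open>t\<close>, so that \<open>A[x, y] / (f 0)\<close> is free over \<open>A[y]\<close> with basis
  \<open>1, \<dots>, x^(t-1)\<close>.  The columns of the matrix are, up to signs, relations between the minors; they express each
  \<open>x * f l\<close>, \<open>l \<ge> 1\<close>, through \<open>f 0, \<dots>, f t\<close> with coefficients in \<open>A[y]\<close>.  Hence the image of \<open>I\<close> in this
  free module is spanned over \<open>A[y]\<close> by the classes of \<open>f 1, \<dots>, f t\<close>, and \<open>Q\<close> is the cokernel of a square
  matrix \<open>\<Phi>\<close> over \<open>A[y]\<close>.  The resultant \<open>r\<close> lies in the ideal \<open>(f 0, f t)\<close>, so \<open>\<Phi> Y = r\<close> for some matrix
  \<open>Y\<close>; as \<open>det \<Phi> det Y = r^t\<close>, the matrix \<open>\<Phi>' = y det Y adj \<Phi>\<close> satisfies \<open>\<Phi> \<Phi>' = \<Phi>' \<Phi> = \<rho>\<close> with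
  \<open>\<rho> = y r^t\<close>.

  Over \<open>S\<close> the polynomial \<open>\<rho>\<close> has a unit as its leading coefficient, so \<open>\<rho>\<close> and \<open>\<Phi>\<close> become invertible over
  the Laurent series in \<open>1/y\<close>.  The map that sends \<open>p\<close> to \<open>\<Phi>\<close> times the polynomial part of \<open>\<Phi>\<^sup>-\<^sup>1 p\<close> is an
  \<open>A\<close>-linear retraction of \<open>A[y]^t\<close> onto the image of \<open>\<Phi>\<close>: this is why \<open>Q\<close> is a direct summand of a free
  module.  In coordinates, let \<open>\<lambda>(p)\<close> be the coefficient of \<open>1/y\<close> in \<open>p / \<rho>\<close>.  The linear forms
  \<open>p \<mapsto> \<lambda>(y^i (\<Phi>' p)\<^sub>k)\<close> kill the image of \<open>\<Phi>\<close>, because \<open>\<lambda>\<close> kills the multiples of \<open>\<rho>\<close>; the vector dual to the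
  form with index \<open>(k, i)\<close> is the coefficient of \<open>z^i\<close> in column \<open>k\<close> of \<open>(\<Phi>(z) - \<Phi>(y)) / (z - y)\<close>.  That these
  form a dual basis comes down to the product rule for the difference quotient \<open>(p(z) - p(y)) / (z - y)\<close>
  and to the fact that \<open>\<lambda>\<close>, applied in \<open>z\<close>, sends this quotient for \<open>p = \<rho>\<close> to \<open>1\<close>.

  Everything that does not involve \<open>\<lambda>\<close> is an identity between polynomials over the ring of all
  \<open>a\<^sub>i\<^sub>,\<^sub>j\<^sub>,\<^sub>k\<close>, and is proved over an arbitrary commutative ring (\<open>determinantal_generators.dual_data\<close>).  It is
  carried to \<open>A\<close> along a ring homomorphism \<open>h\<close>, and \<open>\<lambda>\<close> enters as a sequence of elements of \<open>A\<close> that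
  satisfies the linear recurrence given by the coefficients of \<open>\<rho>\<close>
  (\<open>unit_resultant_family.dual_basis_exists\<close>).
\<close>

section \<open>Finite dual bases and flatness\<close>

lemma tensor_relators_closed:
  assumes "Module.module A N" "Module.module A M"
  shows "tensor_relators A N M \<subseteq> carrier (free_Abelian_group (carrier N \<times> carrier M))"
proof -
  interpret N: Module.module A N by fact
  interpret M: Module.module A M by fact
  show ?thesis unfolding tensor_relators_def by (auto dest!: set_mp[OF keys_diff])
qed

lemma tensor_kernel_subgroup:
  assumes "Module.module A N" "Module.module A M"
  shows "subgroup (tensor_kernel A N M) (free_Abelian_group (carrier N \<times> carrier M))"
  unfolding tensor_kernel_def
  by (intro group.generate_is_subgroup tensor_relators_closed assms) simp

lemma tensor_kernel_minus:
  assumes "Module.module A N" "Module.module A M"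
    and "c \<in> tensor_kernel A N M" "d \<in> tensor_kernel A N M"
  shows "c - d \<in> tensor_kernel A N M"
proof -
  note sg = tensor_kernel_subgroup[OF assms(1,2)]
  have "- d \<in> tensor_kernel A N M"
    using subgroup.m_inv_closed[OF sg assms(4)] subgroup.mem_carrier[OF sg assms(4)] by simp
  then show ?thesis using subgroup.m_closed[OF sg assms(3)] by force
qed

lemma tensor_kernel_zero:
  assumes "Module.module A N" "Module.module A M"
  shows "0 \<in> tensor_kernel A N M"
  using subgroup.one_closed[OF tensor_kernel_subgroup[OF assms]] by simp

lemma tensor_kernel_plus:
  assumes "Module.module A N" "Module.module A M"
    and "c \<in> tensor_kernel A N M" "d \<in> tensor_kernel A N M"
  shows "c + d \<in> tensor_kernel A N M"
  using subgroup.m_closed[OF tensor_kernel_subgroup[OF assms(1,2)] assms(3,4)] by simp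

lemma tensor_kernel_uminus_iff:
  assumes "Module.module A N" "Module.module A M"
  shows "c - d \<in> tensor_kernel A N M \<longleftrightarrow> d - c \<in> tensor_kernel A N M"
  using tensor_kernel_minus[OF assms tensor_kernel_zero[OF assms], of "c - d"]
    tensor_kernel_minus[OF assms tensor_kernel_zero[OF assms], of "d - c"] by auto

lemma tensor_kernel_relators:
  assumes "r \<in> tensor_relators A N M" shows "r \<in> tensor_kernel A N M"
  unfolding tensor_kernel_def by (rule generate.incl[OF assms])

lemma tensor_kernel_frag_zero_left:
  assumes N: "Module.module A N" and M: "Module.module A M" and v: "v \<in> carrier M"
  shows "frag_of (\<zero>\<^bsub>N\<^esub>, v) \<in> tensor_kernel A N M"
proof -
  interpret N: Module.module A N by fact
  have "frag_of (\<zero>\<^bsub>N\<^esub> \<oplus>\<^bsub>N\<^esub> \<zero>\<^bsub>N\<^esub>, v) - frag_of (\<zero>\<^bsub>N\<^esub>, v) - frag_of (\<zero>\<^bsub>N\<^esub>, v) \<in> tensor_kernel A N M"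
    by (rule tensor_kernel_relators) (use v in \<open>unfold tensor_relators_def, blast\<close>)
  then have "0 - frag_of (\<zero>\<^bsub>N\<^esub>, v) \<in> tensor_kernel A N M" by simp
  then show ?thesis using tensor_kernel_minus[OF N M tensor_kernel_zero[OF N M]] by force
qed

lemma tensor_kernel_frag_zero_right:
  assumes N: "Module.module A N" and M: "Module.module A M" and x: "x \<in> carrier N"
  shows "frag_of (x, \<zero>\<^bsub>M\<^esub>) \<in> tensor_kernel A N M"
proof -
  interpret M: Module.module A M by fact
  have "frag_of (x, \<zero>\<^bsub>M\<^esub> \<oplus>\<^bsub>M\<^esub> \<zero>\<^bsub>M\<^esub>) - frag_of (x, \<zero>\<^bsub>M\<^esub>) - frag_of (x, \<zero>\<^bsub>M\<^esub>) \<in> tensor_kernel A N M"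
    by (rule tensor_kernel_relators) (use x in \<open>unfold tensor_relators_def, blast\<close>)
  then have "0 - frag_of (x, \<zero>\<^bsub>M\<^esub>) \<in> tensor_kernel A N M" by simp
  then show ?thesis using tensor_kernel_minus[OF N M tensor_kernel_zero[OF N M]] by force
qed

lemma tensor_kernel_diff_left:
  assumes N: "Module.module A N" and M: "Module.module A M"
    and "x \<in> carrier N" "y \<in> carrier N" "v \<in> carrier M"
  shows "frag_of (x \<ominus>\<^bsub>N\<^esub> y, v) - (frag_of (x, v) - frag_of (y, v)) \<in> tensor_kernel A N M"
proof -
  interpret N: Module.module A N by fact
  have xy: "(x \<ominus>\<^bsub>N\<^esub> y) \<oplus>\<^bsub>N\<^esub> y = x" using assms(3,4)
    by (simp add: N.minus_eq N.a_assoc N.l_neg)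
  have "frag_of ((x \<ominus>\<^bsub>N\<^esub> y) \<oplus>\<^bsub>N\<^esub> y, v) - frag_of (x \<ominus>\<^bsub>N\<^esub> y, v) - frag_of (y, v) \<in> tensor_kernel A N M"
    by (rule tensor_kernel_relators) (use assms N.minus_closed in \<open>unfold tensor_relators_def, blast\<close>)
  then have "(frag_of (x, v) - frag_of (y, v)) - frag_of (x \<ominus>\<^bsub>N\<^esub> y, v) \<in> tensor_kernel A N M"
    by (simp add: xy algebra_simps)
  then show ?thesis using tensor_kernel_uminus_iff[OF N M] by blast
qed

lemma tensor_kernel_finsum_right:
  assumes N: "Module.module A N" and M: "Module.module A M" and x: "x \<in> carrier N"
    and "finite J" "g \<in> J \<rightarrow> carrier M"
  shows "frag_of (x, \<Oplus>\<^bsub>M\<^esub>j\<in>J. g j) - (\<Sum>j\<in>J. frag_of (x, g j)) \<in> tensor_kernel A N M"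
  using assms(4,5)
proof (induction J rule: finite_induct)
  interpret M: Module.module A M by fact
  case empty
  then show ?case using tensor_kernel_frag_zero_right[OF N M x] by simp
next
  interpret M: Module.module A M by fact
  case (insert j J)
  let ?s = "\<Oplus>\<^bsub>M\<^esub>j\<in>J. g j"
  have cl: "g j \<in> carrier M" "?s \<in> carrier M" using insert by auto
  have "frag_of (x, g j \<oplus>\<^bsub>M\<^esub> ?s) - frag_of (x, g j) - frag_of (x, ?s) \<in> tensor_kernel A N M"
    by (rule tensor_kernel_relators) (use x cl in \<open>unfold tensor_relators_def, blast\<close>)
  from tensor_kernel_plus[OF N M this insert.IH] insert
  show ?case by (simp add: algebra_simps Pi_def)
qed

lemma hom_free_Abelian_group_diff:
  assumes G: "abelian_group G" and g: "g \<in> hom (free_Abelian_group S) (add_monoid G)"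
    and c: "c \<in> carrier (free_Abelian_group S)" and d: "d \<in> carrier (free_Abelian_group S)"
  shows "g (c - d) = g c \<ominus>\<^bsub>G\<^esub> g d"
proof -
  interpret G: abelian_group G by fact
  interpret g: group_hom "free_Abelian_group S" "add_monoid G" g
    using g by (auto simp: group_hom_def group_hom_axioms_def G.add.is_group)
  have cd: "c - d \<in> carrier (free_Abelian_group S)" using keys_diff[of c d] c d by auto
  have "g c = g ((c - d) \<otimes>\<^bsub>free_Abelian_group S\<^esub> d)" by simp
  also have "\<dots> = g (c - d) \<oplus>\<^bsub>G\<^esub> g d"
    using d cd g.hom_mult[of "c - d" d] by auto
  finally show ?thesis
    using d cd g.hom_closed[of "c - d"] g.hom_closed[of d]
    by (auto simp: G.minus_eq G.a_assoc G.r_neg)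
qed

text \<open>Equivalently, \<open>M\<close> is a direct summand of a finite free module.\<close>

locale finite_dual_basis = Module.module A M for A (structure) and M :: "('a, 'b) module" +
  fixes J :: "'j set" and e :: "'j \<Rightarrow> 'b" and \<psi> :: "'j \<Rightarrow> 'b \<Rightarrow> 'a"
  assumes finite_index: "finite J"
    and basis_closed: "j \<in> J \<Longrightarrow> e j \<in> carrier M"
    and coord_closed: "j \<in> J \<Longrightarrow> v \<in> carrier M \<Longrightarrow> \<psi> j v \<in> carrier A"
    and coord_add: "j \<in> J \<Longrightarrow> v \<in> carrier M \<Longrightarrow> w \<in> carrier M \<Longrightarrow> \<psi> j (v \<oplus>\<^bsub>M\<^esub> w) = \<psi> j v \<oplus> \<psi> j w"
    and coord_smult: "j \<in> J \<Longrightarrow> a \<in> carrier A \<Longrightarrow> v \<in> carrier M \<Longrightarrow> \<psi> j (a \<odot>\<^bsub>M\<^esub> v) = a \<otimes> \<psi> j v"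
    and expansion: "v \<in> carrier M \<Longrightarrow> v = (\<Oplus>\<^bsub>M\<^esub>j\<in>J. \<psi> j v \<odot>\<^bsub>M\<^esub> e j)"
begin

lemma finite_module: "finite_module A M"
  unfolding finite_module_def
proof (intro conjI exI[of _ "e ` J"] ballI)
  show "Module.module A M" by (rule module_axioms)
  show "finite (e ` J)" using finite_index by simp
  show sub: "e ` J \<subseteq> carrier M" using basis_closed by auto
  \<comment> \<open>The family \<open>e\<close> may repeat elements, so coefficients have to be collected over its image.  The
    set \<open>S\<close> of all combinations is closed under addition, which reduces this to a single term.\<close>
  define S where "S = {x. \<exists>c\<in>e ` J \<rightarrow> carrier A. x = (\<Oplus>\<^bsub>M\<^esub>v\<in>e ` J. c v \<odot>\<^bsub>M\<^esub> v)}"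
  have add: "x \<oplus>\<^bsub>M\<^esub> y \<in> S" if xy: "x \<in> S" "y \<in> S" for x y
  proof -
    from xy obtain c d where c: "c \<in> e ` J \<rightarrow> carrier A" "x = (\<Oplus>\<^bsub>M\<^esub>v\<in>e ` J. c v \<odot>\<^bsub>M\<^esub> v)"
      and d: "d \<in> e ` J \<rightarrow> carrier A" "y = (\<Oplus>\<^bsub>M\<^esub>v\<in>e ` J. d v \<odot>\<^bsub>M\<^esub> v)" unfolding S_def by auto
    have "x \<oplus>\<^bsub>M\<^esub> y = (\<Oplus>\<^bsub>M\<^esub>v\<in>e ` J. c v \<odot>\<^bsub>M\<^esub> v \<oplus>\<^bsub>M\<^esub> d v \<odot>\<^bsub>M\<^esub> v)"
      unfolding c(2) d(2) by (rule M.finsum_addf[symmetric]) (use sub c d in \<open>auto simp: Pi_def\<close>)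
    also have "\<dots> = (\<Oplus>\<^bsub>M\<^esub>v\<in>e ` J. (c v \<oplus> d v) \<odot>\<^bsub>M\<^esub> v)"
      by (rule M.finsum_cong') (use sub c d in \<open>auto simp: Pi_def smult_l_distr\<close>)
    finally show ?thesis unfolding S_def using c d by (auto intro!: bexI[of _ "\<lambda>v. c v \<oplus> d v"])
  qed
  have zero: "\<zero>\<^bsub>M\<^esub> \<in> S"
  proof -
    have "(\<Oplus>\<^bsub>M\<^esub>v\<in>e ` J. \<zero> \<odot>\<^bsub>M\<^esub> v) = \<zero>\<^bsub>M\<^esub>"
      by (rule M.add.finprod_one_eqI) (use sub in auto)
    then show ?thesis unfolding S_def by (auto intro!: bexI[of _ "\<lambda>v. \<zero>"])
  qed
  have gen: "a \<odot>\<^bsub>M\<^esub> e j \<in> S" if a: "a \<in> carrier A" "j \<in> J" for a j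
  proof -
    have "(\<Oplus>\<^bsub>M\<^esub>v\<in>e ` J. (if e j = v then a \<odot>\<^bsub>M\<^esub> v else \<zero>\<^bsub>M\<^esub>)) = a \<odot>\<^bsub>M\<^esub> e j"
      using M.add.finprod_singleton[of "e j" "e ` J" "\<lambda>v. a \<odot>\<^bsub>M\<^esub> v"] a sub finite_index by auto
    moreover have "(\<Oplus>\<^bsub>M\<^esub>v\<in>e ` J. (if e j = v then a else \<zero>) \<odot>\<^bsub>M\<^esub> v) =
        (\<Oplus>\<^bsub>M\<^esub>v\<in>e ` J. (if e j = v then a \<odot>\<^bsub>M\<^esub> v else \<zero>\<^bsub>M\<^esub>))"
      by (rule M.finsum_cong') (use sub a in \<open>auto simp: Pi_def\<close>)
    ultimately show ?thesis unfolding S_def using a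
      by (auto intro!: bexI[of _ "\<lambda>v. if e j = v then a else \<zero>"])
  qed
  have sum: "(\<Oplus>\<^bsub>M\<^esub>j\<in>I. g j \<odot>\<^bsub>M\<^esub> e j) \<in> S" if "finite I" "I \<subseteq> J" "g \<in> I \<rightarrow> carrier A" for I g
    using that
  proof (induction I rule: finite_induct)
    case empty then show ?case using zero by simp
  next
    case (insert i I)
    then show ?case using basis_closed by (subst M.finsum_insert) (auto simp: Pi_def intro!: add gen)
  qed
  fix x assume x: "x \<in> carrier M"
  then have "x \<in> S" using sum[of J "\<lambda>j. \<psi> j x"] finite_index coord_closed expansion by auto
  then show "\<exists>c\<in>e ` J \<rightarrow> carrier A. x = (\<Oplus>\<^bsub>M\<^esub>v\<in>e ` J. c v \<odot>\<^bsub>M\<^esub> v)" unfolding S_def by auto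
qed

text \<open>The map \<open>id \<otimes> \<psi> j : N \<otimes> M \<rightarrow> N\<close>, on representatives.\<close>

lemma contraction:
  assumes N: "Module.module A N" and j: "j \<in> J"
  obtains h where "h \<in> hom (free_Abelian_group (carrier N \<times> carrier M)) (add_monoid N)"
    and "\<And>x v. x \<in> carrier N \<Longrightarrow> v \<in> carrier M \<Longrightarrow> h (frag_of (x, v)) = \<psi> j v \<odot>\<^bsub>N\<^esub> x"
    and "\<And>c. c \<in> tensor_kernel A N M \<Longrightarrow> h c = \<zero>\<^bsub>N\<^esub>"
proof -
  interpret N: Module.module A N by fact
  let ?F = "free_Abelian_group (carrier N \<times> carrier M)"
  have "(\<lambda>(x, v). \<psi> j v \<odot>\<^bsub>N\<^esub> x) ` (carrier N \<times> carrier M) \<subseteq> carrier N"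
    using coord_closed[OF j] by auto
  from N.add.free_Abelian_group_universal[OF this] obtain h
    where h: "h \<in> hom ?F (add_monoid N)"
      and "\<And>p. p \<in> carrier N \<times> carrier M \<Longrightarrow> h (frag_of p) = (case p of (x, v) \<Rightarrow> \<psi> j v \<odot>\<^bsub>N\<^esub> x)" by blast
  then have hf: "h (frag_of (x, v)) = \<psi> j v \<odot>\<^bsub>N\<^esub> x" if "x \<in> carrier N" "v \<in> carrier M" for x v
    using that by force
  interpret h: group_hom ?F "add_monoid N" h
    using h by (auto simp: group_hom_def group_hom_axioms_def N.add.is_group)
  have hd: "h (c - d) = h c \<ominus>\<^bsub>N\<^esub> h d" if "c \<in> carrier ?F" "d \<in> carrier ?F" for c d
    using hom_free_Abelian_group_diff[OF N.abelian_group_axioms h that] .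
  have cancel: "p \<oplus>\<^bsub>N\<^esub> q \<ominus>\<^bsub>N\<^esub> p \<ominus>\<^bsub>N\<^esub> q = \<zero>\<^bsub>N\<^esub>" if "p \<in> carrier N" "q \<in> carrier N" for p q
    using that N.r_neg[of "p \<oplus>\<^bsub>N\<^esub> q"] by (simp add: N.minus_eq N.a_assoc N.minus_add)
  have kdiff: "c - d \<in> carrier ?F" if "c \<in> carrier ?F" "d \<in> carrier ?F" for c d
    using that keys_diff[of c d] by auto
  have fr: "frag_of (x, v) \<in> carrier ?F" if "x \<in> carrier N" "v \<in> carrier M" for x v
    using that by simp
  have rel: "tensor_relators A N M \<subseteq> kernel ?F (add_monoid N) h"
  proof
    fix r assume r: "r \<in> tensor_relators A N M"
    then consider
        (l) x y v where "r = frag_of (x \<oplus>\<^bsub>N\<^esub> y, v) - frag_of (x, v) - frag_of (y, v)"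
          "x \<in> carrier N" "y \<in> carrier N" "v \<in> carrier M"
      | (r) x v w where "r = frag_of (x, v \<oplus>\<^bsub>M\<^esub> w) - frag_of (x, v) - frag_of (x, w)"
          "x \<in> carrier N" "v \<in> carrier M" "w \<in> carrier M"
      | (s) a x v where "r = frag_of (a \<odot>\<^bsub>N\<^esub> x, v) - frag_of (x, a \<odot>\<^bsub>M\<^esub> v)"
          "a \<in> carrier A" "x \<in> carrier N" "v \<in> carrier M"
      unfolding tensor_relators_def by blast
    then have "h r = \<zero>\<^bsub>N\<^esub>"
    proof cases
      case l
      show ?thesis using l(2-) coord_closed[OF j] unfolding l(1)
        by (subst hd; (intro kdiff fr)?; (subst hd)?)
           (auto simp: hf N.smult_r_distr cancel)
    next
      case r
      show ?thesis using r(2-) coord_closed[OF j] unfolding r(1)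
        by (subst hd; (intro kdiff fr)?; (subst hd)?)
           (auto simp: hf coord_add[OF j] N.smult_l_distr cancel)
    next
      case s
      show ?thesis using s(2-) coord_closed[OF j] unfolding s(1)
        by (subst hd)
           (auto simp: hf coord_smult[OF j] N.smult_assoc1 [symmetric] m_comm N.minus_eq N.r_neg)
    qed
    then show "r \<in> kernel ?F (add_monoid N) h"
      using subsetD[OF tensor_relators_closed[OF N module_axioms] r] by (simp add: kernel_def)
  qed
  have "tensor_kernel A N M \<subseteq> kernel ?F (add_monoid N) h"
    unfolding tensor_kernel_def
    by (rule h.G.generate_subgroup_incl[OF rel h.subgroup_kernel])
  then have "h c = \<zero>\<^bsub>N\<^esub>" if "c \<in> tensor_kernel A N M" for c
    using that by (auto simp: kernel_def)
  then show thesis using that h hf by blast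
qed

text \<open>Contraction is natural in \<open>N\<close>, so an injection \<open>u\<close> cannot identify two elements of \<open>N' \<otimes> M\<close> with
  different contractions; by the expansion in the dual basis, elements of \<open>N' \<otimes> M\<close> with equal
  contractions are equal.\<close>

lemma flat_module: "flat_module P N A M"
  unfolding flat_module_def
proof (intro conjI allI impI)
  show "Module.module A M" by (rule module_axioms)
next
  fix N' :: "('a, 'p) module" and N :: "('a, 'n) module" and u
  assume N': "Module.module A N'" and N: "Module.module A N"
    and u: "u \<in> linear_maps A N' N" and inj: "inj_on u (carrier N')"
  interpret N': Module.module A N' by fact
  interpret N: Module.module A N by fact
  let ?F = "free_Abelian_group (carrier N \<times> carrier M)"
  let ?F' = "free_Abelian_group (carrier N' \<times> carrier M)"
  let ?K = "tensor_kernel A N M" and ?K' = "tensor_kernel A N' M"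
  let ?u = "frag_extend (\<lambda>(x, v). frag_of (u x, v))"
  have uc: "u x \<in> carrier N" if "x \<in> carrier N'" for x using u that unfolding linear_maps_def by auto
  have us: "u (a \<odot>\<^bsub>N'\<^esub> x) = a \<odot>\<^bsub>N\<^esub> u x" if "a \<in> carrier A" "x \<in> carrier N'" for a x
    using u that unfolding linear_maps_def by auto
  have ua: "u (x \<oplus>\<^bsub>N'\<^esub> y) = u x \<oplus>\<^bsub>N\<^esub> u y" if "x \<in> carrier N'" "y \<in> carrier N'" for x y
    using u that unfolding linear_maps_def by auto
  have uh: "u \<in> hom (add_monoid N') (add_monoid N)"
    using uc ua by (auto simp: hom_def)
  have uz: "u \<zero>\<^bsub>N'\<^esub> = \<zero>\<^bsub>N\<^esub>"
    using hom_one[OF uh N'.add.is_group N.add.is_group] by simp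
  have "\<exists>h. h \<in> hom ?F (add_monoid N) \<and>
      (\<forall>x\<in>carrier N. \<forall>v\<in>carrier M. h (frag_of (x, v)) = \<psi> j v \<odot>\<^bsub>N\<^esub> x) \<and> (\<forall>c\<in>?K. h c = \<zero>\<^bsub>N\<^esub>)"
    if "j \<in> J" for j using contraction[OF N that] by metis
  then obtain h where h: "\<And>j. j \<in> J \<Longrightarrow> h j \<in> hom ?F (add_monoid N)"
    and hf: "\<And>j x v. j \<in> J \<Longrightarrow> x \<in> carrier N \<Longrightarrow> v \<in> carrier M \<Longrightarrow> h j (frag_of (x, v)) = \<psi> j v \<odot>\<^bsub>N\<^esub> x"
    and hk: "\<And>j c. j \<in> J \<Longrightarrow> c \<in> ?K \<Longrightarrow> h j c = \<zero>\<^bsub>N\<^esub>" by metis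
  have "\<exists>h. h \<in> hom ?F' (add_monoid N') \<and>
      (\<forall>x\<in>carrier N'. \<forall>v\<in>carrier M. h (frag_of (x, v)) = \<psi> j v \<odot>\<^bsub>N'\<^esub> x)"
    if "j \<in> J" for j using contraction[OF N' that] by metis
  then obtain h' where h': "\<And>j. j \<in> J \<Longrightarrow> h' j \<in> hom ?F' (add_monoid N')"
    and hf': "\<And>j x v. j \<in> J \<Longrightarrow> x \<in> carrier N' \<Longrightarrow> v \<in> carrier M \<Longrightarrow> h' j (frag_of (x, v)) = \<psi> j v \<odot>\<^bsub>N'\<^esub> x" by metis
  have hz': "h' j 0 = \<zero>\<^bsub>N'\<^esub>" if "j \<in> J" for j
    using hom_one[OF h'[OF that]] N'.add.is_group by simp
  have hz: "h j 0 = \<zero>\<^bsub>N\<^esub>" if "j \<in> J" for j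
    using hom_one[OF h[OF that]] N.add.is_group by simp
  have hc': "h' j c \<in> carrier N'" if "j \<in> J" "Poly_Mapping.keys c \<subseteq> carrier N' \<times> carrier M" for j c
    using h'[OF that(1)] that(2) by (auto simp: hom_def)
  have hc: "h j c \<in> carrier N" if "j \<in> J" "Poly_Mapping.keys c \<subseteq> carrier N \<times> carrier M" for j c
    using h[OF that(1)] that(2) by (auto simp: hom_def)
  have ukeys: "Poly_Mapping.keys (?u c) \<subseteq> carrier N \<times> carrier M"
    if "Poly_Mapping.keys c \<subseteq> carrier N' \<times> carrier M" for c
    by (rule order_trans[OF keys_frag_extend]) (use that uc in auto)
  have comm: "h j (?u c) = u (h' j c)" if j: "j \<in> J" and c: "Poly_Mapping.keys c \<subseteq> carrier N' \<times> carrier M" for j c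
    using c
  proof (induction c rule: free_Abelian_group_induct [consumes 1])
    case 1 then show ?case using j by (simp add: hz hz' uz)
  next
    case (2 x y)
    have "u (h' j x \<ominus>\<^bsub>N'\<^esub> h' j y) = u (h' j x) \<ominus>\<^bsub>N\<^esub> u (h' j y)"
      using hc'[OF j 2(1)] hc'[OF j 2(2)] ua[of "h' j x" "\<ominus>\<^bsub>N'\<^esub> h' j y"]
        group_hom.hom_inv[of "add_monoid N'" "add_monoid N" u "h' j y"] uh N'.add.is_group N.add.is_group
      by (auto simp: N'.minus_eq N.minus_eq group_hom_def group_hom_axioms_def a_inv_def)
    then show ?case using 2 ukeys
      by (simp add: frag_extend_diff hom_free_Abelian_group_diff[OF N.abelian_group_axioms h[OF j]]
          hom_free_Abelian_group_diff[OF N'.abelian_group_axioms h'[OF j]])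
  next
    case (3 p)
    then show ?case using j by (cases p) (auto simp: hf hf' us uc coord_closed)
  qed
  have sumK: "(\<Sum>j\<in>I. g j) \<in> ?K'" if "\<And>j. j \<in> I \<Longrightarrow> g j \<in> ?K'" for g and I :: "'j set"
      using that by (induction I rule: infinite_finite_induct)
        (auto intro: tensor_kernel_zero tensor_kernel_plus N' module_axioms)
  have expand: "c - (\<Sum>j\<in>J. frag_of (h' j c, e j)) \<in> ?K'" if c: "Poly_Mapping.keys c \<subseteq> carrier N' \<times> carrier M" for c
    using c
  proof (induction c rule: free_Abelian_group_induct [consumes 1])
    case 1
      have "(\<Sum>j\<in>J. frag_of (h' j 0, e j)) \<in> ?K'"
        by (rule sumK) (simp add: hz' tensor_kernel_frag_zero_left[OF N' module_axioms] basis_closed)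
      then show ?case using tensor_kernel_minus[OF N' module_axioms tensor_kernel_zero[OF N' module_axioms]] by force
    next
      case (2 x y)
      have d: "(\<Sum>j\<in>J. frag_of (h' j (x - y), e j) - (frag_of (h' j x, e j) - frag_of (h' j y, e j))) \<in> ?K'"
        by (rule sumK) (auto simp: hom_free_Abelian_group_diff[OF N'.abelian_group_axioms h'] 2 hc' 2
          intro!: tensor_kernel_diff_left N' module_axioms basis_closed)
      have "((x - (\<Sum>j\<in>J. frag_of (h' j x, e j))) - (y - (\<Sum>j\<in>J. frag_of (h' j y, e j)))) -
        (\<Sum>j\<in>J. frag_of (h' j (x - y), e j) - (frag_of (h' j x, e j) - frag_of (h' j y, e j))) \<in> ?K'"
        by (intro tensor_kernel_minus[OF N' module_axioms] d 2)
      then show ?case by (simp add: sum_subtractf sum.distrib algebra_simps)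
    next
      case (3 p)
      then obtain x v where p: "p = (x, v)" and x: "x \<in> carrier N'" and v: "v \<in> carrier M" by auto
      have "frag_of (x, \<Oplus>\<^bsub>M\<^esub>j\<in>J. \<psi> j v \<odot>\<^bsub>M\<^esub> e j) - (\<Sum>j\<in>J. frag_of (x, \<psi> j v \<odot>\<^bsub>M\<^esub> e j)) \<in> ?K'"
        by (rule tensor_kernel_finsum_right[OF N' module_axioms x finite_index])
           (auto simp: coord_closed basis_closed v)
      then have 1: "frag_of (x, v) - (\<Sum>j\<in>J. frag_of (x, \<psi> j v \<odot>\<^bsub>M\<^esub> e j)) \<in> ?K'"
        using expansion[OF v] by simp
      have "(\<Sum>j\<in>J. frag_of (\<psi> j v \<odot>\<^bsub>N'\<^esub> x, e j) - frag_of (x, \<psi> j v \<odot>\<^bsub>M\<^esub> e j)) \<in> ?K'"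
        by (rule sumK, rule tensor_kernel_relators)
           (use x v coord_closed basis_closed in \<open>unfold tensor_relators_def, blast\<close>)
      from tensor_kernel_minus[OF N' module_axioms 1 this]
      show ?case using x v by (simp add: p hf' sum_subtractf)
  qed
  show "inj_on (tensor_map A N M u) (carrier (tensor A N' M))"
  proof (rule inj_onI)
    fix C D assume C: "C \<in> carrier (tensor A N' M)" and D: "D \<in> carrier (tensor A N' M)"
      and eq: "tensor_map A N M u C = tensor_map A N M u D"
    note sg' = tensor_kernel_subgroup[OF N' module_axioms]
    note sg = tensor_kernel_subgroup[OF N module_axioms]
    from C obtain c where c: "c \<in> carrier ?F'" "C = ?K' #>\<^bsub>?F'\<^esub> c"
      unfolding tensor_def FactGroup_def RCOSETS_def by auto
    from D obtain d0 where d0: "d0 \<in> carrier ?F'" "D = ?K' #>\<^bsub>?F'\<^esub> d0"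
      unfolding tensor_def FactGroup_def RCOSETS_def by auto
    have "c \<in> C" unfolding c(2)
      using group.rcos_self[OF group_free_Abelian_group c(1) sg'] .
    moreover have "?u c \<in> ?K #>\<^bsub>?F\<^esub> ?u c"
      using group.rcos_self[OF group_free_Abelian_group _ sg] ukeys c(1) by simp
    ultimately have "?u c \<in> tensor_map A N M u C"
      unfolding tensor_map_def by (rule UN_I)
    then have "?u c \<in> tensor_map A N M u D" by (simp only: eq)
    then obtain d k where d: "d \<in> D" and k: "k \<in> ?K" and "?u c = k \<otimes>\<^bsub>?F\<^esub> ?u d"
      unfolding tensor_map_def r_coset_def by auto
    then have uk: "?u c - ?u d = k" by simp
    have dc: "d \<in> carrier ?F'" 
      using monoid.r_coset_subset_G[OF group.is_monoid[OF group_free_Abelian_group] subgroup.subset[OF sg'] d0(1)] d d0(2) by blast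
    have D': "D = ?K' #>\<^bsub>?F'\<^esub> d"
      using group.repr_independence[OF group_free_Abelian_group _ d0(1) sg'] d d0(2) by blast
    have "h' j c = h' j d" if j: "j \<in> J" for j
    proof -
      have "\<zero>\<^bsub>N\<^esub> = h j (?u c - ?u d)" using hk[OF j k] uk by simp
      also have "\<dots> = h j (?u c) \<ominus>\<^bsub>N\<^esub> h j (?u d)"
        by (rule hom_free_Abelian_group_diff[OF N.abelian_group_axioms h[OF j]]) (use ukeys c dc in auto)
      finally have "h j (?u c) = h j (?u d)"
        using N.minus_equality[of "h j (?u c)" "\<ominus>\<^bsub>N\<^esub> h j (?u d)"] hc[OF j ukeys] c(1) dc
        by (simp add: N.minus_eq)
      then have "u (h' j c) = u (h' j d)" using comm[OF j] c(1) dc by simp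
      then show ?thesis using inj hc'[OF j] c(1) dc by (auto dest: inj_onD)
    qed
    then have "(\<Sum>j\<in>J. frag_of (h' j c, e j)) = (\<Sum>j\<in>J. frag_of (h' j d, e j))"
      by (intro sum.cong) auto
    then have "c - d \<in> ?K'"
      using tensor_kernel_minus[OF N' module_axioms expand[of c] expand[of d]] c(1) dc by simp
    then have "c \<in> ?K' #>\<^bsub>?F'\<^esub> d" unfolding r_coset_def by force
    then show "C = D" unfolding c(2) D'
      using group.repr_independence[OF group_free_Abelian_group _ dc sg'] by blast
  qed
qed

end

section \<open>Localization at a multiplicative set\<close>

locale mult_subset = cring R for R (structure) +
  fixes W
  assumes W_subset: "W \<subseteq> carrier R"
    and one_in_W: "\<one> \<in> W"
    and W_mult: "w \<in> W \<Longrightarrow> v \<in> W \<Longrightarrow> w \<otimes> v \<in> W"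
begin

lemma W_closed [simp]: "w \<in> W \<Longrightarrow> w \<in> carrier R"
  using W_subset by auto

lemma equiv_fraction_rel: "equiv (carrier R \<times> W) (fraction_rel R W)"
proof (rule equivI)
  show "fraction_rel R W \<subseteq> (carrier R \<times> W) \<times> (carrier R \<times> W)"
    unfolding fraction_rel_def by auto
  show "refl_on (carrier R \<times> W) (fraction_rel R W)"
    using one_in_W unfolding refl_on_def fraction_rel_def by auto
  show "sym (fraction_rel R W)"
    unfolding sym_def fraction_rel_def by auto metis
  show "trans (fraction_rel R W)"
  proof (rule transI)
    fix p q z assume "(p, q) \<in> fraction_rel R W" "(q, z) \<in> fraction_rel R W"
    then obtain r w s v x y a b where p: "p = (r, w)" "q = (s, v)" "z = (x, y)"
      and c: "r \<in> carrier R" "s \<in> carrier R" "x \<in> carrier R" "w \<in> W" "v \<in> W" "y \<in> W" "a \<in> W" "b \<in> W"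
      and a: "a \<otimes> (r \<otimes> v) = a \<otimes> (s \<otimes> w)" and b: "b \<otimes> (s \<otimes> y) = b \<otimes> (x \<otimes> v)"
      unfolding fraction_rel_def by auto
    have "(a \<otimes> b \<otimes> v) \<otimes> (r \<otimes> y) = (a \<otimes> (r \<otimes> v)) \<otimes> (b \<otimes> y)" using c by (simp add: m_ac)
    also have "\<dots> = (b \<otimes> (s \<otimes> y)) \<otimes> (a \<otimes> w)" unfolding a using c by (simp add: m_ac)
    also have "\<dots> = (a \<otimes> b \<otimes> v) \<otimes> (x \<otimes> w)" unfolding b using c by (simp add: m_ac)
    finally show "(p, z) \<in> fraction_rel R W"
      unfolding p fraction_rel_def using c W_mult by auto
  qed
qed

lemma fraction_eq_iff:
  assumes "r \<in> carrier R" "s \<in> carrier R" "w \<in> W" "v \<in> W"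
  shows "fraction R W r w = fraction R W s v \<longleftrightarrow> (\<exists>u\<in>W. u \<otimes> (r \<otimes> v) = u \<otimes> (s \<otimes> w))"
  unfolding fraction_def using eq_equiv_class_iff[OF equiv_fraction_rel, of "(r, w)" "(s, v)"] assms
  by (auto simp: fraction_rel_def)

lemma fraction_eqI:
  assumes "r \<in> carrier R" "s \<in> carrier R" "w \<in> W" "v \<in> W" "r \<otimes> v = s \<otimes> w"
  shows "fraction R W r w = fraction R W s v"
  using fraction_eq_iff[OF assms(1-4)] assms(5) one_in_W by auto

lemma fraction_closed:
  assumes "r \<in> carrier R" "w \<in> W"
  shows "fraction R W r w \<in> carrier (localization R W)"
  using assms unfolding fraction_def localization_def by (auto intro: quotientI)

lemma localizationE:
  assumes "x \<in> carrier (localization R W)"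
  obtains r w where "r \<in> carrier R" "w \<in> W" "x = fraction R W r w"
  using assms unfolding fraction_def localization_def by (auto elim: quotientE)

lemma fraction_mem:
  assumes "p \<in> fraction R W r w"
  obtains r' w' u where "p = (r', w')" "r' \<in> carrier R" "w' \<in> W" "u \<in> W" "u \<otimes> (r \<otimes> w') = u \<otimes> (r' \<otimes> w)"
  using assms unfolding fraction_def fraction_rel_def by auto

lemma fraction_nonempty:
  assumes "r \<in> carrier R" "w \<in> W"
  shows "fraction R W r w \<noteq> {}"
  using equiv_class_self[OF equiv_fraction_rel, of "(r, w)"] assms unfolding fraction_def by auto

lemma mult_fraction:
  assumes c: "r \<in> carrier R" "s \<in> carrier R" "w \<in> W" "v \<in> W"
  shows "fraction R W r w \<otimes>\<^bsub>localization R W\<^esub> fraction R W s v = fraction R W (r \<otimes> s) (w \<otimes> v)"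
proof -
  have "(case p of (r, w) \<Rightarrow> \<Union>q\<in>fraction R W s v. case q of (s, v) \<Rightarrow> fraction R W (r \<otimes> s) (w \<otimes> v)) =
      fraction R W (r \<otimes> s) (w \<otimes> v)" if p: "p \<in> fraction R W r w" for p
  proof -
    from fraction_mem[OF p] obtain r' w' a where p': "p = (r', w')" "r' \<in> carrier R" "w' \<in> W" "a \<in> W"
      and a: "a \<otimes> (r \<otimes> w') = a \<otimes> (r' \<otimes> w)" by metis
    have "(case q of (s, v) \<Rightarrow> fraction R W (r' \<otimes> s) (w' \<otimes> v)) = fraction R W (r \<otimes> s) (w \<otimes> v)"
      if q: "q \<in> fraction R W s v" for q
    proof -
      from fraction_mem[OF q] obtain s' v' b where q': "q = (s', v')" "s' \<in> carrier R" "v' \<in> W" "b \<in> W"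
        and b: "b \<otimes> (s \<otimes> v') = b \<otimes> (s' \<otimes> v)" by metis
      have "(a \<otimes> b) \<otimes> ((r' \<otimes> s') \<otimes> (w \<otimes> v)) = (a \<otimes> (r' \<otimes> w)) \<otimes> (b \<otimes> (s' \<otimes> v))"
        using c p' q' by (simp add: m_ac)
      also have "\<dots> = (a \<otimes> b) \<otimes> ((r \<otimes> s) \<otimes> (w' \<otimes> v'))"
        unfolding a[symmetric] b[symmetric] using c p' q' by (simp add: m_ac)
      finally show ?thesis using c p' q' W_mult by (auto simp: q'(1) fraction_eq_iff)
    qed
    then show ?thesis unfolding p'(1) using fraction_nonempty[OF c(2,4)] by auto
  qed
  then show ?thesis unfolding localization_def using fraction_nonempty[OF c(1,3)] by auto
qed

lemma add_fraction:
  assumes c: "r \<in> carrier R" "s \<in> carrier R" "w \<in> W" "v \<in> W"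
  shows "fraction R W r w \<oplus>\<^bsub>localization R W\<^esub> fraction R W s v =
    fraction R W (r \<otimes> v \<oplus> s \<otimes> w) (w \<otimes> v)"
proof -
  have "(case p of (r, w) \<Rightarrow> \<Union>q\<in>fraction R W s v. case q of (s, v) \<Rightarrow> fraction R W (r \<otimes> v \<oplus> s \<otimes> w) (w \<otimes> v)) =
      fraction R W (r \<otimes> v \<oplus> s \<otimes> w) (w \<otimes> v)" if p: "p \<in> fraction R W r w" for p
  proof -
    from fraction_mem[OF p] obtain r' w' a where p': "p = (r', w')" "r' \<in> carrier R" "w' \<in> W" "a \<in> W"
      and a: "a \<otimes> (r \<otimes> w') = a \<otimes> (r' \<otimes> w)" by metis
    have "(case q of (s, v) \<Rightarrow> fraction R W (r' \<otimes> v \<oplus> s \<otimes> w') (w' \<otimes> v)) =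
        fraction R W (r \<otimes> v \<oplus> s \<otimes> w) (w \<otimes> v)"
      if q: "q \<in> fraction R W s v" for q
    proof -
      from fraction_mem[OF q] obtain s' v' b where q': "q = (s', v')" "s' \<in> carrier R" "v' \<in> W" "b \<in> W"
        and b: "b \<otimes> (s \<otimes> v') = b \<otimes> (s' \<otimes> v)" by metis
      have "(a \<otimes> b) \<otimes> ((r' \<otimes> v' \<oplus> s' \<otimes> w') \<otimes> (w \<otimes> v)) =
          (a \<otimes> (r' \<otimes> w)) \<otimes> (b \<otimes> v' \<otimes> v) \<oplus> (b \<otimes> (s' \<otimes> v)) \<otimes> (a \<otimes> w' \<otimes> w)"
        using c p' q' by (simp add: m_ac r_distr l_distr)
      also have "\<dots> = (a \<otimes> b) \<otimes> ((r \<otimes> v \<oplus> s \<otimes> w) \<otimes> (w' \<otimes> v'))"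
        unfolding a[symmetric] b[symmetric] using c p' q' by (simp add: m_ac r_distr l_distr)
      finally show ?thesis using c p' q' W_mult by (auto simp: q'(1) fraction_eq_iff)
    qed
    then show ?thesis unfolding p'(1) using fraction_nonempty[OF c(2,4)] by auto
  qed
  then show ?thesis unfolding localization_def using fraction_nonempty[OF c(1,3)] by auto
qed

lemma one_localization: "\<one>\<^bsub>localization R W\<^esub> = fraction R W \<one> \<one>"
  and zero_localization: "\<zero>\<^bsub>localization R W\<^esub> = fraction R W \<zero> \<one>"
  unfolding localization_def by auto

lemmas fraction_simps = mult_fraction add_fraction one_localization zero_localization

lemma localization_cring: "cring (localization R W)"
proof (intro cringI abelian_groupI comm_monoidI)
  let ?L = "localization R W"
  note cl = fraction_closed W_mult one_in_W
  show "\<zero>\<^bsub>?L\<^esub> \<in> carrier ?L" "\<one>\<^bsub>?L\<^esub> \<in> carrier ?L" by (auto simp: fraction_simps intro: cl)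
  fix x assume "x \<in> carrier ?L"
  then obtain r w where x: "x = fraction R W r w" and r: "r \<in> carrier R" and w: "w \<in> W" by (rule localizationE)
  show "\<zero>\<^bsub>?L\<^esub> \<oplus>\<^bsub>?L\<^esub> x = x" "\<one>\<^bsub>?L\<^esub> \<otimes>\<^bsub>?L\<^esub> x = x"
    unfolding x using r w one_in_W by (auto simp: fraction_simps)
  have "fraction R W (\<ominus> r) w \<oplus>\<^bsub>?L\<^esub> x = \<zero>\<^bsub>?L\<^esub>"
    unfolding x using r w W_mult one_in_W
    by (simp add: fraction_simps l_minus l_neg, intro fraction_eqI, auto)
  then show "\<exists>y\<in>carrier ?L. y \<oplus>\<^bsub>?L\<^esub> x = \<zero>\<^bsub>?L\<^esub>" using r w by (auto intro!: bexI cl)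
  fix y assume "y \<in> carrier ?L"
  then obtain s v where y: "y = fraction R W s v" and s: "s \<in> carrier R" and v: "v \<in> W" by (rule localizationE)
  show "x \<oplus>\<^bsub>?L\<^esub> y \<in> carrier ?L" "x \<otimes>\<^bsub>?L\<^esub> y \<in> carrier ?L"
    unfolding x y using r w s v W_mult by (auto simp: fraction_simps intro: cl)
  show "x \<oplus>\<^bsub>?L\<^esub> y = y \<oplus>\<^bsub>?L\<^esub> x" "x \<otimes>\<^bsub>?L\<^esub> y = y \<otimes>\<^bsub>?L\<^esub> x"
    unfolding x y using r w s v by (auto simp: fraction_simps m_comm a_comm)
  fix z assume "z \<in> carrier ?L"
  then obtain q u where z: "z = fraction R W q u" and q: "q \<in> carrier R" and u: "u \<in> W" by (rule localizationE)
  show "(x \<oplus>\<^bsub>?L\<^esub> y) \<oplus>\<^bsub>?L\<^esub> z = x \<oplus>\<^bsub>?L\<^esub> (y \<oplus>\<^bsub>?L\<^esub> z)"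
    unfolding x y z using r w s v q u W_mult
    by (simp add: fraction_simps m_ac a_ac l_distr r_distr)
  show "(x \<otimes>\<^bsub>?L\<^esub> y) \<otimes>\<^bsub>?L\<^esub> z = x \<otimes>\<^bsub>?L\<^esub> (y \<otimes>\<^bsub>?L\<^esub> z)"
    unfolding x y z using r w s v q u W_mult by (simp add: fraction_simps m_ac)
  show "(x \<oplus>\<^bsub>?L\<^esub> y) \<otimes>\<^bsub>?L\<^esub> z = x \<otimes>\<^bsub>?L\<^esub> z \<oplus>\<^bsub>?L\<^esub> y \<otimes>\<^bsub>?L\<^esub> z"
    unfolding x y z using r w s v q u W_mult
    by (simp add: fraction_simps, intro fraction_eqI) (simp_all add: m_ac a_ac l_distr r_distr)
qed

lemma fraction_hom: "(\<lambda>r. fraction R W r \<one>) \<in> Ring.ring_hom R (localization R W)"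
  by (rule ring_hom_memI) (auto simp: fraction_simps one_in_W intro: fraction_closed)

lemma fraction_Units:
  assumes "w \<in> W" shows "fraction R W w \<one> \<in> Units (localization R W)"
proof -
  have "fraction R W w \<one> \<otimes>\<^bsub>localization R W\<^esub> fraction R W \<one> w = \<one>\<^bsub>localization R W\<^esub>"
    using assms one_in_W by (simp add: fraction_simps, intro fraction_eqI, auto)
  moreover have "fraction R W \<one> w \<otimes>\<^bsub>localization R W\<^esub> fraction R W w \<one> = \<one>\<^bsub>localization R W\<^esub>"
    using assms one_in_W by (simp add: fraction_simps, intro fraction_eqI, auto)
  ultimately show ?thesis
    using assms one_in_W by (auto simp: Units_def intro!: fraction_closed bexI[of _ "fraction R W \<one> w"])
qed

end

section \<open>Division by monic polynomials, square matrices and Bezoutians\<close>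

lemma monic_mult_coeff_nonzero:
  fixes g q :: "'a::comm_ring_1 poly"
  assumes "lead_coeff g = 1" "q \<noteq> 0"
  shows "\<exists>i\<ge>degree g. coeff (g * q) i \<noteq> 0"
  using assms coeff_mult_degree_sum[of g q] by (intro exI[of _ "degree g + degree q"]) auto

lemma monic_mult_cancel:
  fixes g p q :: "'a::comm_ring_1 poly"
  assumes "lead_coeff g = 1" "g * p = g * q"
  shows "p = q"
proof -
  have "g * (p - q) = 0" using assms(2) by (simp add: algebra_simps)
  then show ?thesis using monic_mult_coeff_nonzero[OF assms(1), of "p - q"] by auto
qed

lemma monic_division_exists:
  fixes g p :: "'a::comm_ring_1 poly"
  assumes g: "lead_coeff g = 1"
  shows "\<exists>q r. p = g * q + r \<and> (\<forall>i\<ge>degree g. coeff r i = 0)"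
proof -
  have "\<exists>q r. p = g * q + r \<and> (\<forall>i\<ge>degree g. coeff r i = 0)" if "\<forall>i\<ge>n. coeff p i = 0" for n
    using that
  proof (induction n arbitrary: p)
    case 0
    then have "p = 0" by (auto intro: poly_eqI)
    then show ?case by (intro exI[of _ 0]) auto
  next
    case (Suc n)
    show ?case
    proof (cases "n < degree g")
      case True
      then show ?thesis using Suc.prems by (intro exI[of _ 0] exI[of _ p]) auto
    next
      case False
      define s where "s = monom (coeff p n) (n - degree g)"
      have "coeff (p - g * s) i = 0" if "i \<ge> n" for i
      proof (cases "i = n")
        case True
        then show ?thesis using False g by (simp add: s_def mult.commute[of g] coeff_monom_mult)
      next
        case i: False
        then have "coeff p i = 0" using Suc.prems that by auto
        moreover have "degree g < i - (n - degree g)" using i that False by auto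
        then have "coeff g (i - (n - degree g)) = 0" by (rule coeff_eq_0)
        ultimately show ?thesis using False i that by (simp add: s_def mult.commute[of g] coeff_monom_mult)
      qed
      then obtain q r where "p - g * s = g * q + r" "\<forall>i\<ge>degree g. coeff r i = 0"
        using Suc.IH[of "p - g * s"] by auto
      then show ?thesis by (intro exI[of _ "q + s"] exI[of _ r]) (simp add: algebra_simps)
    qed
  qed
  from this[of "Suc (degree p)"] show ?thesis by (auto simp: coeff_eq_0)
qed

definition monic_mod :: "'a::comm_ring_1 poly \<Rightarrow> 'a poly \<Rightarrow> 'a poly" where
  "monic_mod g p = (SOME r. \<exists>q. p = g * q + r \<and> (\<forall>i\<ge>degree g. coeff r i = 0))"

context
  fixes g :: "'a::comm_ring_1 poly"
  assumes g: "lead_coeff g = 1"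
begin

lemma monic_mod_exists: "\<exists>q. p = g * q + monic_mod g p \<and> (\<forall>i\<ge>degree g. coeff (monic_mod g p) i = 0)"
proof -
  have "\<exists>r. \<exists>q. p = g * q + r \<and> (\<forall>i\<ge>degree g. coeff r i = 0)" using monic_division_exists[OF g, of p] by blast
  from someI_ex[OF this] show ?thesis unfolding monic_mod_def by blast
qed

lemma monic_modE: obtains q where "p = g * q + monic_mod g p"
  using monic_mod_exists by blast

lemma coeff_monic_mod: "i \<ge> degree g \<Longrightarrow> coeff (monic_mod g p) i = 0"
  using monic_mod_exists by blast

lemma monic_mod_unique:
  assumes "p = g * q + r" "\<And>i. i \<ge> degree g \<Longrightarrow> coeff r i = 0"
  shows "monic_mod g p = r"
proof -
  obtain q' where q': "p = g * q' + monic_mod g p" by (rule monic_modE)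
  have "g * (q - q') = monic_mod g p - r" using assms(1) q' by (simp add: algebra_simps)
  then have "coeff (g * (q - q')) i = 0" if "i \<ge> degree g" for i
    using that coeff_monic_mod assms(2) by simp
  then have "q - q' = 0"
    using monic_mult_coeff_nonzero[OF g, of "q - q'"] by blast
  then show ?thesis using assms(1) q' by simp
qed

lemma monic_mod_add: "monic_mod g (p + q) = monic_mod g p + monic_mod g q"
proof -
  obtain a b where "p = g * a + monic_mod g p" "q = g * b + monic_mod g q" by (metis monic_modE)
  then have "p + q = g * (a + b) + (monic_mod g p + monic_mod g q)"
    by (metis (no_types, opaque_lifting) add.assoc add.left_commute distrib_left)
  then show ?thesis by (rule monic_mod_unique) (simp add: coeff_monic_mod)
qed

lemma monic_mod_smult: "monic_mod g (smult c p) = smult c (monic_mod g p)"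
proof -
  obtain a where "p = g * a + monic_mod g p" by (metis monic_modE)
  then have "smult c p = g * smult c a + smult c (monic_mod g p)"
    by (metis mult_smult_right smult_add_right)
  then show ?thesis by (rule monic_mod_unique) (simp add: coeff_monic_mod)
qed

lemma monic_mod_mult_left: "monic_mod g (g * p) = 0"
  by (rule monic_mod_unique[of _ p]) auto

lemma monic_mod_sum: "monic_mod g (sum f A) = (\<Sum>i\<in>A. monic_mod g (f i))"
  using monic_mod_mult_left[of 0]
  by (induction A rule: infinite_finite_induct) (auto simp: monic_mod_add)

lemma monic_mod_eq_sum: "monic_mod g p = (\<Sum>a<degree g. monom (coeff (monic_mod g p) a) a)"
proof (rule poly_eqI)
  fix n show "coeff (monic_mod g p) n = coeff (\<Sum>a<degree g. monom (coeff (monic_mod g p) a) a) n"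
    using coeff_monic_mod[of n p] by (cases "n < degree g") (auto simp: coeff_sum)
qed

lemma monic_mod_small: "a < degree g \<Longrightarrow> monic_mod g (monom c a) = monom c a"
  by (rule monic_mod_unique[of _ 0]) auto

end

text \<open>From \<open>F Y = r\<close> follows \<open>det F det Y = r^t\<close>, so that \<open>det Y adj F\<close> is a two-sided inverse of \<open>F\<close> up to
  the factor \<open>r^t\<close>.  Passing from \<open>r\<close> to \<open>r^t\<close> makes it possible to argue over rings with zero divisors.\<close>

lemma right_inverse_up_to_scalar:
  fixes F Y :: "nat \<Rightarrow> nat \<Rightarrow> 'a::comm_ring_1"
  assumes "\<And>a b. a < t \<Longrightarrow> b < t \<Longrightarrow> (\<Sum>k<t. F a k * Y k b) = (if a = b then r else 0)"
  obtains G where "\<And>a b. a < t \<Longrightarrow> b < t \<Longrightarrow> (\<Sum>k<t. F a k * G k b) = (if a = b then r ^ t else 0)"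
    and "\<And>a b. a < t \<Longrightarrow> b < t \<Longrightarrow> (\<Sum>k<t. G a k * F k b) = (if a = b then r ^ t else 0)"
proof -
  define P where "P = mat t t (\<lambda>(a, k). F a k)"
  define Z where "Z = mat t t (\<lambda>(k, b). Y k b)"
  have P: "P \<in> carrier_mat t t" and Z: "Z \<in> carrier_mat t t" by (auto simp: P_def Z_def)
  have "P * Z = r \<cdot>\<^sub>m 1\<^sub>m t"
    by (rule eq_matI) (use assms in \<open>auto simp: P_def Z_def scalar_prod_def lessThan_atLeast0\<close>)
  then have det: "det P * det Z = r ^ t"
    using det_mult[OF P Z] by simp
  define G where "G = (\<lambda>a b. det Z * adj_mat P $$ (a, b))"
  note adj = adj_mat[OF P]
  show thesis
  proof
    fix a b assume ab: "a < t" "b < t"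
    have "(\<Sum>k<t. F a k * G k b) = det Z * (P * adj_mat P) $$ (a, b)"
      using ab P adj(1) by (auto simp: G_def P_def scalar_prod_def lessThan_atLeast0 sum_distrib_left ac_simps intro!: sum.cong)
    also have "\<dots> = (if a = b then r ^ t else 0)"
      unfolding adj(2) using ab det by (auto simp: ac_simps)
    finally show "(\<Sum>k<t. F a k * G k b) = (if a = b then r ^ t else 0)" .
    have "(\<Sum>k<t. G a k * F k b) = det Z * (adj_mat P * P) $$ (a, b)"
      using ab P adj(1) by (auto simp: G_def P_def scalar_prod_def lessThan_atLeast0 sum_distrib_left ac_simps intro!: sum.cong)
    also have "\<dots> = (if a = b then r ^ t else 0)"
      unfolding adj(3) using ab det by (auto simp: ac_simps)
    finally show "(\<Sum>k<t. G a k * F k b) = (if a = b then r ^ t else 0)" .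
  qed
qed

text \<open>In \<open>'a poly poly poly\<close> the variables are \<open>z\<close>, \<open>x\<close>, \<open>y\<close>, from the outside to the inside; \<open>z_poly p\<close> is
  \<open>p(z)\<close> for a polynomial \<open>p(y)\<close>.\<close>

definition z_poly :: "'a::comm_ring_1 poly \<Rightarrow> 'a poly poly poly" where
  "z_poly p = map_poly (\<lambda>c. [:[:c:]:]) p"

definition y_const :: "'a::comm_ring_1 poly poly" where "y_const = [:[:0, 1:]:]"

text \<open>The difference quotient \<open>(p(z) - p(y)) / (z - y)\<close>, a Bezoutian.\<close>

definition bez :: "'a::comm_ring_1 poly \<Rightarrow> 'a poly poly poly" where
  "bez p = synthetic_div (z_poly p) y_const"

interpretation const2: comm_ring_hom "\<lambda>c :: 'a::comm_ring_1. [:[:c:]:]"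
  by unfold_locales (auto simp: one_pCons)

interpretation z_poly: comm_ring_hom "z_poly :: 'a::comm_ring_1 poly \<Rightarrow> _"
proof -
  interpret m: map_poly_comm_ring_hom "\<lambda>c :: 'a::comm_ring_1. [:[:c:]:]" ..
  have eq: "z_poly = map_poly (\<lambda>c :: 'a::comm_ring_1. [:[:c:]:])" by (simp add: z_poly_def fun_eq_iff)
  show "comm_ring_hom (z_poly :: 'a::comm_ring_1 poly \<Rightarrow> _)" unfolding eq by (rule m.comm_ring_hom_axioms)
qed

lemmas z_poly_mult = z_poly.hom_mult

lemma coeff_z_poly [simp]: "coeff (z_poly p) i = [:[:coeff p i:]:]"
  unfolding z_poly_def by (rule coeff_map_poly) auto

lemma z_poly_pCons: "z_poly (pCons a p) = pCons [:[:a:]:] (z_poly p)"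
  by (rule poly_eqI) (auto simp: coeff_pCons split: nat.splits)

lemma poly_z_poly: "poly (z_poly p) y_const = [:p:]"
  by (induction p) (auto simp: z_poly_pCons y_const_def)

lemma bez_eq: "[:- y_const, 1:] * bez p = z_poly p - [:[:p:]:]"
  using synthetic_div_correct'[of y_const "z_poly p"] unfolding poly_z_poly bez_def
  by (simp add: algebra_simps)

lemma bez_cancel:
  assumes "[:- y_const, 1:] * p = [:- y_const, 1:] * q" shows "p = q"
  by (rule monic_mult_cancel[OF _ assms]) simp

lemma bez_add: "bez (p + q) = bez p + bez q"
  by (rule bez_cancel) (simp only: bez_eq distrib_left, simp add: z_poly.hom_add)

lemma bez_sum: "bez (sum f A :: 'a::comm_ring_1 poly) = (\<Sum>i\<in>A. bez (f i))"
proof -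
  have "bez 0 = (0 :: 'a poly poly poly)" by (rule bez_cancel) (simp only: bez_eq, simp)
  then show ?thesis by (induction A rule: infinite_finite_induct) (auto simp: bez_add)
qed

lemma bez_mult: "bez (p * q) = bez p * z_poly q + [:[:p:]:] * bez q"
proof (rule bez_cancel)
  have "[:- y_const, 1:] * (bez p * z_poly q + [:[:p:]:] * bez q) =
     ([:- y_const, 1:] * bez p) * z_poly q + [:[:p:]:] * ([:- y_const, 1:] * bez q)"
    by (simp only: algebra_simps)
  also have "\<dots> = z_poly (p * q) - [:[:p * q:]:]"
    unfolding bez_eq by (simp add: algebra_simps z_poly.hom_mult)
  finally show "[:- y_const, 1:] * bez (p * q) = [:- y_const, 1:] * (bez p * z_poly q + [:[:p:]:] * bez q)"
    unfolding bez_eq by simp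
qed

lemma bez_mult': "bez (p * q) = bez p * [:[:q:]:] + z_poly p * bez q"
  using bez_mult[of q p] by (simp add: algebra_simps)

text \<open>The coefficients in \<open>z\<close> are the Horner polynomials of \<open>p\<close>, which determine each other downwards.\<close>

lemma coeff_bez: "coeff (bez p) i = [:[:coeff p (Suc i):]:] + y_const * coeff (bez p) (Suc i)"
proof -
  have "coeff ([:- y_const, 1:] * bez p) (Suc i) = coeff (z_poly p - [:[:p:]:]) (Suc i)"
    by (simp only: bez_eq)
  then show ?thesis by (simp add: algebra_simps)
qed

section \<open>The ideal of maximal minors modulo its monic generator\<close>

text \<open>What the proof needs of the maximal minors \<open>f\<close>: \<open>f 0\<close> is associated to a monic polynomial \<open>\<chi>\<close> of degree
  \<open>t\<close>, multiplication by \<open>x\<close> is governed by relations whose coefficients do not involve \<open>x\<close>, and \<open>r\<close> is a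
  polynomial in \<open>y\<close> alone in the ideal \<open>(f 0, f t)\<close>.  The outer variable is \<open>x\<close>, the inner one \<open>y\<close>.\<close>

locale determinantal_generators =
  fixes f :: "nat \<Rightarrow> 'r::comm_ring_1 poly poly" and t :: nat and \<chi> :: "'r poly poly" and r :: "'r poly"
  assumes monic: "lead_coeff \<chi> = 1" and deg: "degree \<chi> = t"
    and chi_dvd: "\<chi> dvd f 0" and dvd_chi: "f 0 dvd \<chi>"
    and x_mult: "l \<in> {1..t} \<Longrightarrow> \<exists>c. [:0, 1:] * f l = (\<Sum>i\<le>t. [:c i:] * f i)"
    and r_mem: "\<exists>a b. [:r:] = a * f 0 + b * f t"
begin

definition span :: "'r poly poly set" where
  "span = {p. \<exists>c w. p = (\<Sum>k<t. [:c k:] * f (Suc k)) + \<chi> * w}"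

lemma spanI: "p = (\<Sum>k<t. [:c k:] * f (Suc k)) + \<chi> * w \<Longrightarrow> p \<in> span"
  unfolding span_def by blast

lemma span_add: assumes "p \<in> span" "q \<in> span" shows "p + q \<in> span"
proof -
  from assms obtain c w d v where "p = (\<Sum>k<t. [:c k:] * f (Suc k)) + \<chi> * w"
    "q = (\<Sum>k<t. [:d k:] * f (Suc k)) + \<chi> * v" unfolding span_def by blast
  then have "p + q = (\<Sum>k<t. [:c k + d k:] * f (Suc k)) + \<chi> * (w + v)"
    by (simp add: algebra_simps sum.distrib smult_add_left)
  then show ?thesis by (rule spanI)
qed

lemma span_const_mult: assumes "p \<in> span" shows "[:a:] * p \<in> span"
proof -
  from assms obtain c w where "p = (\<Sum>k<t. [:c k:] * f (Suc k)) + \<chi> * w" unfolding span_def by blast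
  then have "[:a:] * p = (\<Sum>k<t. [:a * c k:] * f (Suc k)) + \<chi> * ([:a:] * w)"
    by (simp add: smult_add_right sum_distrib_left smult_sum2)
  then show ?thesis by (rule spanI)
qed

lemma span_chi: "\<chi> * w \<in> span"
  by (rule spanI[of _ "\<lambda>_. 0" w]) simp

lemma span_zero: "0 \<in> span" using span_chi[of 0] by simp

lemma span_f0: "f 0 * w \<in> span"
proof -
  obtain v where "f 0 = \<chi> * v" using chi_dvd by (auto elim: dvdE)
  then show ?thesis using span_chi[of "v * w"] by (simp add: mult.assoc)
qed

lemma span_sum: "(\<And>i. i \<in> A \<Longrightarrow> g i \<in> span) \<Longrightarrow> sum g A \<in> span"
  by (induction A rule: infinite_finite_induct) (auto simp: span_zero span_add)

lemma span_f: assumes "l \<le> t" shows "f l \<in> span"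
proof (cases l)
  case 0 then show ?thesis using span_f0[of 1] by simp
next
  case (Suc k)
  have "f l = (\<Sum>i<t. [:if i = k then 1 else 0:] * f (Suc i))"
    using assms Suc by (simp add: if_distrib[of "\<lambda>x. smult x _"] cong: if_cong)
  then show ?thesis by (intro spanI[of _ "\<lambda>i. if i = k then 1 else 0" 0]) simp
qed

lemma span_x_mult: assumes "p \<in> span" shows "[:0, 1:] * p \<in> span"
proof -
  from assms obtain c w where p: "p = (\<Sum>k<t. [:c k:] * f (Suc k)) + \<chi> * w" unfolding span_def by blast
  have "[:0, 1:] * f (Suc k) \<in> span" if "k < t" for k
  proof -
    obtain d where d: "[:0, 1:] * f (Suc k) = (\<Sum>i\<le>t. [:d i:] * f i)" using x_mult[of "Suc k"] \<open>k < t\<close> by auto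
    show ?thesis unfolding d by (rule span_sum, rule span_const_mult, rule span_f) auto
  qed
  then have "(\<Sum>k<t. [:c k:] * ([:0, 1:] * f (Suc k))) + \<chi> * ([:0, 1:] * w) \<in> span"
    by (intro span_add span_chi span_sum span_const_mult) auto
  also have "(\<Sum>k<t. [:c k:] * ([:0, 1:] * f (Suc k))) + \<chi> * ([:0, 1:] * w) = [:0, 1:] * p"
    unfolding p distrib_left sum_distrib_left by (simp only: mult.left_commute)
  finally show ?thesis .
qed

text \<open>The combinations of \<open>f 1, \<dots>, f t\<close> with coefficients free of \<open>x\<close>, modulo \<open>\<chi>\<close>, already form an ideal, because
  they are stable under multiplication by \<open>x\<close>.\<close>

lemma span_mult: assumes "p \<in> span" shows "q * p \<in> span"
proof (induction q)
  case 0 then show ?case by (simp add: span_zero)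
next
  case (pCons a q)
  have "pCons a q * p = [:a:] * p + [:0, 1:] * (q * p)" by simp
  then show ?case using span_add[OF span_const_mult[OF assms] span_x_mult[OF pCons.IH]] by simp
qed

text \<open>The factor \<open>y\<close> makes the degree positive, which the normalization of the residue functional requires.\<close>

definition \<rho> :: "'r poly" where "\<rho> = [:0, 1:] * r ^ t"

text \<open>Let \<open>F\<close> be the matrix of the classes of \<open>f 1, \<dots>, f t\<close> in the basis \<open>1, \<dots>, x^(t-1)\<close> modulo \<open>\<chi>\<close>, and \<open>G\<close> a
  matrix with \<open>F G = G F = \<rho>\<close>.  Then \<open>\<mu> k p\<close> is entry \<open>k\<close> of \<open>G\<close> applied to the coordinates of \<open>p\<close>; it sends
  the ideal of the \<open>f l\<close> into \<open>(\<rho>)\<close> because \<open>G F = \<rho>\<close>.  The polynomial \<open>B k\<close> is column \<open>k\<close> of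
  \<open>(F(z) - F(y)) / (z - y)\<close>, read as a polynomial in \<open>x\<close>.  The last identity says that, modulo the ideal
  of the \<open>f l\<close> and modulo \<open>\<rho>(z)\<close>, the sum of the \<open>B k\<close> times \<open>\<mu> k p\<close>, taken at \<open>z\<close>, is the difference quotient of \<open>\<rho>\<close> times \<open>p\<close>: it
  is the product rule applied to \<open>F \<mu> p = \<rho> p\<close>, that is, to \<open>F G = \<rho>\<close>.\<close>

lemma dual_data:
  obtains \<mu> :: "nat \<Rightarrow> 'r poly poly \<Rightarrow> 'r poly" and B :: "nat \<Rightarrow> 'r poly poly poly"
  where "\<And>k p q. \<mu> k (p + q) = \<mu> k p + \<mu> k q"
    and "\<And>k c p. \<mu> k (smult c p) = c * \<mu> k p"
    and "\<And>k l p. k < t \<Longrightarrow> l \<le> t \<Longrightarrow> \<rho> dvd \<mu> k (f l * p)"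
    and "\<And>p. \<exists>G h. (\<Sum>k<t. B k * z_poly (\<mu> k p)) = bez \<rho> * [:p:] + z_poly \<rho> * G + (\<Sum>l\<le>t. [:f l:] * h l)"
proof -
  define F where "F = (\<lambda>a k. coeff (monic_mod \<chi> (f (Suc k))) a)"
  have "\<exists>c. \<forall>a<t. coeff (monic_mod \<chi> ([:r:] * monom 1 b)) a = (\<Sum>k<t. F a k * c k)" for b
  proof -
    obtain u v where r: "[:r:] = u * f 0 + v * f t" using r_mem by blast
    have "(monom 1 b * u) * f 0 + (monom 1 b * v) * f t \<in> span"
      by (intro span_add span_mult span_f) auto
    then have "[:r:] * monom 1 b \<in> span" unfolding r by (simp add: algebra_simps)
    then obtain c w where eq: "[:r:] * monom 1 b = (\<Sum>k<t. [:c k:] * f (Suc k)) + \<chi> * w" unfolding span_def by blast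
    have "monic_mod \<chi> ([:r:] * monom 1 b) = (\<Sum>k<t. smult (c k) (monic_mod \<chi> (f (Suc k))))"
      unfolding eq by (simp add: monic_mod_add[OF monic] monic_mod_mult_left[OF monic] monic_mod_sum[OF monic] monic_mod_smult[OF monic])
    then show ?thesis by (intro exI[of _ c]) (simp add: coeff_sum F_def mult.commute)
  qed
  then obtain Y where "\<forall>b. \<forall>a<t. coeff (monic_mod \<chi> ([:r:] * monom 1 b)) a = (\<Sum>k<t. F a k * Y b k)"
    using choice[of "\<lambda>b c. \<forall>a<t. coeff (monic_mod \<chi> ([:r:] * monom 1 b)) a = (\<Sum>k<t. F a k * c k)"] by blast
  then have Y: "coeff (monic_mod \<chi> ([:r:] * monom 1 b)) a = (\<Sum>k<t. F a k * Y b k)" if "a < t" for a b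
    using that by blast
  have "(\<Sum>k<t. F a k * Y b k) = (if a = b then r else 0)" if "a < t" "b < t" for a b
  proof -
    have "monic_mod \<chi> ([:r:] * monom 1 b) = smult r (monom 1 b)"
      using monic_mod_smult[OF monic, of r "monom 1 b"] monic_mod_small[OF monic, of b 1] that deg by simp
    then show ?thesis using Y[OF that(1), of b] by (cases "a = b") auto
  qed
  then obtain G0 where
    G0: "\<And>a b. a < t \<Longrightarrow> b < t \<Longrightarrow> (\<Sum>k<t. F a k * G0 k b) = (if a = b then r ^ t else 0)"
        "\<And>a b. a < t \<Longrightarrow> b < t \<Longrightarrow> (\<Sum>k<t. G0 a k * F k b) = (if a = b then r ^ t else 0)"
    using right_inverse_up_to_scalar[of t F "\<lambda>k b. Y b k" r] by blast
  define G where "G = (\<lambda>k b. [:0, 1:] * G0 k b)"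
  have FG: "(\<Sum>k<t. F a k * G k b) = (if a = b then \<rho> else 0)" if "a < t" "b < t" for a b
    using arg_cong[OF G0(1)[OF that], of "\<lambda>x. [:0, 1:] * x"]
    by (simp only: sum_distrib_left G_def \<rho>_def) (simp only: mult.left_commute if_distrib mult_zero_right)
  have GF: "(\<Sum>k<t. G a k * F k b) = (if a = b then \<rho> else 0)" if "a < t" "b < t" for a b
    using arg_cong[OF G0(2)[OF that], of "\<lambda>x. [:0, 1:] * x"]
    by (simp only: sum_distrib_left G_def \<rho>_def) (simp only: mult.assoc if_distrib mult_zero_right)
  define co where "co = (\<lambda>p a. coeff (monic_mod \<chi> p) a)"
  define \<mu> where "\<mu> = (\<lambda>k p. \<Sum>a<t. G k a * co p a)"
  define B where "B = (\<lambda>k. \<Sum>a<t. [:monom 1 a:] * bez (F a k))"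
  \<comment> \<open>With \<open>co p\<close> the coordinates of \<open>p\<close>, this is \<open>F G (co p) = \<rho> (co p)\<close>.\<close>
  have F\<mu>: "(\<Sum>k<t. F a k * \<mu> k p) = \<rho> * co p a" if "a < t" for a p
  proof -
    have "(\<Sum>k<t. F a k * \<mu> k p) = (\<Sum>b<t. (\<Sum>k<t. F a k * G k b) * co p b)"
      unfolding \<mu>_def sum_distrib_left sum_distrib_right by (subst sum.swap) (simp only: mult.assoc)
    also have "\<dots> = (\<Sum>b<t. if a = b then \<rho> * co p b else 0)"
      by (rule sum.cong) (auto simp: FG that)
    finally show ?thesis using that by simp
  qed
  have mm: "(\<Sum>a<t. [:monom 1 a:] * [:[:co p a:]:]) = [:monic_mod \<chi> p:]" for p
  proof -
    have "(\<Sum>a<t. [:monom 1 a:] * [:[:co p a:]:]) = [:\<Sum>a<t. monom (co p a) a:]"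
      by (induction t) (auto simp: smult_monom)
    then show ?thesis using monic_mod_eq_sum[OF monic, of p] deg by (simp add: co_def)
  qed
  obtain e where e: "\<chi> = f 0 * e" using dvd_chi by (auto elim: dvdE)
  show thesis
  proof
    show "\<mu> k (p + q) = \<mu> k p + \<mu> k q" for k p q
      by (simp add: \<mu>_def co_def monic_mod_add[OF monic] algebra_simps sum.distrib)
    show "\<mu> k (smult c p) = c * \<mu> k p" for k c p
      by (simp add: \<mu>_def co_def monic_mod_smult[OF monic] algebra_simps sum_distrib_left)
    show "\<rho> dvd \<mu> k (f l * p)" if k: "k < t" and l: "l \<le> t" for k l p
    proof -
      have "f l * p \<in> span" using span_mult[OF span_f[OF l], of p] by (simp add: mult.commute)
      then obtain c w where eq: "f l * p = (\<Sum>k<t. [:c k:] * f (Suc k)) + \<chi> * w" unfolding span_def by blast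
      have "co (f l * p) a = (\<Sum>j<t. F a j * c j)" for a
        unfolding co_def eq
        by (simp add: monic_mod_add[OF monic] monic_mod_mult_left[OF monic] monic_mod_sum[OF monic]
            monic_mod_smult[OF monic] coeff_sum F_def mult.commute)
      then have "\<mu> k (f l * p) = (\<Sum>a<t. \<Sum>j<t. G k a * F a j * c j)"
        unfolding \<mu>_def by (simp add: sum_distrib_left mult.assoc)
      also have "\<dots> = (\<Sum>j<t. (\<Sum>a<t. G k a * F a j) * c j)"
        by (subst sum.swap) (simp only: sum_distrib_right)
      also have "\<dots> = (\<Sum>j<t. if k = j then \<rho> * c j else 0)"
        by (rule sum.cong) (auto simp: GF k)
      finally show ?thesis using k by simp
    qed
    show "\<exists>W h. (\<Sum>k<t. B k * z_poly (\<mu> k p)) = bez \<rho> * [:p:] + z_poly \<rho> * W + (\<Sum>l\<le>t. [:f l:] * h l)" for p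
    proof -
      \<comment> \<open>The product rule is used on both sides: once for \<open>F \<mu>\<close>, once for \<open>\<rho> co\<close>.\<close>
      have bz: "(\<Sum>k<t. bez (F a k) * z_poly (\<mu> k p)) =
          bez \<rho> * [:[:co p a:]:] + z_poly \<rho> * bez (co p a) - (\<Sum>k<t. [:[:F a k:]:] * bez (\<mu> k p))"
        if "a < t" for a
      proof -
        have "(\<Sum>k<t. bez (F a k) * z_poly (\<mu> k p)) + (\<Sum>k<t. [:[:F a k:]:] * bez (\<mu> k p)) = bez (\<rho> * co p a)"
          unfolding F\<mu>[OF that, symmetric] bez_sum bez_mult sum.distrib ..
        also have "\<dots> = bez \<rho> * [:[:co p a:]:] + z_poly \<rho> * bez (co p a)" by (rule bez_mult')
        finally show ?thesis by (simp only: algebra_simps)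
      qed
      obtain w where w: "p = \<chi> * w + monic_mod \<chi> p" by (rule monic_modE[OF monic])
      then have w': "monic_mod \<chi> p = p - f 0 * (e * w)" by (simp add: e mult.assoc algebra_simps)
      have "\<exists>v. \<forall>k. monic_mod \<chi> (f (Suc k)) = f (Suc k) - f 0 * v k"
      proof -
        have "\<exists>v. monic_mod \<chi> (f (Suc k)) = f (Suc k) - f 0 * v" for k
        proof -
          obtain v where "f (Suc k) = \<chi> * v + monic_mod \<chi> (f (Suc k))" by (rule monic_modE[OF monic])
          then have "monic_mod \<chi> (f (Suc k)) = f (Suc k) - f 0 * (e * v)" by (simp add: e mult.assoc algebra_simps)
          then show ?thesis by blast
        qed
        then show ?thesis using choice[of "\<lambda>k v. monic_mod \<chi> (f (Suc k)) = f (Suc k) - f 0 * v"] by blast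
      qed
      then obtain v where v: "\<And>k. monic_mod \<chi> (f (Suc k)) = f (Suc k) - f 0 * v k" by blast
      define W where "W = (\<Sum>a<t. [:monom 1 a:] * bez (co p a))"
      define h where "h = (\<lambda>l. case l of 0 \<Rightarrow> (\<Sum>k<t. [:v k:] * bez (\<mu> k p)) - [:e * w:] * bez \<rho> | Suc k \<Rightarrow> - bez (\<mu> k p))"
      have "(\<Sum>k<t. B k * z_poly (\<mu> k p)) = (\<Sum>a<t. [:monom 1 a:] * (\<Sum>k<t. bez (F a k) * z_poly (\<mu> k p)))"
        unfolding B_def sum_distrib_left sum_distrib_right by (subst sum.swap) (simp only: mult.assoc)
      also have "\<dots> = (\<Sum>a<t. [:monom 1 a:] * (bez \<rho> * [:[:co p a:]:] + z_poly \<rho> * bez (co p a) - (\<Sum>k<t. [:[:F a k:]:] * bez (\<mu> k p))))"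
        by (rule sum.cong) (auto simp only: bz lessThan_iff)
      also have "\<dots> = bez \<rho> * (\<Sum>a<t. [:monom 1 a:] * [:[:co p a:]:]) + z_poly \<rho> * W -
          (\<Sum>k<t. (\<Sum>a<t. [:monom 1 a:] * [:[:F a k:]:]) * bez (\<mu> k p))"
      proof -
        have "(\<Sum>k<t. (\<Sum>a<t. [:monom 1 a:] * [:[:F a k:]:]) * bez (\<mu> k p)) =
            (\<Sum>a<t. [:monom 1 a:] * (\<Sum>k<t. [:[:F a k:]:] * bez (\<mu> k p)))"
          unfolding sum_distrib_left sum_distrib_right by (subst sum.swap) (simp only: mult.assoc)
        then show ?thesis
          unfolding W_def right_diff_distrib distrib_left sum_subtractf sum.distrib
          by (simp only: sum_distrib_left mult.left_commute)
      qed
      also have "\<dots> = bez \<rho> * [:monic_mod \<chi> p:] + z_poly \<rho> * W - (\<Sum>k<t. [:monic_mod \<chi> (f (Suc k)):] * bez (\<mu> k p))"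
        using mm by (simp only: F_def co_def)
      also have "\<dots> = bez \<rho> * ([:p:] - [:f 0:] * [:e * w:]) + z_poly \<rho> * W - (\<Sum>k<t. ([:f (Suc k):] - [:f 0:] * [:v k:]) * bez (\<mu> k p))"
        unfolding w' v by (simp add: mult.commute[of "f 0"])
      also have "\<dots> = bez \<rho> * [:p:] + z_poly \<rho> * W + ([:f 0:] * h 0 + (\<Sum>k<t. [:f (Suc k):] * h (Suc k)))"
      proof -
        have 1: "(\<Sum>k<t. ([:f (Suc k):] - [:f 0:] * [:v k:]) * bez (\<mu> k p)) =
            (\<Sum>k<t. [:f (Suc k):] * bez (\<mu> k p)) - [:f 0:] * (\<Sum>k<t. [:v k:] * bez (\<mu> k p))"
          by (simp only: left_diff_distrib sum_subtractf sum_distrib_left mult.assoc)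
        have 2: "(\<Sum>k<t. [:f (Suc k):] * h (Suc k)) = - (\<Sum>k<t. [:f (Suc k):] * bez (\<mu> k p))"
          by (simp only: h_def nat.case mult_minus_right sum_negf)
        have 3: "h 0 = (\<Sum>k<t. [:v k:] * bez (\<mu> k p)) - [:e * w:] * bez \<rho>"
          by (simp only: h_def nat.case)
        have "b * (P - F * E) + Z - (S - F * V) = b * P + Z + (F * (V - E * b) + - S)"
          for b P F E Z S V :: "'r poly poly poly" by (simp add: algebra_simps)
        then show ?thesis unfolding 1 2 3 .
      qed
      also have "[:f 0:] * h 0 + (\<Sum>k<t. [:f (Suc k):] * h (Suc k)) = (\<Sum>l\<le>t. [:f l:] * h l)"
        unfolding lessThan_Suc_atMost[symmetric] sum.lessThan_Suc_shift ..
      finally show ?thesis by blast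
    qed
  qed
qed

end

section \<open>Resultants and maximal minors\<close>

text \<open>The Sylvester matrix sends the column of the powers \<open>x^(m+n-1), \<dots>, x, 1\<close> to the column of the multiples
  \<open>w i\<close> of \<open>p\<close> and \<open>q\<close>; the last row of its adjugate expresses the determinant times \<open>1\<close> through the \<open>w i\<close>.\<close>

lemma resultant_in_ideal:
  fixes p q :: "'a::comm_ring_1 poly"
  assumes "degree p > 0"
  shows "\<exists>a b. [:resultant p q:] = a * p + b * q"
proof -
  define m n where "m = degree p" and "n = degree q"
  define S where "S = sylvester_mat p q"
  have S: "S \<in> carrier_mat (m + n) (m + n)" unfolding S_def m_def n_def by (rule sylvester_carrier_mat)
  have mn: "m + n > 0" using assms m_def by simp
  define w where "w = (\<lambda>i. if i < n then monom 1 (n - Suc i) * p else monom 1 (m + n - Suc i) * q)"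
  have row: "(\<Sum>j<m+n. [:S $$ (i, j):] * monom 1 (m + n - Suc j)) = w i" if i: "i < m + n" for i
  proof -
    have x: "[:0, 1:] * w i = (if i < n then monom 1 (n - i) * p else monom 1 (m + n - i) * q)"
    proof -
      have "[:0, 1:] * monom 1 (k - Suc i) = (monom 1 (k - i) :: 'a poly)" if "i < k" for k
        using that by (simp add: monom_Suc[symmetric] Suc_diff_Suc)
      then show ?thesis unfolding w_def using i by (simp add: mult.assoc[symmetric] del: mult_pCons_left)
    qed
    have Sij: "S $$ (i, j) = coeff (w i) (m + n - Suc j)" if "j < m + n" for j
    proof -
      have "S $$ (i, j) = coeff ([:0, 1:] * w i) (m + n - j)"
        unfolding x S_def using sylvester_index_mat2[of i p q j] i that by (simp add: m_def n_def)
      also have "m + n - j = Suc (m + n - Suc j)" using that by simp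
      finally show ?thesis by simp
    qed
    have deg: "coeff (w i) k = 0" if "k \<ge> m + n" for k
      using that i by (auto simp: w_def coeff_monom_mult coeff_eq_0 m_def n_def)
    have "(\<Sum>j<m+n. [:S $$ (i, j):] * monom 1 (m + n - Suc j)) =
        (\<Sum>j<m+n. monom (coeff (w i) (m + n - Suc j)) (m + n - Suc j))"
      by (rule sum.cong) (auto simp: Sij smult_monom)
    also have "\<dots> = (\<Sum>j<m+n. monom (coeff (w i) j) j)"
      by (rule sum.nat_diff_reindex)
    also have "\<dots> = w i"
    proof (rule poly_eqI)
      fix k show "coeff (\<Sum>j<m+n. monom (coeff (w i) j) j) k = coeff (w i) k"
        using deg[of k] by (cases "k < m + n") (auto simp: coeff_sum)
    qed
    finally show ?thesis .
  qed
  define N where "N = m + n - 1"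
  have N: "N < m + n" using mn N_def by simp
  have N0: "m + n - Suc N = 0" using mn N_def by simp
  define A where "A = adj_mat S"
  have A: "A \<in> carrier_mat (m + n) (m + n)" "A * S = det S \<cdot>\<^sub>m 1\<^sub>m (m + n)"
    using adj_mat[OF S] by (auto simp: A_def)
  have AS: "(\<Sum>i<m+n. A $$ (N, i) * S $$ (i, j)) = (if j = N then resultant p q else 0)" if j: "j < m + n" for j
  proof -
    have "(\<Sum>i<m+n. A $$ (N, i) * S $$ (i, j)) = (A * S) $$ (N, j)"
      using A(1) S N j by (auto simp: scalar_prod_def lessThan_atLeast0)
    then show ?thesis unfolding A(2) using N j by (auto simp: resultant_def S_def)
  qed
  have "(\<Sum>i<m+n. [:A $$ (N, i):] * w i) = (\<Sum>i<m+n. [:A $$ (N, i):] * (\<Sum>j<m+n. [:S $$ (i, j):] * monom 1 (m + n - Suc j)))"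
    by (rule sum.cong) (auto simp only: row lessThan_iff)
  also have "\<dots> = (\<Sum>j<m+n. [:\<Sum>i<m+n. A $$ (N, i) * S $$ (i, j):] * monom 1 (m + n - Suc j))"
  proof -
    have "(\<Sum>i<m+n. [:A $$ (N, i):] * (\<Sum>j<m+n. [:S $$ (i, j):] * monom 1 (m + n - Suc j))) =
      (\<Sum>i<m+n. \<Sum>j<m+n. [:A $$ (N, i) * S $$ (i, j):] * monom 1 (m + n - Suc j))"
      by (simp add: sum_distrib_left smult_sum2 mult.commute)
    also have "\<dots> = (\<Sum>j<m+n. (\<Sum>i<m+n. [:A $$ (N, i) * S $$ (i, j):]) * monom 1 (m + n - Suc j))"
      by (subst sum.swap) (simp only: sum_distrib_right)
    also have "(\<lambda>j. \<Sum>i<m+n. [:A $$ (N, i) * S $$ (i, j):]) = (\<lambda>j. [:\<Sum>i<m+n. A $$ (N, i) * S $$ (i, j):])"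
    proof
      fix j
      have "(\<Sum>i\<in>I. [:g i:]) = [:\<Sum>i\<in>I. g i:]" for g :: "nat \<Rightarrow> 'a" and I
        by (induction I rule: infinite_finite_induct) auto
      then show "(\<Sum>i<m+n. [:A $$ (N, i) * S $$ (i, j):]) = [:\<Sum>i<m+n. A $$ (N, i) * S $$ (i, j):]" .
    qed
    finally show ?thesis .
  qed
  also have "\<dots> = (\<Sum>j<m+n. if j = N then [:resultant p q:] else 0)"
    using N0 by (intro sum.cong) (auto simp: AS)
  also have "\<dots> = [:resultant p q:]" using N by simp
  finally have eq: "(\<Sum>i<m+n. [:A $$ (N, i):] * w i) = [:resultant p q:]" .
  have "\<exists>a b. sum (\<lambda>i. [:A $$ (N, i):] * w i) I = a * p + b * q" for I
  proof (induction I rule: infinite_finite_induct)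
    case (insert i I)
    then obtain a b where "sum (\<lambda>i. [:A $$ (N, i):] * w i) I = a * p + b * q" by blast
    moreover have "\<exists>a b. [:A $$ (N, i):] * w i = a * p + b * q"
    proof (cases "i < n")
      case True
      then show ?thesis
        by (intro exI[of _ "[:A $$ (N, i):] * monom 1 (n - Suc i)"] exI[of _ 0]) (simp add: w_def)
    next
      case False
      then show ?thesis
        by (intro exI[of _ 0] exI[of _ "[:A $$ (N, i):] * monom 1 (m + n - Suc i)"]) (simp add: w_def)
    qed
    then obtain c d where "[:A $$ (N, i):] * w i = c * p + d * q" by blast
    ultimately have "sum (\<lambda>i. [:A $$ (N, i):] * w i) (insert i I) = (c + a) * p + (d + b) * q"
      using insert by (simp add: algebra_simps del: mult_pCons_left)
    then show ?case by blast
  qed (auto intro!: exI[of _ 0] exI[of _ "0 :: 'a poly"])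
  then show ?thesis using eq by metis
qed

text \<open>The signed maximal minors are orthogonal to each column: the sum is the expansion of the determinant of the
  matrix in which that column is repeated.\<close>

lemma maximal_minors_syzygy:
  fixes M :: "'a::comm_ring_1 mat"
  assumes j: "j < t"
  shows "(\<Sum>i\<le>t. (- 1) ^ i * M $$ (i, j) * det (mat t t (\<lambda>(a, b). M $$ (insert_index i a, b)))) = 0"
proof -
  define A where "A = mat (Suc t) (Suc t) (\<lambda>(a, b). if b = 0 then M $$ (a, j) else M $$ (a, b - 1))"
  have A: "A \<in> carrier_mat (Suc t) (Suc t)" by (simp add: A_def)
  have "col A 0 = col A (Suc j)" using j by (auto simp: A_def)
  then have "det A = 0" using j by (intro det_identical_columns[OF A, of 0 "Suc j"]) auto
  moreover have "det A = (\<Sum>i<Suc t. A $$ (i, 0) * cofactor A i 0)"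
    by (rule laplace_expansion_column[OF A]) simp
  moreover have "A $$ (i, 0) * cofactor A i 0 =
      (- 1) ^ i * M $$ (i, j) * det (mat t t (\<lambda>(a, b). M $$ (insert_index i a, b)))" if "i < Suc t" for i
  proof -
    have "mat_delete A i 0 = mat t t (\<lambda>(a, b). M $$ (insert_index i a, b))"
      using that by (intro eq_matI) (auto simp: mat_delete_def A_def insert_index_def)
    then show ?thesis using that by (simp add: cofactor_def A_def)
  qed
  ultimately show ?thesis by (simp add: lessThan_Suc_atMost)
qed

text \<open>Without its first row, the spread-out matrix is \<open>N - x\<close> with \<open>N\<close> free of \<open>x\<close>.\<close>

lemma maximal_minor_0:
  obtains \<chi> :: "'k::field apoly poly poly" where "maximal_minor t m 0 = (- 1) ^ t * \<chi>" "lead_coeff \<chi> = 1" "degree \<chi> = t"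
proof -
  define N where "N = mat t t (\<lambda>(i, j). if i = j then a_entry m (Suc (Suc i)) (Suc j)
    else if Suc i = j then Polynomial.monom 1 (step m (Suc j)) + a_entry m (Suc j) (Suc j)
    else a_entry m (Suc (Suc i)) (Suc j) :: 'k apoly poly)"
  have N: "N \<in> carrier_mat t t" by (simp add: N_def)
  have minus_one: "[:- 1:] = (- 1 :: 'k apoly poly poly)"
    by (metis minus_pCons minus_zero pCons_one)
  have "mat t t (\<lambda>(i, j). spread_out_matrix t m $$ (insert_index 0 i, j)) = (- 1) \<cdot>\<^sub>m char_poly_matrix N"
    by (rule eq_matI) (auto simp: N_def char_poly_matrix_def spread_out_matrix_def insert_index_def Let_def minus_one)
  then have "maximal_minor t m 0 = (- 1) ^ t * char_poly N"
    using N unfolding maximal_minor_def char_poly_def by (simp add: char_poly_matrix_def)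
  moreover have "lead_coeff (char_poly N) = 1" "degree (char_poly N) = t"
    using degree_monic_char_poly[OF N] by auto
  ultimately show thesis by (rule that)
qed

text \<open>In column \<open>l\<close> (counted from 1) the variable \<open>x\<close> occurs only in the row that is removed to form \<open>f l\<close>, so the
  orthogonality relation for this column can be solved for \<open>x * f l\<close>.\<close>

lemma x_mult_maximal_minor:
  assumes "l \<in> {1..t}"
  shows "\<exists>c. [:0, 1:] * maximal_minor t m l = (\<Sum>i\<le>t. [:c i:] * (maximal_minor t m i :: 'k::field apoly poly poly))"
proof -
  define f where "f = (maximal_minor t m :: nat \<Rightarrow> 'k apoly poly poly)"
  define M where "M = (spread_out_matrix t m :: 'k apoly poly poly mat)"
  define j where "j = l - 1"
  have j: "j < t" "l = Suc j" using assms by (auto simp: j_def)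
  define c where "c = (\<lambda>i. if i = l then a_entry m (Suc l) l else coeff (M $$ (i, j)) 0)"
  have Mij: "M $$ (i, j) = (if i = l then [:c i:] - [:0, 1:] else [:c i:])" if "i \<le> t" for i
    using that j by (auto simp: M_def spread_out_matrix_def Let_def c_def)
  have "0 = (\<Sum>i\<le>t. (- 1) ^ i * M $$ (i, j) * f i)"
    using maximal_minors_syzygy[OF j(1), of M] by (simp add: f_def maximal_minor_def M_def)
  also have "\<dots> = (\<Sum>i\<le>t. (- 1) ^ i * [:c i:] * f i - (if i = l then (- 1) ^ i * ([:0, 1:] * f i) else 0))"
    by (rule sum.cong) (auto simp: Mij algebra_simps)
  also have "\<dots> = (\<Sum>i\<le>t. (- 1) ^ i * [:c i:] * f i) - (- 1) ^ l * ([:0, 1:] * f l)"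
    using assms by (simp add: sum_subtractf)
  finally have "(- 1) ^ l * ([:0, 1:] * f l) = (\<Sum>i\<le>t. (- 1) ^ i * [:c i:] * f i)" by simp
  then have "(- 1) ^ l * ((- 1) ^ l * ([:0, 1:] * f l)) = (\<Sum>i\<le>t. (- 1) ^ l * ((- 1) ^ i * [:c i:] * f i))"
    by (simp only: sum_distrib_left)
  moreover have "(- 1) ^ l * ((- 1) ^ l * ([:0, 1:] * f l)) = [:0, 1:] * f l"
    by (simp only: mult.assoc[symmetric] minus_one_mult_self mult_1_left)
  moreover have "(- 1) ^ l * ((- 1) ^ i * [:c i:] * f i) = [:(- 1) ^ (l + i) * c i:] * f i" for i
  proof -
    have "(- 1) ^ n * [:d:] = [:(- 1) ^ n * d:]" for n and d :: "'k apoly poly"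
      by (induction n) auto
    then show ?thesis by (simp only: mult.assoc[symmetric] power_add[symmetric])
  qed
  ultimately have "[:0, 1:] * f l = (\<Sum>i\<le>t. [:(- 1) ^ (l + i) * c i:] * f i)" by (simp only:)
  then show ?thesis unfolding f_def by (intro exI[of _ "\<lambda>i. (- 1) ^ (l + i) * c i"])
qed

section \<open>Homomorphisms from polynomial rings and residue functionals\<close>

text \<open>Connects the rings that are types, over which the identities between determinants and polynomials are
  proved, with rings given by a carrier, such as the coordinate ring of \<open>S\<close>.\<close>

locale type_ring_hom = cring S for S (structure) +
  fixes h :: "'r::comm_ring_1 \<Rightarrow> 'a"
  assumes h_closed [simp, intro]: "h c \<in> carrier S"
    and h_add: "h (c + d) = h c \<oplus> h d"
    and h_mult: "h (c * d) = h c \<otimes> h d"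
    and h_one: "h 1 = \<one>"
begin

lemma h_zero: "h 0 = \<zero>"
proof -
  have "h 0 \<oplus> h 0 = h 0 \<oplus> \<zero>" using h_add[of 0 0] by simp
  then show ?thesis using add.l_cancel[of "h 0" "h 0" "\<zero>"] by simp
qed

lemma h_sum: "finite I \<Longrightarrow> h (sum g I) = (\<Oplus>i\<in>I. h (g i))"
  by (induction I rule: finite_induct) (auto simp: h_zero h_add)

text \<open>The \<open>h\<close>-semilinear functional that sends the \<open>j\<close>-th power of the variable to \<open>s j\<close>.\<close>

definition seq_sum :: "(nat \<Rightarrow> 'a) \<Rightarrow> 'r poly \<Rightarrow> 'a" where
  "seq_sum s p = (\<Oplus>j\<in>{..degree p}. h (Polynomial.coeff p j) \<otimes> s j)"

context
  fixes s :: "nat \<Rightarrow> 'a"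
  assumes s: "\<And>j. s j \<in> carrier S"
begin

lemma seq_sum_bound:
  assumes "Polynomial.degree p \<le> n" shows "seq_sum s p = (\<Oplus>j\<in>{..n}. h (Polynomial.coeff p j) \<otimes> s j)"
  unfolding seq_sum_def
  by (rule add.finprod_mono_neutral_cong_left) (use assms s in \<open>auto simp: coeff_eq_0 h_zero\<close>)

lemma seq_sum_closed [simp]: "seq_sum s p \<in> carrier S"
  unfolding seq_sum_def using s by auto

lemma seq_sum_add: "seq_sum s (p + q) = seq_sum s p \<oplus> seq_sum s q"
proof -
  define n where "n = max (Polynomial.degree p) (Polynomial.degree q)"
  have n: "Polynomial.degree p \<le> n" "Polynomial.degree q \<le> n" "Polynomial.degree (p + q) \<le> n"
    unfolding n_def using degree_add_le_max[of p q] by auto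
  show ?thesis unfolding seq_sum_bound[OF n(1)] seq_sum_bound[OF n(2)] seq_sum_bound[OF n(3)]
    using s by (subst finsum_addf[symmetric]) (auto simp: h_add l_distr)
qed

lemma seq_sum_zero [simp]: "seq_sum s 0 = \<zero>"
  unfolding seq_sum_def using s by (simp add: h_zero)

lemma seq_sum_sum: "finite I \<Longrightarrow> seq_sum s (sum g I) = (\<Oplus>i\<in>I. seq_sum s (g i))"
  by (induction I rule: finite_induct) (auto simp: seq_sum_add)

lemma seq_sum_smult: "seq_sum s (smult c p) = h c \<otimes> seq_sum s p"
proof -
  have "seq_sum s (smult c p) = (\<Oplus>j\<in>{..degree p}. h (Polynomial.coeff (smult c p) j) \<otimes> s j)"
    by (rule seq_sum_bound) (rule degree_smult_le)
  also have "\<dots> = h c \<otimes> seq_sum s p"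
    unfolding seq_sum_def using s by (subst finsum_rdistr) (auto simp: h_mult m_assoc)
  finally show ?thesis .
qed

end

lemma seq_sum_pCons:
  assumes s: "\<And>j. s j \<in> carrier S"
  shows "seq_sum s (pCons a p) = h a \<otimes> s 0 \<oplus> seq_sum (\<lambda>j. s (Suc j)) p"
proof -
  have "seq_sum s (pCons a p) = (\<Oplus>j\<in>{..Suc (Polynomial.degree p)}. h (Polynomial.coeff (pCons a p) j) \<otimes> s j)"
    by (rule seq_sum_bound[OF s]) (rule degree_pCons_le)
  also have "\<dots> = (\<Oplus>j\<in>{..degree p}. h (Polynomial.coeff p j) \<otimes> s (Suc j)) \<oplus> h a \<otimes> s 0"
    using s by (subst finsum_Suc2) auto
  finally show ?thesis unfolding seq_sum_def using s by (simp add: a_comm)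
qed

text \<open>A functional kills the multiples of \<open>q\<close> as soon as its sequence satisfies the linear recurrence with the
  coefficients of \<open>q\<close>.\<close>

lemma seq_sum_recurrence:
  assumes "\<And>j. s j \<in> carrier S" and "\<And>j. seq_sum (\<lambda>i. s (i + j)) q = \<zero>"
  shows "seq_sum s (q * p) = \<zero>"
  using assms
proof (induction p arbitrary: s)
  case 0 then show ?case by simp
next
  case (pCons a p)
  have IH: "seq_sum (\<lambda>j. s (Suc j)) (q * p) = \<zero>"
    using pCons.prems(2)[of "Suc j" for j] by (intro pCons.IH) (auto simp: pCons.prems(1))
  have "q * pCons a p = smult a q + pCons 0 (q * p)" by (simp add: mult.commute)
  moreover have "seq_sum s q = \<zero>" using pCons.prems(2)[of 0] by simp
  ultimately show ?case using pCons.prems(1) IH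
    by (simp add: seq_sum_add seq_sum_smult seq_sum_pCons h_zero)
qed

end

text \<open>For \<open>c\<close> the coefficients of a polynomial \<open>p\<close> of degree \<open>n + 1\<close> with a unit in front, \<open>s j\<close> is the coefficient
  of \<open>1/y\<close> in \<open>y^j / p\<close>.\<close>

lemma (in cring) linear_recurrence_exists:
  assumes c: "\<And>l. c l \<in> carrier R" and u: "u \<in> carrier R" "c (Suc n) \<otimes> u = \<one>"
  obtains s where "\<And>j. s j \<in> carrier R" "\<And>i. i < n \<Longrightarrow> s i = \<zero>" "s n = u"
    "\<And>j. (\<Oplus>l\<in>{..Suc n}. c l \<otimes> s (l + j)) = \<zero>"
proof -
  \<comment> \<open>The state at time \<open>j\<close> is the window \<open>s j, \<dots>, s (j + n)\<close> of the sequence.\<close>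
  define v where "v = rec_nat (\<lambda>i. if i = n then u else \<zero>)
    (\<lambda>_ w i. if i < n then w (Suc i) else \<ominus> (u \<otimes> (\<Oplus>l\<in>{..n}. c l \<otimes> w l)))"
  have v0: "v 0 i = (if i = n then u else \<zero>)" for i by (simp add: v_def)
  have vS: "v (Suc j) i = (if i < n then v j (Suc i) else \<ominus> (u \<otimes> (\<Oplus>l\<in>{..n}. c l \<otimes> v j l)))" for i j
    by (simp add: v_def)
  have vc: "v j i \<in> carrier R" for j i
    by (induction j arbitrary: i) (auto simp: v0 vS u c)
  define s where "s = (\<lambda>j. v j 0)"
  have vs: "i \<le> n \<Longrightarrow> v j i = s (i + j)" for i j
  proof (induction i arbitrary: j)
    case (Suc i)
    have "v j (Suc i) = v (Suc j) i" unfolding vS using Suc.prems by simp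
    also have "\<dots> = s (i + Suc j)" using Suc by simp
    finally show ?case by simp
  qed (simp add: s_def)
  show thesis
  proof
    show "s j \<in> carrier R" for j by (simp add: s_def vc)
    show "s i = \<zero>" if "i < n" for i using vs[of i 0] that by (simp add: v0)
    show "s n = u" using vs[of n 0] by (simp add: v0)
    fix j
    let ?t = "\<Oplus>l\<in>{..n}. c l \<otimes> s (l + j)"
    have tc: "?t \<in> carrier R" by (simp add: s_def vc c)
    have "s (Suc n + j) = v (Suc j) n" using vs[of n "Suc j"] by simp
    also have "\<dots> = \<ominus> (u \<otimes> ?t)"
      unfolding vS using vs[of _ j] c vc by (auto simp: s_def intro!: arg_cong[of _ _ "\<lambda>x. \<ominus> (u \<otimes> x)"] add.finprod_cong')
    finally have "c (Suc n) \<otimes> s (Suc n + j) = \<ominus> (c (Suc n) \<otimes> u \<otimes> ?t)"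
      using tc c u by (simp add: r_minus m_assoc[symmetric])
    then show "(\<Oplus>l\<in>{..Suc n}. c l \<otimes> s (l + j)) = \<zero>"
      using tc c u vc by (simp add: s_def l_neg)
  qed
qed

lemma (in type_ring_hom) UP_type_ring_hom: "type_ring_hom (UP S) (\<lambda>p i. h (Polynomial.coeff p i))"
proof -
  interpret U: UP_cring S "UP S" by unfold_locales auto
  have cl: "(\<lambda>i. h (Polynomial.coeff p i)) \<in> up S" for p
    by (rule mem_upI) (auto intro!: exI[of _ "Polynomial.degree p"] simp: bound_def coeff_eq_0 h_zero)
  show ?thesis
  proof
    fix p q :: "'r poly"
    show "(\<lambda>i. h (Polynomial.coeff p i)) \<in> carrier (UP S)" using cl by (simp add: UP_def)
    show "(\<lambda>i. h (Polynomial.coeff (p + q) i)) = (\<lambda>i. h (Polynomial.coeff p i)) \<oplus>\<^bsub>UP S\<^esub> (\<lambda>i. h (Polynomial.coeff q i))"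
      using cl by (simp add: UP_def h_add)
    show "(\<lambda>i. h (Polynomial.coeff (p * q) i)) = (\<lambda>i. h (Polynomial.coeff p i)) \<otimes>\<^bsub>UP S\<^esub> (\<lambda>i. h (Polynomial.coeff q i))"
      using cl by (simp add: UP_def coeff_mult h_sum h_mult)
    show "(\<lambda>i. h (Polynomial.coeff 1 i)) = \<one>\<^bsub>UP S\<^esub>"
      by (auto simp: UP_def fun_eq_iff h_one h_zero)
  qed
qed

lemma (in UP_ring) UP_additive_induct [consumes 1, case_names zero add monom]:
  assumes p: "p \<in> carrier P" and 0: "Q \<zero>\<^bsub>P\<^esub>"
    and add: "\<And>p q. p \<in> carrier P \<Longrightarrow> q \<in> carrier P \<Longrightarrow> Q p \<Longrightarrow> Q q \<Longrightarrow> Q (p \<oplus>\<^bsub>P\<^esub> q)"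
    and monom: "\<And>a i. a \<in> carrier R \<Longrightarrow> Q (up_ring.monom P a i)"
  shows "Q p"
proof -
  have "Q (\<Oplus>\<^bsub>P\<^esub>i\<in>I. up_ring.monom P (g i) i)" if "finite I" "\<And>i. g i \<in> carrier R" for g I
    using that
  proof (induction I rule: finite_induct)
    case (insert i I)
    then show ?case by (subst finsum_insert) (auto intro!: add monom)
  qed (simp add: 0)
  from this[of "{..deg R p}" "up_ring.coeff P p"] show ?thesis using up_repr[OF p] p by simp
qed

text \<open>Functionals on polynomial rings are built one variable at a time, and only their additivity survives in
  between; linearity over the coefficients is recovered at the end.\<close>

definition additive_map :: "('a, 'm) ring_scheme \<Rightarrow> ('b, 'n) ring_scheme \<Rightarrow> ('a \<Rightarrow> 'b) \<Rightarrow> bool" where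
  "additive_map R S F \<longleftrightarrow> F \<in> carrier R \<rightarrow> carrier S \<and>
     (\<forall>x\<in>carrier R. \<forall>y\<in>carrier R. F (x \<oplus>\<^bsub>R\<^esub> y) = F x \<oplus>\<^bsub>S\<^esub> F y)"

lemma additive_zero:
  assumes "ring R" "ring S" "additive_map R S F" shows "F \<zero>\<^bsub>R\<^esub> = \<zero>\<^bsub>S\<^esub>"
proof -
  interpret R: ring R by fact
  interpret S: ring S by fact
  have "F \<zero>\<^bsub>R\<^esub> \<in> carrier S" using assms(3) by (auto simp: additive_map_def)
  moreover have "F \<zero>\<^bsub>R\<^esub> \<oplus>\<^bsub>S\<^esub> F \<zero>\<^bsub>R\<^esub> = F \<zero>\<^bsub>R\<^esub> \<oplus>\<^bsub>S\<^esub> \<zero>\<^bsub>S\<^esub>"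
    using assms(3) calculation unfolding additive_map_def by (metis R.l_zero R.zero_closed S.r_zero)
  ultimately show ?thesis using S.add.l_cancel by blast
qed

lemma UP_additive_extension:
  assumes R: "ring R" and S: "ring S" and F: "\<And>i. additive_map R S (F i)"
  obtains G where "additive_map (UP R) S G" "\<And>a i. a \<in> carrier R \<Longrightarrow> G (up_ring.monom (UP R) a i) = F i a"
proof -
  interpret R: ring R by fact
  interpret S: ring S by fact
  interpret U: UP_ring R "UP R" by unfold_locales auto
  have Fc: "F i a \<in> carrier S" if "a \<in> carrier R" for i a using F[of i] that by (auto simp: additive_map_def)
  have Fa: "F i (a \<oplus>\<^bsub>R\<^esub> b) = F i a \<oplus>\<^bsub>S\<^esub> F i b" if "a \<in> carrier R" "b \<in> carrier R" for i a b
    using F[of i] that by (auto simp: additive_map_def)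
  have F0: "F i \<zero>\<^bsub>R\<^esub> = \<zero>\<^bsub>S\<^esub>" for i using additive_zero[OF R S F] .
  define G where "G = (\<lambda>p. \<Oplus>\<^bsub>S\<^esub>i\<in>{..deg R p}. F i (up_ring.coeff (UP R) p i))"
  have Gb: "G p = (\<Oplus>\<^bsub>S\<^esub>i\<in>{..n}. F i (up_ring.coeff (UP R) p i))" if "p \<in> carrier (UP R)" "deg R p \<le> n" for p n
    unfolding G_def
    by (rule S.add.finprod_mono_neutral_cong_left) (use that in \<open>auto simp: U.deg_aboveD F0 Fc\<close>)
  have "additive_map (UP R) S G"
    unfolding additive_map_def
  proof (intro conjI ballI funcsetI)
    show "G p \<in> carrier S" if "p \<in> carrier (UP R)" for p
      unfolding G_def using that by (auto simp: Fc)
    fix p q assume p: "p \<in> carrier (UP R)" and q: "q \<in> carrier (UP R)"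
    define n where "n = max (deg R (p \<oplus>\<^bsub>UP R\<^esub> q)) (max (deg R p) (deg R q))"
    have "G (p \<oplus>\<^bsub>UP R\<^esub> q) = (\<Oplus>\<^bsub>S\<^esub>i\<in>{..n}. F i (up_ring.coeff (UP R) (p \<oplus>\<^bsub>UP R\<^esub> q) i))"
      by (rule Gb) (use p q n_def in auto)
    also have "\<dots> = (\<Oplus>\<^bsub>S\<^esub>i\<in>{..n}. F i (up_ring.coeff (UP R) p i) \<oplus>\<^bsub>S\<^esub> F i (up_ring.coeff (UP R) q i))"
      by (rule S.add.finprod_cong') (use p q in \<open>auto simp: Fa Fc\<close>)
    also have "\<dots> = (\<Oplus>\<^bsub>S\<^esub>i\<in>{..n}. F i (up_ring.coeff (UP R) p i)) \<oplus>\<^bsub>S\<^esub> (\<Oplus>\<^bsub>S\<^esub>i\<in>{..n}. F i (up_ring.coeff (UP R) q i))"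
      by (rule S.finsum_addf) (use p q in \<open>auto simp: Fc\<close>)
    also have "(\<Oplus>\<^bsub>S\<^esub>i\<in>{..n}. F i (up_ring.coeff (UP R) p i)) = G p"
      by (rule Gb[symmetric]) (use p n_def in auto)
    also have "(\<Oplus>\<^bsub>S\<^esub>i\<in>{..n}. F i (up_ring.coeff (UP R) q i)) = G q"
      by (rule Gb[symmetric]) (use q n_def in auto)
    finally show "G (p \<oplus>\<^bsub>UP R\<^esub> q) = G p \<oplus>\<^bsub>S\<^esub> G q" .
  qed
  moreover have "G (up_ring.monom (UP R) a i) = F i a" if a: "a \<in> carrier R" for a i
  proof -
    have "G (up_ring.monom (UP R) a i) = (\<Oplus>\<^bsub>S\<^esub>j\<in>{..i}. F j (up_ring.coeff (UP R) (up_ring.monom (UP R) a i) j))"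
      by (rule Gb) (use a U.deg_monom_le in auto)
    also have "\<dots> = (\<Oplus>\<^bsub>S\<^esub>j\<in>{..i}. if i = j then F j a else \<zero>\<^bsub>S\<^esub>)"
      by (rule S.add.finprod_cong') (use a in \<open>auto simp: F0 Fc\<close>)
    also have "\<dots> = F i a" using S.add.finprod_singleton[of i "{..i}" "\<lambda>j. F j a"] a by (auto simp: Fc)
    finally show ?thesis .
  qed
  ultimately show thesis by (rule that)
qed

context type_ring_hom
begin

text \<open>The image of \<open>p\<close> under \<open>h\<close> has degree \<open>n\<close>, with a unit in front.\<close>

definition unit_top :: "'r poly \<Rightarrow> nat \<Rightarrow> bool" where
  "unit_top p n \<longleftrightarrow> (\<forall>i>n. h (Polynomial.coeff p i) = \<zero>) \<and> h (Polynomial.coeff p n) \<in> Units S"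

lemma unit_top_mult:
  assumes p: "unit_top p n" and q: "unit_top q m"
  shows "unit_top (p * q) (n + m)"
proof -
  have sum: "h (Polynomial.coeff (p * q) k) = (\<Oplus>i\<in>{..k}. h (Polynomial.coeff p i) \<otimes> h (Polynomial.coeff q (k - i)))" for k
    by (simp add: coeff_mult h_sum h_mult)
  have z: "h (Polynomial.coeff p i) \<otimes> h (Polynomial.coeff q (k - i)) = \<zero>" if "i > n \<or> k - i > m" for i k
    using that p q unfolding unit_top_def by auto
  have "h (Polynomial.coeff (p * q) k) = \<zero>" if "k > n + m" for k
    unfolding sum by (rule add.finprod_one_eqI, rule z) (use that in auto)
  moreover have "h (Polynomial.coeff (p * q) (n + m)) =
      (\<Oplus>i\<in>{..n + m}. if n = i then h (Polynomial.coeff p i) \<otimes> h (Polynomial.coeff q m) else \<zero>)"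
    unfolding sum
  proof (rule add.finprod_cong')
    fix i assume i: "i \<in> {..n + m}"
    consider "i = n" | "i > n" | "n + m - i > m" by linarith
    then show "h (Polynomial.coeff p i) \<otimes> h (Polynomial.coeff q (n + m - i)) =
        (if n = i then h (Polynomial.coeff p i) \<otimes> h (Polynomial.coeff q m) else \<zero>)"
      by cases (use z[of i "n + m"] i in auto)
  qed auto
  then have "h (Polynomial.coeff (p * q) (n + m)) = h (Polynomial.coeff p n) \<otimes> h (Polynomial.coeff q m)"
    using add.finprod_singleton[of n "{..n + m}" "\<lambda>i. h (Polynomial.coeff p i) \<otimes> h (Polynomial.coeff q m)"] by simp
  ultimately show ?thesis using p q unfolding unit_top_def by auto
qed

lemma unit_top_power: "unit_top p n \<Longrightarrow> unit_top (p ^ s) (s * n)"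
proof (induction s)
  case 0 then show ?case by (auto simp: unit_top_def h_one h_zero)
next
  case (Suc s) then show ?case using unit_top_mult[of p n "p ^ s" "s * n"] by simp
qed

lemma unit_top_X: "unit_top [:0, 1:] 1"
  by (auto simp: unit_top_def h_one h_zero coeff_pCons split: nat.splits)

end

lemma poly_poly_additive_induct [case_names zero add monom]:
  fixes p :: "'r::comm_ring_1 poly poly"
  assumes 0: "Q 0" and add: "\<And>p q. Q p \<Longrightarrow> Q q \<Longrightarrow> Q (p + q)"
    and mon: "\<And>c a b. Q ([:[:c:]:] * monom (monom 1 b) a)"
  shows "Q p"
proof -
  have s: "Q (sum g I)" if "\<And>i. i \<in> I \<Longrightarrow> Q (g i)" for g and I :: "nat set"
    using that by (induction I rule: infinite_finite_induct) (auto simp: 0 add)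
  have 1: "Q (monom u a)" for u a
  proof -
    have "monom u a = monom (\<Sum>b\<le>degree u. monom (coeff u b) b) a" by (simp add: poly_as_sum_of_monoms)
    also have "\<dots> = (\<Sum>b\<le>degree u. [:[:coeff u b:]:] * monom (monom 1 b) a)"
      by (simp add: monom_sum smult_monom)
    finally show ?thesis using s[of "{..degree u}"] mon by simp
  qed
  have "Q (\<Sum>a\<le>degree p. monom (coeff p a) a)" by (rule s) (rule 1)
  then show ?thesis by (simp add: poly_as_sum_of_monoms)
qed

context type_ring_hom
begin

abbreviation Sy where "Sy \<equiv> UP S"
abbreviation Sxy where "Sxy \<equiv> UP (UP S)"

interpretation y: UP_cring S Sy by unfold_locales auto
interpretation xy: UP_cring Sy Sxy by unfold_locales auto
interpretation hy: type_ring_hom Sy "\<lambda>p i. h (Polynomial.coeff p i)" by (rule UP_type_ring_hom)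

definition h_xy :: "'r poly poly \<Rightarrow> nat \<Rightarrow> nat \<Rightarrow> 'a" where
  "h_xy p = (\<lambda>i j. h (Polynomial.coeff (Polynomial.coeff p i) j))"

definition const_xy :: "'a \<Rightarrow> nat \<Rightarrow> nat \<Rightarrow> 'a" where
  "const_xy a = up_ring.monom Sxy (up_ring.monom Sy a 0) 0"

lemma h_xy_hom: "type_ring_hom Sxy h_xy"
  using hy.UP_type_ring_hom unfolding h_xy_def[abs_def] .

interpretation hxy: type_ring_hom Sxy h_xy by (rule h_xy_hom)

lemma const_xy_hom: "const_xy \<in> Ring.ring_hom S Sxy"
proof (rule ring_hom_memI)
  fix a b assume "a \<in> carrier S" "b \<in> carrier S"
  then show "const_xy (a \<otimes> b) = const_xy a \<otimes>\<^bsub>Sxy\<^esub> const_xy b"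
    using y.monom_mult[of a b 0 0] xy.monom_mult[of "up_ring.monom Sy a 0" "up_ring.monom Sy b 0" 0 0]
    by (simp add: const_xy_def)
qed (auto simp: const_xy_def)

lemma const_xy_closed [simp]: "a \<in> carrier S \<Longrightarrow> const_xy a \<in> carrier Sxy"
  by (simp add: const_xy_def)

lemma const_xy_mult: "a \<in> carrier S \<Longrightarrow> b \<in> carrier S \<Longrightarrow> const_xy (a \<otimes> b) = const_xy a \<otimes>\<^bsub>Sxy\<^esub> const_xy b"
  using ring_hom_mult[OF const_xy_hom] .

lemma monom_Sxy:
  "a \<in> carrier S \<Longrightarrow> up_ring.monom Sxy (up_ring.monom Sy a j) i = (\<lambda>k l. if k = i \<and> l = j then a else \<zero>)"
  using y.monom_closed[of a j] unfolding UP_def by (simp only: up_ring.select_convs ring_record_simps restrict_apply' partial_object.select_convs) force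

lemma h_xy_const: "h_xy [:[:c:]:] = const_xy (h c)"
  unfolding const_xy_def monom_Sxy[OF h_closed] h_xy_def
  by (intro ext) (simp add: coeff_pCons h_zero split: nat.split)

lemma const_xy_monom:
  assumes a: "a \<in> carrier S"
  shows "const_xy a \<otimes>\<^bsub>Sxy\<^esub> h_xy (Polynomial.monom (Polynomial.monom 1 j) i) = up_ring.monom Sxy (up_ring.monom Sy a j) i"
proof -
  have "h_xy (Polynomial.monom (Polynomial.monom 1 j) i) = up_ring.monom Sxy (up_ring.monom Sy \<one> j) i"
    unfolding monom_Sxy[OF one_closed] h_xy_def
    by (intro ext) (simp add: h_zero h_one)
  then show ?thesis
    using a y.monom_mult[of a \<one> 0 j] xy.monom_mult[of "up_ring.monom Sy a 0" "up_ring.monom Sy \<one> j" 0 i]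
    by (simp add: const_xy_def)
qed

lemma Sxy_induct [consumes 1, case_names zero add monom]:
  assumes "p \<in> carrier Sxy" and 0: "Q \<zero>\<^bsub>Sxy\<^esub>"
    and add: "\<And>p q. p \<in> carrier Sxy \<Longrightarrow> q \<in> carrier Sxy \<Longrightarrow> Q p \<Longrightarrow> Q q \<Longrightarrow> Q (p \<oplus>\<^bsub>Sxy\<^esub> q)"
    and mon: "\<And>a i j. a \<in> carrier S \<Longrightarrow> Q (const_xy a \<otimes>\<^bsub>Sxy\<^esub> h_xy (Polynomial.monom (Polynomial.monom 1 j) i))"
  shows "Q p"
  using assms(1)
proof (induction p rule: xy.UP_additive_induct)
  case (monom u i)
  then show ?case
  proof (induction u rule: y.UP_additive_induct)
    case zero then show ?case using 0 by simp
  next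
    case (add u v) then show ?case using assms(3) by simp
  next
    case (monom a j) then show ?case using mon[of a j i] by (simp add: const_xy_monom)
  qed
qed (auto intro: 0 add)

text \<open>An \<open>h\<close>-semilinear functional extends to the polynomials over \<open>S\<close>, because it is determined by its values on
  the monomials.\<close>

lemma functional_extension:
  fixes L :: "'r poly poly \<Rightarrow> 'a"
  assumes Lc: "\<And>p. L p \<in> carrier S" and La: "\<And>p q. L (p + q) = L p \<oplus> L q"
    and Ls: "\<And>c p. L ([:[:c:]:] * p) = h c \<otimes> L p"
  obtains \<phi> where "additive_map Sxy S \<phi>"
    and "\<And>a p. a \<in> carrier S \<Longrightarrow> p \<in> carrier Sxy \<Longrightarrow> \<phi> (const_xy a \<otimes>\<^bsub>Sxy\<^esub> p) = a \<otimes> \<phi> p"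
    and "\<And>p. \<phi> (h_xy p) = L p"
proof -
  define m where "m = (\<lambda>i j. Polynomial.monom (Polynomial.monom 1 j) i :: 'r poly poly)"
  have "additive_map S S (\<lambda>a. a \<otimes> L (m i j))" for i j
    by (auto simp: additive_map_def Lc l_distr)
  then have "\<exists>G. additive_map Sy S G \<and> (\<forall>a j. a \<in> carrier S \<longrightarrow> G (up_ring.monom Sy a j) = a \<otimes> L (m i j))" for i
    using UP_additive_extension[OF ring_axioms ring_axioms, of "\<lambda>j a. a \<otimes> L (m i j)"] by blast
  then obtain G where "\<forall>i. additive_map Sy S (G i) \<and>
      (\<forall>a j. a \<in> carrier S \<longrightarrow> G i (up_ring.monom Sy a j) = a \<otimes> L (m i j))"
    using choice[of "\<lambda>i G. additive_map Sy S G \<and> (\<forall>a j. a \<in> carrier S \<longrightarrow> G (up_ring.monom Sy a j) = a \<otimes> L (m i j))"] by blast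
  then have G: "\<And>i. additive_map Sy S (G i)"
    "\<And>i a j. a \<in> carrier S \<Longrightarrow> G i (up_ring.monom Sy a j) = a \<otimes> L (m i j)" by blast+
  obtain \<phi> where \<phi>: "additive_map Sxy S \<phi>"
    "\<And>u i. u \<in> carrier Sy \<Longrightarrow> \<phi> (up_ring.monom Sxy u i) = G i u"
    using UP_additive_extension[OF y.UP_ring ring_axioms, of G] G(1) by blast
  have \<phi>m: "\<phi> (const_xy a \<otimes>\<^bsub>Sxy\<^esub> h_xy (m i j)) = a \<otimes> L (m i j)" if "a \<in> carrier S" for a i j
    using that \<phi>(2) G(2) by (simp add: m_def const_xy_monom)
  have \<phi>c: "\<phi> p \<in> carrier S" if "p \<in> carrier Sxy" for p using \<phi>(1) that by (auto simp: additive_map_def)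
  have \<phi>a: "\<phi> (p \<oplus>\<^bsub>Sxy\<^esub> q) = \<phi> p \<oplus> \<phi> q" if "p \<in> carrier Sxy" "q \<in> carrier Sxy" for p q
    using \<phi>(1) that by (auto simp: additive_map_def)
  have \<phi>0: "\<phi> \<zero>\<^bsub>Sxy\<^esub> = \<zero>" by (rule additive_zero[OF xy.UP_ring ring_axioms \<phi>(1)])
  have \<phi>s: "\<phi> (const_xy a \<otimes>\<^bsub>Sxy\<^esub> p) = a \<otimes> \<phi> p" if a: "a \<in> carrier S" and p: "p \<in> carrier Sxy" for a p
    using p
  proof (induction p rule: Sxy_induct)
    case zero then show ?case using a by (simp add: \<phi>0)
  next
    case (add p q) then show ?case using a by (simp add: xy.P.r_distr r_distr \<phi>a \<phi>c)
  next
    case (monom b i j)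
    then have "const_xy a \<otimes>\<^bsub>Sxy\<^esub> (const_xy b \<otimes>\<^bsub>Sxy\<^esub> h_xy (m i j)) = const_xy (a \<otimes> b) \<otimes>\<^bsub>Sxy\<^esub> h_xy (m i j)"
      using a by (simp add: const_xy_mult xy.P.m_assoc)
    then show ?case using a monom \<phi>m[of "a \<otimes> b" i j] \<phi>m[of b i j] by (simp add: m_def m_assoc Lc)
  qed
  have L0: "L 0 = \<zero>" using Ls[of 0 0] Lc[of 0] by (simp add: h_zero)
  have "\<phi> (h_xy p) = L p" for p
  proof (induction p rule: poly_poly_additive_induct)
    case zero then show ?case by (simp add: hxy.h_zero \<phi>0 L0)
  next
    case (add p q) then show ?case by (simp add: hxy.h_add \<phi>a La)
  next
    case (monom c i j)
    show ?case unfolding hxy.h_mult h_xy_const Ls using \<phi>m[of "h c" i j] by (simp add: m_def)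
  qed
  with \<phi>(1) \<phi>s show thesis by (rule that)
qed

end

section \<open>A dual basis of the quotient by the minors\<close>

lemma (in abelian_monoid) finsum_Times:
  assumes "finite I" "finite J" "\<And>i j. i \<in> I \<Longrightarrow> j \<in> J \<Longrightarrow> g (i, j) \<in> carrier G"
  shows "(\<Oplus>x\<in>I \<times> J. g x) = (\<Oplus>i\<in>I. \<Oplus>j\<in>J. g (i, j))"
  using assms(1,3)
proof (induction I rule: finite_induct)
  case (insert i I)
  have eq: "insert i I \<times> J = Pair i ` J \<union> I \<times> J" by auto
  have "(\<Oplus>x\<in>insert i I \<times> J. g x) = (\<Oplus>x\<in>Pair i ` J. g x) \<oplus> (\<Oplus>x\<in>I \<times> J. g x)"
    unfolding eq by (rule finsum_Un_disjoint) (use insert.hyps insert.prems assms(2) in auto)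
  also have "(\<Oplus>x\<in>Pair i ` J. g x) = (\<Oplus>j\<in>J. g (i, j))"
    by (rule finsum_reindex) (use insert.prems in \<open>auto simp: inj_on_def\<close>)
  finally show ?case using insert by simp
qed simp

lemma finsum_restrict_scalars [simp]: "finsum (restrict_scalars Q \<rho>) g I = finsum Q g I"
  by (simp add: finsum_def finprod_def restrict_scalars_def)

lemma ring_hom_cringI2:
  assumes "cring R" "cring S" "\<rho> \<in> Ring.ring_hom R S" shows "ring_hom_cring R S \<rho>"
  using assms by (intro ring_hom_cring.intro ring_hom_cring_axioms.intro)

lemma module_restrict_scalars:
  assumes A: "cring A" and Q: "cring Q" and \<rho>: "\<rho> \<in> Ring.ring_hom A Q"
  shows "Module.module A (restrict_scalars Q \<rho>)"
proof -
  interpret A: cring A by fact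
  interpret Q: cring Q by fact
  interpret \<rho>: ring_hom_cring A Q \<rho> by (rule ring_hom_cringI2) fact+
  have rs: "carrier (restrict_scalars Q \<rho>) = carrier Q" "add (restrict_scalars Q \<rho>) = add Q"
    "ring.zero (restrict_scalars Q \<rho>) = ring.zero Q" "a \<odot>\<^bsub>restrict_scalars Q \<rho>\<^esub> x = \<rho> a \<otimes>\<^bsub>Q\<^esub> x" for a x
    by (auto simp: restrict_scalars_def)
  have "abelian_group (restrict_scalars Q \<rho>)"
  proof (rule abelian_groupI)
    show "\<exists>y\<in>carrier (restrict_scalars Q \<rho>). y \<oplus>\<^bsub>restrict_scalars Q \<rho>\<^esub> x = \<zero>\<^bsub>restrict_scalars Q \<rho>\<^esub>"
      if "x \<in> carrier (restrict_scalars Q \<rho>)" for x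
      using that Q.l_neg[of x] Q.a_inv_closed[of x] unfolding rs by blast
  qed (auto simp: rs Q.a_ac)
  then show ?thesis
    by (intro Module.moduleI A) (auto simp: rs Q.l_distr Q.r_distr Q.m_assoc)
qed

text \<open>The ring \<open>A\<close> plays the part of the coordinate ring of \<open>S\<close>, and \<open>Q\<close> that of the coordinate ring of the family
  over it.\<close>

locale unit_resultant_family = type_ring_hom A h + determinantal_generators f t \<chi> r
  for A (structure) and h :: "'r::comm_ring_1 \<Rightarrow> 'a"
    and f :: "nat \<Rightarrow> 'r poly poly" and t and \<chi> :: "'r poly poly" and r :: "'r poly" +
  fixes n :: nat
  assumes unit_top_r: "unit_top r n"
begin

interpretation y: UP_cring A Sy by unfold_locales auto
interpretation xy: UP_cring Sy Sxy by unfold_locales auto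
interpretation hxy: type_ring_hom Sxy h_xy by (rule h_xy_hom)

definition minors where "minors = Idl\<^bsub>Sxy\<^esub> {h_xy (f l) | l. l \<le> t}"

definition Q where "Q = Sxy Quot minors"

definition proj where "proj p = minors +>\<^bsub>Sxy\<^esub> p"

definition to_Q where "to_Q a = proj (const_xy a)"

lemma minors_ideal: "ideal minors Sxy"
  unfolding minors_def by (rule xy.P.genideal_ideal) auto

lemma Q_cring: "cring Q"
  unfolding Q_def by (rule ideal.quotient_is_cring[OF minors_ideal xy.P.cring_axioms])

lemma proj_hom: "proj \<in> Ring.ring_hom Sxy Q"
  using ideal.rcos_ring_hom[OF minors_ideal] unfolding Q_def proj_def[abs_def] .

lemma to_Q_hom: "to_Q \<in> Ring.ring_hom A Q"
  using ring_hom_trans[OF const_xy_hom proj_hom] by (simp add: to_Q_def[abs_def] comp_def)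

interpretation Q: cring Q by (rule Q_cring)
interpretation proj: ring_hom_cring Sxy Q proj
  by (rule ring_hom_cringI2) (rule xy.P.cring_axioms Q_cring proj_hom)+
interpretation to_Q: ring_hom_cring A Q to_Q
  by (rule ring_hom_cringI2) (rule cring_axioms Q_cring to_Q_hom)+

definition h_Q where "h_Q p = proj (h_xy p)"

interpretation hQ: type_ring_hom Q h_Q
  by unfold_locales (auto simp: h_Q_def hxy.h_add hxy.h_mult hxy.h_one)

lemma h_Q_const: "h_Q [:[:c:]:] = to_Q (h c)"
  by (simp add: h_Q_def to_Q_def h_xy_const)

lemma proj_zero: "p \<in> minors \<Longrightarrow> proj p = \<zero>\<^bsub>Q\<^esub>"
  using xy.P.quotient_eq_iff_same_a_r_cos[OF minors_ideal, of p "\<zero>\<^bsub>Sxy\<^esub>"] ideal.Icarr[OF minors_ideal, of p]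
    proj.hom_zero by (simp add: proj_def xy.P.minus_eq)

lemma h_Q_minor: "l \<le> t \<Longrightarrow> h_Q (f l) = \<zero>\<^bsub>Q\<^esub>"
proof -
  assume "l \<le> t"
  then have "h_xy (f l) \<in> minors"
    unfolding minors_def using xy.P.genideal_self[of "{h_xy (f l) | l. l \<le> t}"] by auto
  then show ?thesis by (simp add: h_Q_def proj_zero)
qed

lemma unit_top_rho: "unit_top \<rho> (Suc (t * n))"
  using unit_top_mult[OF unit_top_X unit_top_power[OF unit_top_r, of t]] by (simp add: \<rho>_def)

text \<open>A functional in \<open>z\<close> with values in \<open>A\<close> also acts on polynomials in \<open>x\<close>, \<open>y\<close>, \<open>z\<close>, with values in \<open>Q\<close>: the
  variables \<open>x\<close> and \<open>y\<close> go to their classes.  Both actions agree on polynomials in \<open>z\<close> alone.\<close>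

lemma seq_sum_z_poly:
  assumes w: "\<And>j. w j \<in> carrier A"
  shows "hQ.seq_sum (\<lambda>j. to_Q (w j)) (z_poly p) = to_Q (seq_sum w p)"
proof -
  have "Polynomial.degree (z_poly p) \<le> Polynomial.degree p"
    by (rule degree_le) (simp add: coeff_eq_0)
  then have "hQ.seq_sum (\<lambda>j. to_Q (w j)) (z_poly p) =
      (\<Oplus>\<^bsub>Q\<^esub>j\<in>{..Polynomial.degree p}. h_Q (Polynomial.coeff (z_poly p) j) \<otimes>\<^bsub>Q\<^esub> to_Q (w j))"
    using w by (intro hQ.seq_sum_bound) auto
  also have "\<dots> = (\<Oplus>\<^bsub>Q\<^esub>j\<in>{..Polynomial.degree p}. to_Q (h (Polynomial.coeff p j) \<otimes> w j))"
    using w by (simp add: h_Q_const)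
  also have "\<dots> = to_Q (seq_sum w p)"
    unfolding seq_sum_def using w by (subst to_Q.hom_finsum) (auto simp: comp_def)
  finally show ?thesis .
qed

text \<open>The values on the powers of the variable of a functional \<open>\<lambda>\<close> that behaves like the coefficient of \<open>1/y\<close> in
  \<open>p / \<rho>\<close>.\<close>

definition residue_seq :: "(nat \<Rightarrow> 'a) \<Rightarrow> bool" where
  "residue_seq s \<longleftrightarrow> (\<forall>j. s j \<in> carrier A) \<and> (\<forall>p. seq_sum s (\<rho> * p) = \<zero>) \<and>
     (\<forall>G. hQ.seq_sum (\<lambda>j. to_Q (s j)) (z_poly \<rho> * G) = \<zero>\<^bsub>Q\<^esub>) \<and>
     hQ.seq_sum (\<lambda>j. to_Q (s j)) (bez \<rho>) = \<one>\<^bsub>Q\<^esub>"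

lemma residue_seq_exists: "\<exists>s. residue_seq s"
proof -
  define m where "m = t * n"
  define c where "c = (\<lambda>l. h (Polynomial.coeff \<rho> l))"
  have cc: "c l \<in> carrier A" for l by (simp add: c_def)
  have c0: "c l = \<zero>" if "l > Suc m" for l using unit_top_rho that by (simp add: unit_top_def c_def m_def)
  have cu: "c (Suc m) \<in> Units A" using unit_top_rho by (simp add: unit_top_def c_def m_def)
  obtain s where s: "\<And>j. s j \<in> carrier A" and s0: "\<And>i. i < m \<Longrightarrow> s i = \<zero>" and sm: "s m = inv (c (Suc m))"
    and rec: "\<And>j. (\<Oplus>l\<in>{..Suc m}. c l \<otimes> s (l + j)) = \<zero>"
    using linear_recurrence_exists[of c "inv (c (Suc m))" m] cc cu by auto
  have shift: "seq_sum (\<lambda>i. s (i + j)) \<rho> = \<zero>" for j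
  proof -
    define N where "N = max (Polynomial.degree \<rho>) (Suc m)"
    have "seq_sum (\<lambda>i. s (i + j)) \<rho> = (\<Oplus>l\<in>{..N}. c l \<otimes> s (l + j))"
      unfolding c_def by (rule seq_sum_bound) (auto simp: s N_def)
    also have "\<dots> = (\<Oplus>l\<in>{..Suc m}. c l \<otimes> s (l + j))"
      by (rule add.finprod_mono_neutral_cong_left[symmetric]) (auto simp: N_def c0 cc s)
    finally show ?thesis using rec by simp
  qed
  define b where "b = (\<lambda>i. h_Q (Polynomial.coeff (bez \<rho>) i))"
  have bc: "b i \<in> carrier Q" for i by (simp add: b_def)
  have b_rec: "b i = to_Q (c (Suc i)) \<oplus>\<^bsub>Q\<^esub> h_Q y_const \<otimes>\<^bsub>Q\<^esub> b (Suc i)" for i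
    unfolding b_def c_def by (subst coeff_bez) (simp only: hQ.h_add hQ.h_mult h_Q_const)
  \<comment> \<open>Over \<open>A\<close> the coefficients of \<open>\<rho>\<close> above degree \<open>m + 1\<close> vanish, hence so do those of its difference quotient
    above degree \<open>m\<close>; the induction descends from the degree of the latter over the universal ring.\<close>
  have b0: "b i = \<zero>\<^bsub>Q\<^esub>" if "i > m" "Polynomial.degree (bez \<rho>) < i + d" for i d
    using that
  proof (induction d arbitrary: i)
    case 0 then show ?case by (simp add: b_def coeff_eq_0 hQ.h_zero)
  next
    case (Suc d)
    then have "b (Suc i) = \<zero>\<^bsub>Q\<^esub>" by simp
    then show ?case using b_rec[of i] c0[of "Suc i"] Suc.prems by simp
  qed
  have b0: "b i = \<zero>\<^bsub>Q\<^esub>" if "i > m" for i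
    using b0[OF that, of "Suc (Polynomial.degree (bez \<rho>))"] by simp
  have bm: "b m = to_Q (c (Suc m))" using b_rec[of m] b0[of "Suc m"] cc by simp
  define N where "N = max (Polynomial.degree (bez \<rho>)) m"
  have "hQ.seq_sum (\<lambda>j. to_Q (s j)) (bez \<rho>) = (\<Oplus>\<^bsub>Q\<^esub>j\<in>{..N}. b j \<otimes>\<^bsub>Q\<^esub> to_Q (s j))"
    unfolding b_def by (rule hQ.seq_sum_bound) (auto simp: s N_def)
  also have "\<dots> = (\<Oplus>\<^bsub>Q\<^esub>j\<in>{..N}. if m = j then b j \<otimes>\<^bsub>Q\<^esub> to_Q (s j) else \<zero>\<^bsub>Q\<^esub>)"
  proof (rule Q.add.finprod_cong')
    fix j
    show "b j \<otimes>\<^bsub>Q\<^esub> to_Q (s j) = (if m = j then b j \<otimes>\<^bsub>Q\<^esub> to_Q (s j) else \<zero>\<^bsub>Q\<^esub>)"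
      using b0[of j] s0[of j] bc s by (cases "j < m"; cases "j = m") auto
  qed (auto simp: bc s)
  also have "\<dots> = b m \<otimes>\<^bsub>Q\<^esub> to_Q (s m)"
    using Q.add.finprod_singleton[of m "{..N}" "\<lambda>j. b j \<otimes>\<^bsub>Q\<^esub> to_Q (s j)"] bc s by (simp add: N_def)
  also have "\<dots> = to_Q (c (Suc m) \<otimes> inv (c (Suc m)))"
    unfolding bm sm by (rule to_Q.hom_mult[symmetric]) (use cu cc in auto)
  finally have 1: "hQ.seq_sum (\<lambda>j. to_Q (s j)) (bez \<rho>) = \<one>\<^bsub>Q\<^esub>" using cu by simp
  have 2: "seq_sum s (\<rho> * p) = \<zero>" for p by (rule seq_sum_recurrence) (simp_all add: s shift)
  have 3: "hQ.seq_sum (\<lambda>j. to_Q (s j)) (z_poly \<rho> * G) = \<zero>\<^bsub>Q\<^esub>" for G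
    by (rule hQ.seq_sum_recurrence) (simp_all add: s seq_sum_z_poly shift)
  show ?thesis unfolding residue_seq_def using s 1 2 3 by blast
qed

text \<open>The polynomials all of whose multiples are killed form an ideal, so it suffices to consider the
  generators, and for these the multiples by monomials.\<close>

lemma functional_kills_minors:
  assumes add: "additive_map Sxy A \<phi>"
    and lin: "\<And>a p. a \<in> carrier A \<Longrightarrow> p \<in> carrier Sxy \<Longrightarrow> \<phi> (const_xy a \<otimes>\<^bsub>Sxy\<^esub> p) = a \<otimes> \<phi> p"
    and kill: "\<And>l p. l \<le> t \<Longrightarrow> \<phi> (h_xy (f l * p)) = \<zero>"
    and p: "p \<in> minors"
  shows "\<phi> p = \<zero>"
proof -
  define Z where "Z = {p \<in> carrier Sxy. \<forall>q\<in>carrier Sxy. \<phi> (q \<otimes>\<^bsub>Sxy\<^esub> p) = \<zero>}"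
  have \<phi>a: "\<phi> (p \<oplus>\<^bsub>Sxy\<^esub> q) = \<phi> p \<oplus> \<phi> q" if "p \<in> carrier Sxy" "q \<in> carrier Sxy" for p q
    using add that by (auto simp: additive_map_def)
  have \<phi>0: "\<phi> \<zero>\<^bsub>Sxy\<^esub> = \<zero>" by (rule additive_zero[OF xy.UP_ring ring_axioms add])
  have mult: "q \<otimes>\<^bsub>Sxy\<^esub> p \<in> Z" if "p \<in> Z" "q \<in> carrier Sxy" for p q
    using that by (auto simp: Z_def xy.P.m_assoc[symmetric])
  have "ideal Z Sxy"
  proof (rule idealI)
    show "ring Sxy" by (rule xy.UP_ring)
    show "subgroup Z (add_monoid Sxy)"
    proof (rule xy.P.add.subgroupI)
      show "Z \<subseteq> carrier Sxy" by (auto simp: Z_def)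
      show "Z \<noteq> {}" using \<phi>0 by (auto simp: Z_def intro!: exI[of _ "\<zero>\<^bsub>Sxy\<^esub>"])
      show "\<ominus>\<^bsub>Sxy\<^esub> p \<in> Z" if "p \<in> Z" for p
        using mult[OF that, of "\<ominus>\<^bsub>Sxy\<^esub> \<one>\<^bsub>Sxy\<^esub>"] that by (simp add: Z_def xy.P.l_minus)
      show "p \<oplus>\<^bsub>Sxy\<^esub> q \<in> Z" if "p \<in> Z" "q \<in> Z" for p q
        using that by (auto simp: Z_def xy.P.r_distr \<phi>a)
    qed
    show "q \<otimes>\<^bsub>Sxy\<^esub> p \<in> Z" if "p \<in> Z" "q \<in> carrier Sxy" for p q using mult[OF that] .
    show "p \<otimes>\<^bsub>Sxy\<^esub> q \<in> Z" if "p \<in> Z" "q \<in> carrier Sxy" for p q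
      using mult[OF that] that by (simp add: xy.P.m_comm Z_def)
  qed
  moreover have "h_xy (f l) \<in> Z" if l: "l \<le> t" for l
  proof -
    have "\<phi> (q \<otimes>\<^bsub>Sxy\<^esub> h_xy (f l)) = \<zero>" if "q \<in> carrier Sxy" for q
      using that
    proof (induction q rule: Sxy_induct)
      case zero then show ?case by (simp add: \<phi>0)
    next
      case (add p q) then show ?case by (simp add: xy.P.l_distr \<phi>a)
    next
      case (monom a i j)
      let ?m = "Polynomial.monom (Polynomial.monom 1 j) i"
      have "const_xy a \<otimes>\<^bsub>Sxy\<^esub> h_xy ?m \<otimes>\<^bsub>Sxy\<^esub> h_xy (f l) = const_xy a \<otimes>\<^bsub>Sxy\<^esub> h_xy (f l * ?m)"
        using monom by (simp add: hxy.h_mult xy.P.m_ac)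
      then show ?case using monom kill[OF l] lin by simp
    qed
    then show ?thesis by (simp add: Z_def)
  qed
  ultimately have "minors \<subseteq> Z"
    unfolding minors_def by (intro xy.P.genideal_minimal) auto
  then show ?thesis using p by (auto simp: Z_def dest!: subsetD bspec[of _ _ "\<one>\<^bsub>Sxy\<^esub>"])
qed

text \<open>With \<open>\<mu>\<close> and \<open>B\<close> as in \<open>dual_data\<close> and \<open>\<lambda>\<close> a residue functional, the form with index \<open>(k, i)\<close> extends
  \<open>p \<mapsto> \<lambda>(y^i \<mu> k p)\<close>, and its dual vector is the coefficient of \<open>z^i\<close> in \<open>B k\<close>.  Applying \<open>\<lambda>\<close> in \<open>z\<close> to the
  identity of \<open>dual_data\<close> leaves only \<open>p\<close> on the right hand side, as \<open>\<lambda>\<close> sends the difference quotient of \<open>\<rho>\<close>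
  to \<open>1\<close>; on the left hand side it gives the expansion of \<open>p\<close>.\<close>

lemma dual_basis_exists:
  "\<exists>(J :: (nat \<times> nat) set) e \<psi>. finite_dual_basis A (restrict_scalars Q to_Q) J e \<psi>"
proof -
  obtain \<mu> B where
    \<mu>_add: "\<And>k p q. \<mu> k (p + q) = \<mu> k p + \<mu> k q" and
    \<mu>_smult: "\<And>k c p. \<mu> k (smult c p) = c * \<mu> k p" and
    \<mu>_dvd: "\<And>k l p. k < t \<Longrightarrow> l \<le> t \<Longrightarrow> \<rho> dvd \<mu> k (f l * p)" and
    B: "\<And>p. \<exists>G w. (\<Sum>k<t. B k * z_poly (\<mu> k p)) = bez \<rho> * [:p:] + z_poly \<rho> * G + (\<Sum>l\<le>t. [:f l:] * w l)"
    by (rule dual_data, rule that, assumption+)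
  obtain s where "residue_seq s" using residue_seq_exists by blast
  then have s: "\<And>j. s j \<in> carrier A" and s_rho: "\<And>p. seq_sum s (\<rho> * p) = \<zero>"
    and sQ_rho: "\<And>G. hQ.seq_sum (\<lambda>j. to_Q (s j)) (z_poly \<rho> * G) = \<zero>\<^bsub>Q\<^esub>"
    and sQ_bez: "hQ.seq_sum (\<lambda>j. to_Q (s j)) (bez \<rho>) = \<one>\<^bsub>Q\<^esub>"
    unfolding residue_seq_def by auto
  have sQ: "to_Q (s j) \<in> carrier Q" for j using s by simp
  define N where "N = (\<Sum>k<t. Polynomial.degree (B k))"
  have N: "Polynomial.degree (B k) \<le> N" if "k < t" for k
    unfolding N_def using that by (intro member_le_sum) auto
  define L where "L = (\<lambda>(k, i) p. seq_sum s (Polynomial.monom 1 i * \<mu> k p))"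
  define good where "good = (\<lambda>x \<phi>. additive_map Sxy A \<phi> \<and>
    (\<forall>a p. a \<in> carrier A \<longrightarrow> p \<in> carrier Sxy \<longrightarrow> \<phi> (const_xy a \<otimes>\<^bsub>Sxy\<^esub> p) = a \<otimes> \<phi> p) \<and>
    (\<forall>p. \<phi> (h_xy p) = L x p))"
  have "\<exists>\<phi>. good x \<phi>" for x
  proof -
    obtain k i where x: "x = (k, i)" by force
    have 1: "L x p \<in> carrier A" for p by (simp add: L_def x s)
    have 2: "L x (p + q) = L x p \<oplus> L x q" for p q
      by (simp add: L_def x \<mu>_add distrib_left seq_sum_add s)
    have 3: "L x ([:[:c:]:] * p) = h c \<otimes> L x p" for c p
      by (simp add: L_def x \<mu>_smult seq_sum_smult s)
    show ?thesis
    proof (rule functional_extension[of "L x", OF 1 2 3])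
      fix \<phi> assume "additive_map Sxy A \<phi>"
        "\<And>a p. a \<in> carrier A \<Longrightarrow> p \<in> carrier Sxy \<Longrightarrow> \<phi> (const_xy a \<otimes>\<^bsub>Sxy\<^esub> p) = a \<otimes> \<phi> p"
        "\<And>p. \<phi> (h_xy p) = L x p"
      then show ?thesis unfolding good_def by (intro exI[of _ \<phi>]) simp
    qed
  qed
  then obtain \<phi> where "\<And>x. good x (\<phi> x)" using choice[of good] by blast
  then have \<phi>: "additive_map Sxy A (\<phi> x)"
    and \<phi>s: "a \<in> carrier A \<Longrightarrow> p \<in> carrier Sxy \<Longrightarrow> \<phi> x (const_xy a \<otimes>\<^bsub>Sxy\<^esub> p) = a \<otimes> \<phi> x p"
    and \<phi>L: "\<phi> x (h_xy q) = L x q" for x a p q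
    unfolding good_def by blast+
  have \<phi>c: "\<phi> x p \<in> carrier A" if "p \<in> carrier Sxy" for x p using \<phi>[of x] that by (auto simp: additive_map_def)
  have \<phi>a: "\<phi> x (p \<oplus>\<^bsub>Sxy\<^esub> q) = \<phi> x p \<oplus> \<phi> x q" if "p \<in> carrier Sxy" "q \<in> carrier Sxy" for x p q
    using \<phi>[of x] that by (auto simp: additive_map_def)
  have \<phi>0: "\<phi> x \<zero>\<^bsub>Sxy\<^esub> = \<zero>" for x by (rule additive_zero[OF xy.UP_ring ring_axioms \<phi>])
  define J where "J = {..<t} \<times> {..N}"
  define e where "e = (\<lambda>(k, i). h_Q (Polynomial.coeff (B k) i))"
  have ec: "e x \<in> carrier Q" for x by (simp add: e_def split: prod.split)
  have kill: "\<phi> x p = \<zero>" if x: "x \<in> J" and p: "p \<in> minors" for x p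
  proof (rule functional_kills_minors[OF \<phi> \<phi>s _ p])
    fix l p assume l: "l \<le> t"
    obtain k i where x': "x = (k, i)" "k < t" using x by (auto simp: J_def)
    obtain q where "\<mu> k (f l * p) = \<rho> * q" using \<mu>_dvd[OF x'(2) l] by (auto elim: dvdE)
    then have "L x (f l * p) = seq_sum s (\<rho> * (Polynomial.monom 1 i * q))"
      by (simp add: L_def x' mult.left_commute)
    then show "\<phi> x (h_xy (f l * p)) = \<zero>" by (simp add: \<phi>L s_rho)
  qed auto
  \<comment> \<open>The functional \<open>\<phi> x\<close> is constant on the cosets that are the elements of \<open>Q\<close>.\<close>
  define \<psi> where "\<psi> = (\<lambda>x v. the_elem (\<phi> x ` v))"
  have \<psi>: "\<psi> x (proj p) = \<phi> x p" if x: "x \<in> J" and p: "p \<in> carrier Sxy" for x p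
  proof -
    have "\<phi> x q = \<phi> x p" if q: "q \<in> proj p" for q
    proof -
      from q obtain i where i: "i \<in> minors" "q = i \<oplus>\<^bsub>Sxy\<^esub> p"
        unfolding proj_def a_r_coset_def' by auto
      then show ?thesis using \<phi>a[of i p x] kill[OF x i(1)] p ideal.Icarr[OF minors_ideal i(1)] \<phi>c by simp
    qed
    moreover have "p \<in> proj p"
      unfolding proj_def using abelian_subgroup.a_rcos_self[OF abelian_subgroupI3[OF
          ideal.axioms(1)[OF minors_ideal] xy.P.abelian_group_axioms] p] .
    ultimately have "\<phi> x ` proj p = {\<phi> x p}" by blast
    then show ?thesis by (simp add: \<psi>_def)
  qed
  have surj: "\<exists>p\<in>carrier Sxy. v = proj p" if "v \<in> carrier Q" for v
    using that unfolding Q_def FactRing_def A_RCOSETS_def' proj_def by auto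
  have expand_h: "h_Q p = (\<Oplus>\<^bsub>Q\<^esub>x\<in>J. to_Q (\<phi> x (h_xy p)) \<otimes>\<^bsub>Q\<^esub> e x)" for p
  proof -
    let ?\<Theta> = "hQ.seq_sum (\<lambda>j. to_Q (s j))"
    have prod: "?\<Theta> (B k * z_poly q) = (\<Oplus>\<^bsub>Q\<^esub>i\<in>{..N}. to_Q (seq_sum s (Polynomial.monom 1 i * q)) \<otimes>\<^bsub>Q\<^esub> e (k, i))"
      if k: "k < t" for k q
    proof -
      have Bk: "(\<Sum>i\<le>N. Polynomial.monom (Polynomial.coeff (B k) i) i) = B k"
        by (rule poly_as_sum_of_monoms'[OF N[OF k]])
      have "B k * z_poly q = (\<Sum>i\<le>N. Polynomial.monom (Polynomial.coeff (B k) i) i) * z_poly q"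
        by (simp only: Bk)
      also have "\<dots> = (\<Sum>i\<le>N. Polynomial.monom (Polynomial.coeff (B k) i) i * z_poly q)"
        by (rule sum_distrib_right)
      also have "\<dots> = (\<Sum>i\<le>N. smult (Polynomial.coeff (B k) i) (z_poly (Polynomial.monom 1 i * q)))"
      proof (rule sum.cong[OF refl])
        fix i
        have "z_poly (Polynomial.monom 1 i :: 'r poly) = Polynomial.monom 1 i"
          by (rule poly_eqI) (simp add: pCons_one)
        then have "z_poly (Polynomial.monom 1 i * q) = Polynomial.monom 1 i * z_poly q"
          by (simp only: z_poly_mult)
        moreover have "Polynomial.monom (Polynomial.coeff (B k) i) i = smult (Polynomial.coeff (B k) i) (Polynomial.monom 1 i)"
          by (simp add: smult_monom)
        ultimately show "Polynomial.monom (Polynomial.coeff (B k) i) i * z_poly q =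
            smult (Polynomial.coeff (B k) i) (z_poly (Polynomial.monom 1 i * q))"
          by (simp only: mult_smult_left)
      qed
      finally have Bz: "B k * z_poly q = (\<Sum>i\<le>N. smult (Polynomial.coeff (B k) i) (z_poly (Polynomial.monom 1 i * q)))" .
      have "?\<Theta> (B k * z_poly q) =
          (\<Oplus>\<^bsub>Q\<^esub>i\<in>{..N}. ?\<Theta> (smult (Polynomial.coeff (B k) i) (z_poly (Polynomial.monom 1 i * q))))"
        unfolding Bz by (rule hQ.seq_sum_sum[OF sQ]) simp
      also have "\<dots> = (\<Oplus>\<^bsub>Q\<^esub>i\<in>{..N}. to_Q (seq_sum s (Polynomial.monom 1 i * q)) \<otimes>\<^bsub>Q\<^esub> e (k, i))"
        by (rule Q.add.finprod_cong') (auto simp: hQ.seq_sum_smult[OF sQ] seq_sum_z_poly s e_def Q.m_comm)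
      finally show ?thesis .
    qed
    obtain G w where eq: "(\<Sum>k<t. B k * z_poly (\<mu> k p)) = bez \<rho> * [:p:] + z_poly \<rho> * G + (\<Sum>l\<le>t. [:f l:] * w l)"
      using B by blast
    have "?\<Theta> (\<Sum>k<t. B k * z_poly (\<mu> k p)) = (\<Oplus>\<^bsub>Q\<^esub>k\<in>{..<t}. ?\<Theta> (B k * z_poly (\<mu> k p)))"
      by (rule hQ.seq_sum_sum[OF sQ]) simp
    also have "\<dots> = (\<Oplus>\<^bsub>Q\<^esub>k\<in>{..<t}. \<Oplus>\<^bsub>Q\<^esub>i\<in>{..N}. to_Q (\<phi> (k, i) (h_xy p)) \<otimes>\<^bsub>Q\<^esub> e (k, i))"
      by (rule Q.add.finprod_cong') (auto simp: prod \<phi>L L_def ec s)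
    also have "\<dots> = (\<Oplus>\<^bsub>Q\<^esub>x\<in>J. to_Q (\<phi> x (h_xy p)) \<otimes>\<^bsub>Q\<^esub> e x)"
      unfolding J_def by (rule Q.finsum_Times[symmetric]) (auto simp: ec \<phi>c)
    finally have lhs: "?\<Theta> (\<Sum>k<t. B k * z_poly (\<mu> k p)) = (\<Oplus>\<^bsub>Q\<^esub>x\<in>J. to_Q (\<phi> x (h_xy p)) \<otimes>\<^bsub>Q\<^esub> e x)" .
    have "?\<Theta> (\<Sum>l\<le>t. [:f l:] * w l) = (\<Oplus>\<^bsub>Q\<^esub>l\<in>{..t}. ?\<Theta> ([:f l:] * w l))"
      by (rule hQ.seq_sum_sum[OF sQ]) simp
    also have "\<dots> = \<zero>\<^bsub>Q\<^esub>"
      by (rule Q.add.finprod_one_eqI) (simp add: hQ.seq_sum_smult[OF sQ] h_Q_minor hQ.seq_sum_closed[OF sQ])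
    finally have f0: "?\<Theta> (\<Sum>l\<le>t. [:f l:] * w l) = \<zero>\<^bsub>Q\<^esub>" .
    have "?\<Theta> (bez \<rho> * [:p:]) = h_Q p"
      by (simp add: hQ.seq_sum_smult[OF sQ] sQ_bez)
    then have "?\<Theta> (bez \<rho> * [:p:] + z_poly \<rho> * G + (\<Sum>l\<le>t. [:f l:] * w l)) = h_Q p"
      by (simp only: hQ.seq_sum_add[OF sQ] f0 sQ_rho) simp
    then show ?thesis using lhs by (simp only: eq)
  qed
  have expand: "proj p = (\<Oplus>\<^bsub>Q\<^esub>x\<in>J. to_Q (\<phi> x p) \<otimes>\<^bsub>Q\<^esub> e x)" if "p \<in> carrier Sxy" for p
    using that
  proof (induction p rule: Sxy_induct)
    case zero
    have "(\<Oplus>\<^bsub>Q\<^esub>x\<in>J. to_Q (\<phi> x \<zero>\<^bsub>Sxy\<^esub>) \<otimes>\<^bsub>Q\<^esub> e x) = \<zero>\<^bsub>Q\<^esub>"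
      by (rule Q.add.finprod_one_eqI) (simp add: \<phi>0 ec)
    then show ?case by simp
  next
    case (add p q)
    have "(\<Oplus>\<^bsub>Q\<^esub>x\<in>J. to_Q (\<phi> x (p \<oplus>\<^bsub>Sxy\<^esub> q)) \<otimes>\<^bsub>Q\<^esub> e x) =
      (\<Oplus>\<^bsub>Q\<^esub>x\<in>J. to_Q (\<phi> x p) \<otimes>\<^bsub>Q\<^esub> e x \<oplus>\<^bsub>Q\<^esub> to_Q (\<phi> x q) \<otimes>\<^bsub>Q\<^esub> e x)"
      by (rule Q.add.finprod_cong') (use add in \<open>auto simp: \<phi>a \<phi>c ec Q.l_distr\<close>)
    also have "\<dots> = proj p \<oplus>\<^bsub>Q\<^esub> proj q"
      unfolding add.IH by (rule Q.finsum_addf) (use add in \<open>auto simp: \<phi>c ec\<close>)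
    finally show ?case using add by simp
  next
    case (monom a i j)
    let ?m = "Polynomial.monom (Polynomial.monom 1 j) i"
    have "proj (const_xy a \<otimes>\<^bsub>Sxy\<^esub> h_xy ?m) = to_Q a \<otimes>\<^bsub>Q\<^esub> h_Q ?m"
      using monom by (simp add: to_Q_def h_Q_def)
    also have "\<dots> = (\<Oplus>\<^bsub>Q\<^esub>x\<in>J. to_Q a \<otimes>\<^bsub>Q\<^esub> (to_Q (\<phi> x (h_xy ?m)) \<otimes>\<^bsub>Q\<^esub> e x))"
      unfolding expand_h[of ?m] by (rule Q.finsum_rdistr) (use monom in \<open>auto simp: J_def \<phi>c ec\<close>)
    also have "\<dots> = (\<Oplus>\<^bsub>Q\<^esub>x\<in>J. to_Q (\<phi> x (const_xy a \<otimes>\<^bsub>Sxy\<^esub> h_xy ?m)) \<otimes>\<^bsub>Q\<^esub> e x)"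
      by (rule Q.add.finprod_cong') (use monom in \<open>auto simp: \<phi>s \<phi>c ec Q.m_assoc\<close>)
    finally show ?case .
  qed
  let ?M = "restrict_scalars Q to_Q"
  have rs: "carrier ?M = carrier Q" "x \<oplus>\<^bsub>?M\<^esub> y = x \<oplus>\<^bsub>Q\<^esub> y" "a \<odot>\<^bsub>?M\<^esub> x = to_Q a \<otimes>\<^bsub>Q\<^esub> x" for x y a
    by (auto simp: restrict_scalars_def)
  have "finite_dual_basis A ?M J e \<psi>"
  proof (intro finite_dual_basis.intro finite_dual_basis_axioms.intro)
    show "Module.module A ?M" by (rule module_restrict_scalars[OF cring_axioms Q_cring to_Q_hom])
    show "finite J" by (simp add: J_def)
    show "e j \<in> carrier ?M" if "j \<in> J" for j by (simp add: rs ec)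
    show "\<psi> j v \<in> carrier A" if "j \<in> J" "v \<in> carrier ?M" for j v
      using surj[of v] that by (auto simp: rs \<psi> \<phi>c)
    show "\<psi> j (v \<oplus>\<^bsub>?M\<^esub> w) = \<psi> j v \<oplus> \<psi> j w" if j: "j \<in> J" and vw: "v \<in> carrier ?M" "w \<in> carrier ?M" for j v w
    proof -
      obtain p q where "p \<in> carrier Sxy" "q \<in> carrier Sxy" "v = proj p" "w = proj q"
        using surj[of v] surj[of w] vw by (auto simp: rs)
      then show ?thesis using \<psi>[OF j, of "p \<oplus>\<^bsub>Sxy\<^esub> q"] by (simp add: rs \<psi>[OF j] \<phi>a)
    qed
    show "\<psi> j (a \<odot>\<^bsub>?M\<^esub> v) = a \<otimes> \<psi> j v" if j: "j \<in> J" and a: "a \<in> carrier A" and v: "v \<in> carrier ?M" for j a v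
    proof -
      obtain p where "p \<in> carrier Sxy" "v = proj p" using surj[of v] v by (auto simp: rs)
      then show ?thesis using \<psi>[OF j, of "const_xy a \<otimes>\<^bsub>Sxy\<^esub> p"] a by (simp add: rs \<psi>[OF j] \<phi>s to_Q_def)
    qed
    show "v = (\<Oplus>\<^bsub>?M\<^esub>j\<in>J. \<psi> j v \<odot>\<^bsub>?M\<^esub> e j)" if v: "v \<in> carrier ?M" for v
    proof -
      obtain p where p: "p \<in> carrier Sxy" "v = proj p" using surj[of v] v by (auto simp: rs)
      have "(\<Oplus>\<^bsub>Q\<^esub>j\<in>J. to_Q (\<psi> j v) \<otimes>\<^bsub>Q\<^esub> e j) = (\<Oplus>\<^bsub>Q\<^esub>x\<in>J. to_Q (\<phi> x p) \<otimes>\<^bsub>Q\<^esub> e x)"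
        by (rule Q.add.finprod_cong') (use p in \<open>auto simp: \<psi> \<phi>c ec\<close>)
      then show ?thesis using expand[OF p(1)] p(2) by (simp add: rs)
    qed
  qed
  then show ?thesis by blast
qed

end

section \<open>The coordinate ring of the base\<close>

text \<open>Setting to zero all variables outside \<open>I\<close> is a retraction onto the polynomials in the remaining variables.
  Through it, homomorphisms from the coordinate ring of \<open>B\<close> become homomorphisms from the type of all
  polynomials, and being fixed by it is preserved by determinants and resultants.\<close>

definition restrict_vars :: "(nat \<times> nat \<times> nat) set \<Rightarrow> 'k::field apoly \<Rightarrow> 'k apoly" where
  "restrict_vars I p = Abs_poly_mapping (\<lambda>e. if Poly_Mapping.keys e \<subseteq> I then Poly_Mapping.lookup p e else 0)"

lemma lookup_restrict_vars:
  "Poly_Mapping.lookup (restrict_vars I p) e = (if Poly_Mapping.keys e \<subseteq> I then Poly_Mapping.lookup p e else 0)"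
proof -
  have "finite {e. (if Poly_Mapping.keys e \<subseteq> I then Poly_Mapping.lookup p e else 0) \<noteq> 0}"
    by (rule finite_subset[of _ "{e. Poly_Mapping.lookup p e \<noteq> 0}"]) auto
  then show ?thesis by (simp add: restrict_vars_def)
qed

lemma restrict_vars_single:
  "restrict_vars I (Poly_Mapping.single e c) = (if Poly_Mapping.keys e \<subseteq> I then Poly_Mapping.single e c else 0)"
  by (rule poly_mapping_eqI) (auto simp: lookup_restrict_vars lookup_single when_def)

lemma restrict_vars_add: "restrict_vars I (p + q) = restrict_vars I p + restrict_vars I q"
  by (rule poly_mapping_eqI) (auto simp: lookup_restrict_vars lookup_add)

lemma restrict_vars_zero: "restrict_vars I 0 = 0"
  by (rule poly_mapping_eqI) (auto simp: lookup_restrict_vars)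

lemma restrict_vars_iff: "restrict_vars I p = p \<longleftrightarrow> (\<forall>e\<in>Poly_Mapping.keys p. Poly_Mapping.keys e \<subseteq> I)"
  unfolding poly_mapping_eq_iff fun_eq_iff lookup_restrict_vars by (auto simp: in_keys_iff)

lemma restrict_vars_idem: "restrict_vars I (restrict_vars I p) = restrict_vars I p"
  by (rule poly_mapping_eqI) (auto simp: lookup_restrict_vars)

lemma poly_mapping_additive_induct [case_names zero add single]:
  fixes p :: "'a \<Rightarrow>\<^sub>0 'b::comm_monoid_add"
  assumes "P 0" "\<And>p q. P p \<Longrightarrow> P q \<Longrightarrow> P (p + q)" "\<And>e c. P (Poly_Mapping.single e c)"
  shows "P p"
proof -
  have "P (\<Sum>e\<in>I. Poly_Mapping.single e (Poly_Mapping.lookup p e))" for I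
    by (induction I rule: infinite_finite_induct) (auto intro: assms)
  moreover have "(\<Sum>e\<in>Poly_Mapping.keys p. Poly_Mapping.single e (Poly_Mapping.lookup p e)) = p"
    by (rule poly_mapping_eqI) (simp add: lookup_sum lookup_single when_def in_keys_iff)
  ultimately show ?thesis by metis
qed

lemma restrict_vars_mult: "restrict_vars I (p * q) = restrict_vars I p * restrict_vars I q"
proof (induction p rule: poly_mapping_additive_induct)
  case (single e c)
  show ?case
  proof (induction q rule: poly_mapping_additive_induct)
    case (single e' c')
    have "Poly_Mapping.keys (e + e') = Poly_Mapping.keys e \<union> Poly_Mapping.keys e'"
      by (auto simp: in_keys_iff lookup_add)
    then show ?case by (simp add: mult_single restrict_vars_single)
  qed (simp_all add: restrict_vars_zero restrict_vars_add distrib_left)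
qed (simp_all add: restrict_vars_zero restrict_vars_add distrib_right)

lemma restrict_vars_one: "restrict_vars I 1 = 1"
  unfolding restrict_vars_iff by simp

lemma comm_ring_hom_restrict_vars: "comm_ring_hom (restrict_vars I)"
  by unfold_locales (auto simp: restrict_vars_zero restrict_vars_one restrict_vars_add restrict_vars_mult)

context
  fixes t :: nat and m :: "nat \<Rightarrow> nat"
begin

abbreviation "\<pi> \<equiv> restrict_vars (a_index t m) :: 'k::field apoly \<Rightarrow> 'k apoly"

interpretation \<pi>: comm_ring_hom \<pi> by (rule comm_ring_hom_restrict_vars)
interpretation \<pi>y: map_poly_comm_ring_hom \<pi> ..
interpretation \<pi>xy: map_poly_comm_ring_hom "map_poly \<pi>" ..

lemma restrict_vars_a_entry:
  assumes "1 \<le> i" "i \<le> t + 1" "1 \<le> j" "j \<le> t"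
  shows "map_poly \<pi> (a_entry m i j :: 'k::field apoly poly) = a_entry m i j"
proof -
  have "\<pi> (a_var i j k) = (a_var i j k :: 'k apoly)" if "k < D_bound m i j" for k
    using assms that by (auto simp: a_var_def restrict_vars_single a_index_def)
  then show ?thesis by (simp add: a_entry_def \<pi>y.hom_sum map_poly_monom \<pi>.hom_zero)
qed

lemma restrict_vars_maximal_minor:
  assumes "l \<le> t"
  shows "map_poly (map_poly \<pi>) (maximal_minor t m l) = (maximal_minor t m l :: 'k::field apoly poly poly)"
proof -
  have lin: "map_poly (map_poly \<pi>) [:a, b:] = [:map_poly \<pi> a, map_poly \<pi> b:]" for a b :: "'k apoly poly"
    by (rule poly_eqI) (auto simp: coeff_map_poly coeff_pCons split: nat.split)
  have const: "map_poly (map_poly \<pi>) [:a:] = [:map_poly \<pi> a:]" for a :: "'k apoly poly"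
    by (rule poly_eqI) (auto simp: coeff_map_poly coeff_pCons split: nat.split)
  have M: "map_poly (map_poly \<pi>) (spread_out_matrix t m $$ (i, j)) = (spread_out_matrix t m $$ (i, j) :: 'k apoly poly poly)"
    if "i \<le> t" "j < t" for i j
    using that
    by (auto simp: spread_out_matrix_def Let_def restrict_vars_a_entry \<pi>y.hom_add map_poly_monom \<pi>.hom_zero \<pi>.hom_one
        lin const \<pi>y.hom_uminus \<pi>y.hom_one \<pi>y.hom_zero)
  have "map_mat (map_poly (map_poly \<pi>)) (mat t t (\<lambda>(i, j). spread_out_matrix t m $$ (insert_index l i, j))) =
     mat t t (\<lambda>(i, j). spread_out_matrix t m $$ (insert_index l i, j) :: 'k apoly poly poly)"
    using assms by (intro eq_matI) (auto simp: insert_index_def intro!: M)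
  then show ?thesis unfolding maximal_minor_def \<pi>xy.hom_det[symmetric] by simp
qed

lemma restrict_vars_coeff_minor:
  assumes "l \<le> t"
  shows "\<pi> (Polynomial.coeff (Polynomial.coeff (maximal_minor t m l) i) j) =
    (Polynomial.coeff (Polynomial.coeff (maximal_minor t m l) i) j :: 'k::field apoly)"
proof -
  have "\<pi> (Polynomial.coeff (Polynomial.coeff (maximal_minor t m l) i) j) =
      (Polynomial.coeff (Polynomial.coeff (map_poly (map_poly \<pi>) (maximal_minor t m l)) i) j :: 'k apoly)"
    by (simp add: coeff_map_poly restrict_vars_zero)
  then show ?thesis by (simp only: restrict_vars_maximal_minor[OF assms])
qed

lemma restrict_vars_coeff_res: "\<pi> (Polynomial.coeff (res_E t m) j) = (Polynomial.coeff (res_E t m) j :: 'k::field apoly)"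
proof -
  note fixed = restrict_vars_maximal_minor[of 0] restrict_vars_maximal_minor[of t]
  have "map_poly \<pi> (res_E t m) = (res_E t m :: 'k apoly poly)"
    using \<pi>y.resultant_map_poly[of "maximal_minor t m 0" "maximal_minor t m t"] unfolding res_E_def
    by (metis fixed order_refl zero_le)
  moreover have "\<pi> (Polynomial.coeff (res_E t m) j) = (Polynomial.coeff (map_poly \<pi> (res_E t m)) j :: 'k apoly)"
    by (simp add: coeff_map_poly restrict_vars_zero)
  ultimately show ?thesis by (simp only:)
qed

lemma carrier_base_ring: "carrier (base_ring t m :: 'k::field apoly ring) = {p. \<pi> p = p}"
  by (simp add: base_ring_def restrict_vars_iff)

lemma base_ring_ops:
  "x \<oplus>\<^bsub>base_ring t m\<^esub> y = x + y" "x \<otimes>\<^bsub>base_ring t m\<^esub> y = x * y"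
  "\<one>\<^bsub>base_ring t m\<^esub> = 1" "\<zero>\<^bsub>base_ring t m\<^esub> = 0" for x y :: "'k::field apoly"
  by (simp_all add: base_ring_def ring_of_type_algebra_def)

lemma cring_base_ring: "cring (base_ring t m :: 'k::field apoly ring)"
proof (intro cringI abelian_groupI comm_monoidI)
  fix x :: "'k apoly" assume "x \<in> carrier (base_ring t m)"
  then show "\<exists>y\<in>carrier (base_ring t m). y \<oplus>\<^bsub>base_ring t m\<^esub> x = \<zero>\<^bsub>base_ring t m\<^esub>"
    by (intro bexI[of _ "- x"]) (auto simp: carrier_base_ring base_ring_ops \<pi>.hom_uminus)
qed (auto simp: carrier_base_ring base_ring_ops \<pi>.hom_add \<pi>.hom_mult \<pi>.hom_one \<pi>.hom_zero algebra_simps)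

interpretation base: cring "base_ring t m :: 'k::field apoly ring" by (rule cring_base_ring)

lemma ideal_S_ideal: "ideal (S_ideal t m) (base_ring t m :: 'k::field apoly ring)"
  unfolding S_ideal_def by (rule base.genideal_ideal) (auto simp: carrier_base_ring restrict_vars_coeff_res)

lemma cring_Quot_S_ideal: "cring (base_ring t m Quot S_ideal t m :: 'k::field apoly set ring)"
  by (rule ideal.quotient_is_cring[OF ideal_S_ideal cring_base_ring])

lemma coset_hom: "(\<lambda>p. S_ideal t m +>\<^bsub>base_ring t m\<^esub> p) \<in>
    Ring.ring_hom (base_ring t m :: 'k::field apoly ring) (base_ring t m Quot S_ideal t m)"
  by (rule ideal.rcos_ring_hom[OF ideal_S_ideal])

lemma mult_subset_S_denominators:
  "mult_subset (base_ring t m Quot S_ideal t m) (S_denominators t m :: 'k::field apoly set set)"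
proof -
  interpret q: cring "base_ring t m Quot S_ideal t m :: 'k apoly set ring" by (rule cring_Quot_S_ideal)
  let ?c = "S_ideal t m +>\<^bsub>base_ring t m\<^esub> (Polynomial.coeff (res_E t m) (t * m t) :: 'k apoly)"
  have c: "?c \<in> carrier (base_ring t m Quot S_ideal t m)"
    by (rule ring_hom_closed[OF coset_hom]) (simp add: carrier_base_ring restrict_vars_coeff_res)
  show ?thesis
  proof
    show "S_denominators t m \<subseteq> carrier (base_ring t m Quot S_ideal t m :: 'k apoly set ring)"
      using c unfolding S_denominators_def by auto
    show "\<one>\<^bsub>base_ring t m Quot S_ideal t m\<^esub> \<in> (S_denominators t m :: 'k apoly set set)"
      unfolding S_denominators_def by (rule range_eqI[of _ _ 0]) simp
    show "w \<otimes>\<^bsub>base_ring t m Quot S_ideal t m\<^esub> v \<in> S_denominators t m"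
      if "w \<in> S_denominators t m" "v \<in> S_denominators t m" for w v :: "'k apoly set"
      using that c unfolding S_denominators_def by (auto simp: q.nat_pow_mult)
  qed
qed

interpretation loc: mult_subset "base_ring t m Quot S_ideal t m" "S_denominators t m :: 'k::field apoly set set"
  by (rule mult_subset_S_denominators)

lemma cring_S_ring: "cring (S_ring t m :: 'k::field S_elem ring)"
  unfolding S_ring_def by (rule loc.localization_cring)

lemma to_S_hom: "to_S t m \<in> Ring.ring_hom (base_ring t m :: 'k::field apoly ring) (S_ring t m)"
  using ring_hom_trans[OF coset_hom loc.fraction_hom] by (simp add: S_ring_def to_S_def[abs_def] comp_def)

lemma type_ring_hom_S: "type_ring_hom (S_ring t m) (\<lambda>p :: 'k::field apoly. to_S t m (\<pi> p))"
proof -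
  interpret S: cring "S_ring t m :: 'k S_elem ring" by (rule cring_S_ring)
  have \<pi>: "\<pi> p \<in> carrier (base_ring t m)" for p :: "'k apoly"
    by (simp add: carrier_base_ring restrict_vars_idem)
  show ?thesis
  proof
    fix c d :: "'k apoly"
    show "to_S t m (\<pi> c) \<in> carrier (S_ring t m)" using ring_hom_closed[OF to_S_hom \<pi>] .
    show "to_S t m (\<pi> (c + d)) = to_S t m (\<pi> c) \<oplus>\<^bsub>S_ring t m\<^esub> to_S t m (\<pi> d)"
      using ring_hom_add[OF to_S_hom \<pi> \<pi>, of c d] by (simp add: \<pi>.hom_add base_ring_ops)
    show "to_S t m (\<pi> (c * d)) = to_S t m (\<pi> c) \<otimes>\<^bsub>S_ring t m\<^esub> to_S t m (\<pi> d)"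
      using ring_hom_mult[OF to_S_hom \<pi> \<pi>, of c d] by (simp add: \<pi>.hom_mult base_ring_ops)
    show "to_S t m (\<pi> 1) = (\<one>\<^bsub>S_ring t m\<^esub> :: 'k S_elem)"
      using ring_hom_one[OF to_S_hom] by (simp add: \<pi>.hom_one base_ring_ops)
  qed
qed

text \<open>This is what distinguishes \<open>S\<close>: the coefficients above \<open>t * m t\<close> lie in the ideal of the closed subscheme,
  and the coefficient of \<open>y^(t * m t)\<close> is inverted.\<close>

lemma unit_top_res_E:
  "type_ring_hom.unit_top (S_ring t m) (\<lambda>p :: 'k::field apoly. to_S t m (\<pi> p)) (res_E t m) (t * m t)"
proof -
  interpret S: type_ring_hom "S_ring t m" "\<lambda>p :: 'k apoly. to_S t m (\<pi> p)" by (rule type_ring_hom_S)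
  have "to_S t m (Polynomial.coeff (res_E t m) i) = (\<zero>\<^bsub>S_ring t m\<^esub> :: 'k S_elem)" if "i > t * m t" for i
  proof -
    have "(Polynomial.coeff (res_E t m) i :: 'k apoly) \<in> S_ideal t m"
      unfolding S_ideal_def
      by (rule subsetD[OF base.genideal_self]) (use that in \<open>auto simp: carrier_base_ring restrict_vars_coeff_res\<close>)
    then have "S_ideal t m +>\<^bsub>base_ring t m\<^esub> (Polynomial.coeff (res_E t m) i :: 'k apoly) = S_ideal t m"
      by (rule base.a_rcos_zero[OF ideal_S_ideal])
    also have "\<dots> = \<zero>\<^bsub>base_ring t m Quot S_ideal t m\<^esub>" by (simp add: FactRing_def)
    finally show ?thesis by (simp add: to_S_def S_ring_def loc.zero_localization)
  qed
  moreover have "to_S t m (Polynomial.coeff (res_E t m) (t * m t)) \<in> Units (S_ring t m :: 'k S_elem ring)"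
    unfolding to_S_def S_ring_def
  proof (rule loc.fraction_Units)
    have "S_ideal t m +>\<^bsub>base_ring t m\<^esub> (Polynomial.coeff (res_E t m) (t * m t) :: 'k apoly)
        \<in> carrier (base_ring t m Quot S_ideal t m)"
      by (rule ring_hom_closed[OF coset_hom]) (simp add: carrier_base_ring restrict_vars_coeff_res)
    then show "S_ideal t m +>\<^bsub>base_ring t m\<^esub> (Polynomial.coeff (res_E t m) (t * m t) :: 'k apoly) \<in> S_denominators t m"
      unfolding S_denominators_def by (intro range_eqI[of _ _ "1::nat"]) (simp add: loc.nat_pow_eone)
  qed
  ultimately show ?thesis by (simp add: S.unit_top_def restrict_vars_coeff_res)
qed

end

section \<open>Finiteness and flatness over S\<close>

theorem corollary7p5:
  fixes E :: "'k::field poly poly set" and d t :: nat and m :: "nat \<Rightarrow> nat"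
  assumes "d \<ge> 1" and "t \<ge> 1"
    and "m 0 = 0" and "\<And>i. i < t \<Longrightarrow> m i \<le> m (Suc i)"
    and "E = monomial_ideal t m" and "has_colength E d"
  shows
    "finite_ring_hom (S_ring t m) (family_ring t m)
       (pi_S t m :: 'k S_elem \<Rightarrow> (nat \<Rightarrow> nat \<Rightarrow> 'k S_elem) set) \<and>
     flat_ring_hom TYPE('p) TYPE('n) (S_ring t m) (family_ring t m)
       (pi_S t m :: 'k S_elem \<Rightarrow> (nat \<Rightarrow> nat \<Rightarrow> 'k S_elem) set)"
proof -
  define f where "f = (maximal_minor t m :: nat \<Rightarrow> 'k apoly poly poly)"
  define h where "h = (\<lambda>p :: 'k apoly. to_S t m (restrict_vars (a_index t m) p))"
  obtain \<chi> :: "'k apoly poly poly" where \<chi>: "f 0 = (- 1) ^ t * \<chi>" "lead_coeff \<chi> = 1" "Polynomial.degree \<chi> = t"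
    unfolding f_def by (rule maximal_minor_0)
  have "(- 1) ^ t * f 0 = ((- 1) ^ t * (- 1) ^ t) * \<chi>" unfolding \<chi>(1) by (simp only: mult.assoc)
  then have \<chi>': "\<chi> = (- 1) ^ t * f 0" by simp
  have "Polynomial.degree (f 0) = t"
    unfolding \<chi>(1) using \<chi>(3) by (cases "even t") auto
  then have r: "\<exists>a b. [:res_E t m:] = a * f 0 + b * f t"
    unfolding res_E_def f_def using \<open>t \<ge> 1\<close> by (intro resultant_in_ideal) simp
  interpret type_ring_hom "S_ring t m" h unfolding h_def by (rule type_ring_hom_S)
  interpret unit_resultant_family "S_ring t m" h f t \<chi> "res_E t m" "t * m t"
  proof
    show "\<chi> dvd f 0" unfolding \<chi>(1) by simp
    show "f 0 dvd \<chi>" unfolding \<chi>' by simp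
    show "\<exists>c. [:0, 1:] * f l = (\<Sum>i\<le>t. [:c i:] * f i)" if "l \<in> {1..t}" for l
      unfolding f_def by (rule x_mult_maximal_minor[OF that])
    show "unit_top (res_E t m) (t * m t)" unfolding h_def by (rule unit_top_res_E)
  qed (use \<chi> r in auto)
  have fl: "h_xy (f l) = (\<lambda>i j. to_S t m (Polynomial.coeff (Polynomial.coeff (maximal_minor t m l) i) j))"
    if "l \<le> t" for l
    unfolding h_xy_def by (intro ext) (simp only: h_def f_def restrict_vars_coeff_minor[OF that])
  have "{h_xy (f l) | l. l \<le> t} =
      {(\<lambda>i j. to_S t m (Polynomial.coeff (Polynomial.coeff (maximal_minor t m l) i) j)) | l. l \<le> t}"
    unfolding setcompr_eq_image by (rule image_cong) (auto simp only: fl)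
  then have minors: "minors = minors_S t m" by (simp add: minors_def minors_S_def)
  then have Q: "Q = family_ring t m" by (simp add: Q_def family_ring_def)
  have pi: "to_Q = pi_S t m" by (simp add: fun_eq_iff to_Q_def proj_def pi_S_def minors const_xy_def)
  obtain J :: "(nat \<times> nat) set" and e \<psi> where "finite_dual_basis (S_ring t m) (restrict_scalars Q to_Q) J e \<psi>"
    using dual_basis_exists by blast
  then interpret finite_dual_basis "S_ring t m" "restrict_scalars Q to_Q" J e \<psi> .
  show ?thesis
    unfolding finite_ring_hom_def flat_ring_hom_def
    using cring_axioms Q_cring to_Q_hom finite_module flat_module unfolding Q pi by blast
qed

end
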